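(* Let $d=\prod_{j=1}^{k}p_j^{s_j}$ with $p_1<p_2<\dots<p_k$ primes, $k\ge1$ and $s_j\ge1$. Let $\mathbf{K}=\{j: s_j \text{ odd}\}$. Consider the following factorizations $d=\prod_{u}d_u$ and the corresponding Hilbert spaces $\bigotimes_u\mathbb{C}^{d_u}$: (a) $d=\prod_{u=1}^{\ell'}d'_u$, obtained by writing each $p_j^{s_j}$ as a product of $s_j/2$ factors $p_j^2$ if $s_j$ is even, and as a product of $(s_j-1)/2$ factors $p_j^2$ and one factor $p_j$ if $s_j$ is odd; $\mathcal{H}'=\bigotimes_{u}\mathbb{C}^{d'_u}$; (b) in case $\mathbf{K}\neq\emptyset$ and $\#\mathbf{K}$ is even: $d=\prod_t d''_t$, obtained from (a) by grouping the single factors $p_j$, $j\in\mathbf{K}$, into disjoint pairs and replacing each pair by the product $p_jp_{j'}$ (so each $d''_t$ is some $p_j^2$ or some $p_jp_{j'}$ with $j\ne j'$ in $\mathbf{K}$); $\mathcal{H}''=\bigotimes_t\mathbb{C}^{d''_t}$; (c) in case $\#\mathbf{K}$ is odd: $d=\prod_r d'''_r$, obtained from (a) by leaving one single factor $p_{j_0}$, $j_0\in\mathbf{K}$, and grouping the other single factors into disjoint pairs as in (b); $\mathcal{H}'''=\bigotimes_r\mathbb{C}^{d'''_r}$. Then in each of the scenarios (a), (b), (c), the set of all tensor products $\bigotimes_uP_u$ with $P_u\in\mathcal{P}^{(d_u)}$ (families defined in the context) is an informationally complete system of $d^2$ rank one projections on the corresponding $d$-dimensional Hilbert space. Further, in case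 (a), the set of quantum mechanical overlaps $\{\mathrm{tr}(PP')\}$, with $P,P'$ ranging over this system, is $\{0\}\cup\{1/d': d' \text{ a positive divisor of } d\}$.
   Context: A set of rank one projections on a Hilbert space of finite dimension $n$ is informationally complete if it spans the algebra of all operators on it (equivalently, every operator $\rho$ is determined by the numbers $\mathrm{tr}(\rho P)$). For $n\ge2$ let $\{|k\rangle:k\in\mathbb{Z}_n\}$ be the standard basis of $\mathbb{C}^n$, $\eta_n=e^{2\pi i/n}$, and $U_{m,m'}|k\rangle=\eta_n^{mk}|m'+k\rangle$ for $m,m'\in\mathbb{Z}_n$. The families $\mathcal{P}^{(n)}$ of $n^2$ rank one projections on $\mathbb{C}^n$, for $n=p,p^2,pa$ with $p<a$ primes, are: 1. $n=p$ prime: all eigenprojections $|k\rangle\langle k|$ of $U_{1,0}$, together with, for each $0\le j\le p-1$, all but one of the $p$ rank one eigenprojections of $U_{j,1}$ (these $p+1$ eigenbases are mutually unbiased). 2. $n=p^2$, $p$ prime: for $0\le r,a\le p-1$ let $P(r,a;c,s)$, $0\le c,s\le p-1$, be the rank one eigenprojection of $U_{ap+r,1}$ for the simple eigenvalue $e^{\pi i(ap+r)(p-1)/p^2}e^{2\pi ic/p^2}e^{2\pi is/p}$. For $1\le b\le p-1$, $0\le t\le p-1$, $U_{1,bp}$ preserves the span $E_t$ of $\{|vp+t\rangle:0\le v\le p-1\}$ and has $p$ simple eigenvalues there, for $p$ odd $e^{2\pi it/p^2}e^{2\pi is/p}$, $0\le s\le p-1$, and for $p=2$ labelled by $s=0,1$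 in either order; $P_{b,t,s}$ is the corresponding rank one eigenprojection. Then $\mathcal{P}^{(p^2)}$ consists of all $|j\rangle\langle j|$, $0\le j\le p^2-1$; all $P_{b,t,s}$ with $1\le b\le p-1$, $0\le t\le p-1$, $1\le s\le p-1$; all $P(r,0;c,s)$ with $0\le r,c,s\le p-1$, $(c,s)\ne(0,0)$; and all $P(r,a;c,s)$ with $0\le r,c\le p-1$, $1\le a,s\le p-1$. 3. $n=2a$, $a$ odd prime: for $0\le t\le a-1$ put $j_t=t$, $k_t=a+t$, $g_t=t$ for $t$ odd and $j_t=a+t$, $k_t=t$, $g_t=a+t$ for $t$ even. Let $\Sigma$ consist of $(1,0)$, $(a+1,a)$, $(1,a)$ and all $(j_t,a+1)$, $(k_t,1)$, $(g_t,1)$, $0\le t\le a-1$. For $\sigma=(m,m')\in\Sigma$ let $P_{\sigma,k}$ be the rank one eigenprojection of $U_\sigma$ for the simple eigenvalue $\varepsilon_\sigma e^{\pi ik/a}$, $0\le k\le 2a-1$, with $\varepsilon_\sigma=1$ if $mm'$ is even and $e^{\pi i/(2a)}$ if $mm'$ is odd. $\mathcal{P}^{(2a)}$ consists of all $P_{(1,0),k}$; $P_{(0,1),k}$ and $P_{(1,1),k}$ for $k\le 2a-2$; $P_{(j_t,a+1),k}$ for $k\le2a-3$, $2\le t\le a-1$; and $P_{\sigma,k}$, $k\le a-2$, for all other $\sigma\in\Sigma$. 4. $n=pa$, $p<a$ odd primes: let $m_{b,t}\in\{0,\dots,pa-1\}$ be determined by $m_{b,t}\equiv b\pmod a$, $m_{b,t}\equiv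 t\pmod p$. Let $\Sigma$ consist of $(1,0)$, $(m_{b,t},1)$, $(m_{1,t},m_{0,1})$, $(m_{b,1},m_{1,0})$, $0\le b\le a-1$, $0\le t\le p-1$, and let $P_{\sigma,k}$ be the rank one eigenprojection of $U_\sigma$ for the simple eigenvalue $\eta_n^k$, $0\le k\le pa-1$. $\mathcal{P}^{(pa)}$ consists of all $P_{(1,0),k}$; $P_{(b,1),k}$, $k\le pa-2$, for $0\le b\le p-1$; $P_{(b,1),k}$, $k\le p(a-1)-1$, for $p\le b\le a-1$; and $P_{\sigma,k}$ with $k=m_{b',t'}$, $0\le b'\le a-2$, $0\le t'\le p-2$, for all other $\sigma\in\Sigma$. *)

theory Defs
  imports
    "Jordan_Normal_Form.Schur_Decomposition"
    "Jordan_Normal_Form.DL_Rank"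
    "HOL-Number_Theory.Cong"
    "HOL-Library.Disjoint_Sets"
begin

text \<open>Operators on \<open>\<complex>\<^sup>n\<close> are the complex \<open>n \<times> n\<close> matrices, the standard basis being
  \<^term>\<open>unit_vec n k\<close> for \<open>k < n\<close>.\<close>

definition orth_projection :: "nat \<Rightarrow> complex mat \<Rightarrow> bool" where
  "orth_projection n P \<longleftrightarrow> P \<in> carrier_mat n n \<and> P * P = P \<and> mat_adjoint P = P"

definition rank_one_projection :: "nat \<Rightarrow> complex mat \<Rightarrow> bool" where
  "rank_one_projection n P \<longleftrightarrow> orth_projection n P \<and> vec_space.rank n P = 1"

definition informationally_complete :: "nat \<Rightarrow> complex mat set \<Rightarrow> bool" where
  "informationally_complete n S \<longleftrightarrow>
     LinearCombinations.module.span class_ring (module_mat TYPE(complex) n n) S = carrier_mat n n"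

definition info_complete_system :: "nat \<Rightarrow> complex mat set \<Rightarrow> bool" where
  "info_complete_system d S \<longleftrightarrow>
     card S = d\<^sup>2 \<and> (\<forall>P\<in>S. rank_one_projection d P) \<and> informationally_complete d S"

definition mat_trace :: "complex mat \<Rightarrow> complex" where
  "mat_trace A = (\<Sum>i<dim_row A. A $$ (i, i))"

definition overlaps :: "complex mat set \<Rightarrow> complex set" where
  "overlaps S = {mat_trace (P * Q) | P Q. P \<in> S \<and> Q \<in> S}"

text \<open>Kronecker product: \<open>\<complex>\<^sup>m \<otimes> \<complex>\<^sup>n\<close> is identified with \<open>\<complex>\<^sup>m\<^sup>n\<close> by
  \<open>|i\<rangle> \<otimes> |j\<rangle> \<mapsto> |i n + j\<rangle>\<close>.\<close>

definition tensor_mat :: "complex mat \<Rightarrow> complex mat \<Rightarrow> complex mat" where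
  "tensor_mat A B = mat (dim_row A * dim_row B) (dim_col A * dim_col B)
     (\<lambda>(i, j). A $$ (i div dim_row B, j div dim_col B) * B $$ (i mod dim_row B, j mod dim_col B))"

definition tensor_list :: "complex mat list \<Rightarrow> complex mat" where
  "tensor_list Ps = foldr tensor_mat Ps (1\<^sub>m 1)"

definition tensor_system :: "(nat \<Rightarrow> complex mat set) \<Rightarrow> nat list \<Rightarrow> complex mat set" where
  "tensor_system Fam ds = {tensor_list Ps | Ps. list_all2 (\<lambda>P n. P \<in> Fam n) Ps ds}"

definition ket_proj :: "nat \<Rightarrow> nat \<Rightarrow> complex mat" where
  "ket_proj n k = mat n n (\<lambda>(i, j). if i = k \<and> j = k then 1 else 0)"

definition weyl :: "nat \<Rightarrow> nat \<Rightarrow> nat \<Rightarrow> complex mat" where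
  "weyl n m m' = mat n n (\<lambda>(i, k). if i = (m' + k) mod n then cis (2 * pi / real n) ^ (m * k) else 0)"

text \<open>Every subspace is the range of exactly one orthogonal projection, so the
  description below is proper for each subspace \<open>W\<close>.\<close>

definition projection_onto :: "nat \<Rightarrow> complex vec set \<Rightarrow> complex mat" where
  "projection_onto n W =
     (THE P. orth_projection n P \<and> {P *\<^sub>v v | v. v \<in> carrier_vec n} = W)"

definition eigenspace :: "complex mat \<Rightarrow> complex \<Rightarrow> complex vec set" where
  "eigenspace A z = {v \<in> carrier_vec (dim_row A). A *\<^sub>v v = z \<cdot>\<^sub>v v}"

definition eigenproj :: "complex mat \<Rightarrow> complex \<Rightarrow> complex mat" where
  "eigenproj A z = projection_onto (dim_row A) (eigenspace A z)"

definition rank_one_eigenprojs :: "complex mat \<Rightarrow> complex mat set" where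
  "rank_one_eigenprojs A =
     {eigenproj A z | z. eigenvalue A z \<and> rank_one_projection (dim_row A) (eigenproj A z)}"

text \<open>The omitted eigenprojections \<open>Q j\<close> are arbitrary, so this is a predicate on families.\<close>

definition prime_family :: "nat \<Rightarrow> complex mat set \<Rightarrow> bool" where
  "prime_family p F \<longleftrightarrow>
     (\<exists>Q. (\<forall>j<p. Q j \<in> rank_one_eigenprojs (weyl p j 1)) \<and>
          F = {ket_proj p k | k. k < p} \<union> (\<Union>j<p. rank_one_eigenprojs (weyl p j 1) - {Q j}))"

definition proj_rcs :: "nat \<Rightarrow> nat \<Rightarrow> nat \<Rightarrow> nat \<Rightarrow> nat \<Rightarrow> complex mat" where
  "proj_rcs p r a c s = eigenproj (weyl (p\<^sup>2) (a * p + r) 1)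
     (cis (pi * real (a * p + r) * (real p - 1) / (real p)\<^sup>2) *
      cis (2 * pi * real c / (real p)\<^sup>2) * cis (2 * pi * real s / real p))"

definition residue_span :: "nat \<Rightarrow> nat \<Rightarrow> complex vec set" where
  "residue_span p t = LinearCombinations.module.span class_ring (module_vec TYPE(complex) (p\<^sup>2))
     {unit_vec (p\<^sup>2) (v * p + t) | v. v < p}"

text \<open>\<open>\<mu> b t s\<close> is the eigenvalue of \<^term>\<open>weyl (p\<^sup>2) 1 (b * p)\<close> on \<^term>\<open>residue_span p t\<close>
  with label \<open>s\<close>; for \<open>p = 2\<close> the two labels may be assigned in either order.\<close>

definition eigen_labelling :: "nat \<Rightarrow> (nat \<Rightarrow> nat \<Rightarrow> nat \<Rightarrow> complex) \<Rightarrow> bool" where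
  "eigen_labelling p \<mu> \<longleftrightarrow> (\<forall>b\<in>{1..p-1}. \<forall>t\<in>{0..p-1}.
     if p = 2
     then bij_betw (\<mu> b t) {0, 1}
            {z. \<exists>v\<in>residue_span p t. eigenvector (weyl (p\<^sup>2) 1 (b * p)) v z}
     else \<forall>s\<in>{0..p-1}. \<mu> b t s = cis (2 * pi * real t / (real p)\<^sup>2) * cis (2 * pi * real s / real p))"

definition prime_square_family :: "nat \<Rightarrow> complex mat set \<Rightarrow> bool" where
  "prime_square_family p F \<longleftrightarrow> (\<exists>\<mu>. eigen_labelling p \<mu> \<and>
     F = {ket_proj (p\<^sup>2) j | j. j \<le> p\<^sup>2 - 1}
       \<union> {projection_onto (p\<^sup>2) (residue_span p t \<inter> eigenspace (weyl (p\<^sup>2) 1 (b * p)) (\<mu> b t s)) | b t s.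
            b \<in> {1..p-1} \<and> t \<in> {0..p-1} \<and> s \<in> {1..p-1}}
       \<union> {proj_rcs p r 0 c s | r c s.
            r \<in> {0..p-1} \<and> c \<in> {0..p-1} \<and> s \<in> {0..p-1} \<and> (c, s) \<noteq> (0, 0)}
       \<union> {proj_rcs p r a c s | r a c s.
            r \<in> {0..p-1} \<and> c \<in> {0..p-1} \<and> a \<in> {1..p-1} \<and> s \<in> {1..p-1}})"

text \<open>The constants named \<open>even_\<close> concern dimension \<open>2 a\<close> with \<open>a\<close> an odd prime, those named
  \<open>odd_\<close> dimension \<open>p a\<close> with odd primes \<open>p < a\<close>. The formulas for \<open>even_j\<close> and \<open>even_g\<close> coincide;
  they occur with different second components in \<open>even_Sigma\<close>.\<close>

definition even_j :: "nat \<Rightarrow> nat \<Rightarrow> nat" where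
  "even_j a t = (if odd t then t else a + t)"

definition even_k :: "nat \<Rightarrow> nat \<Rightarrow> nat" where
  "even_k a t = (if odd t then a + t else t)"

definition even_g :: "nat \<Rightarrow> nat \<Rightarrow> nat" where
  "even_g a t = (if odd t then t else a + t)"

definition even_Sigma :: "nat \<Rightarrow> (nat \<times> nat) set" where
  "even_Sigma a = {(1, 0), (a + 1, a), (1, a)}
     \<union> {(even_j a t, a + 1) | t. t \<in> {0..a-1}}
     \<union> {(even_k a t, 1) | t. t \<in> {0..a-1}}
     \<union> {(even_g a t, 1) | t. t \<in> {0..a-1}}"

definition even_proj :: "nat \<Rightarrow> nat \<times> nat \<Rightarrow> nat \<Rightarrow> complex mat" where
  "even_proj a \<sigma> k = (case \<sigma> of (m, m') \<Rightarrow> eigenproj (weyl (2 * a) m m')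
     ((if even (m * m') then 1 else cis (pi / (2 * real a))) * cis (pi * real k / real a)))"

definition even_family :: "nat \<Rightarrow> complex mat set" where
  "even_family a =
     {even_proj a (1, 0) k | k. k \<le> 2 * a - 1}
   \<union> {even_proj a \<sigma> k | \<sigma> k. \<sigma> \<in> {(0, 1), (1, 1)} \<and> k \<le> 2 * a - 2}
   \<union> {even_proj a (even_j a t, a + 1) k | t k. t \<in> {2..a-1} \<and> k \<le> 2 * a - 3}
   \<union> {even_proj a \<sigma> k | \<sigma> k.
        \<sigma> \<in> even_Sigma a - {(1, 0), (0, 1), (1, 1)} - {(even_j a t, a + 1) | t. t \<in> {2..a-1}}
        \<and> k \<le> a - 2}"

definition crt_index :: "nat \<Rightarrow> nat \<Rightarrow> nat \<Rightarrow> nat \<Rightarrow> nat" where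
  "crt_index p a b t = (THE m. m < p * a \<and> [m = b] (mod a) \<and> [m = t] (mod p))"

definition odd_Sigma :: "nat \<Rightarrow> nat \<Rightarrow> (nat \<times> nat) set" where
  "odd_Sigma p a = {(1, 0)}
     \<union> {(crt_index p a b t, 1) | b t. b \<in> {0..a-1} \<and> t \<in> {0..p-1}}
     \<union> {(crt_index p a 1 t, crt_index p a 0 1) | t. t \<in> {0..p-1}}
     \<union> {(crt_index p a b 1, crt_index p a 1 0) | b. b \<in> {0..a-1}}"

definition odd_proj :: "nat \<Rightarrow> nat \<Rightarrow> nat \<times> nat \<Rightarrow> nat \<Rightarrow> complex mat" where
  "odd_proj p a \<sigma> k = (case \<sigma> of (m, m') \<Rightarrow> eigenproj (weyl (p * a) m m')
     (cis (2 * pi / real (p * a)) ^ k))"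

definition odd_family :: "nat \<Rightarrow> nat \<Rightarrow> complex mat set" where
  "odd_family p a =
     {odd_proj p a (1, 0) k | k. k \<le> p * a - 1}
   \<union> {odd_proj p a (b, 1) k | b k. b \<in> {0..p-1} \<and> k \<le> p * a - 2}
   \<union> {odd_proj p a (b, 1) k | b k. b \<in> {p..a-1} \<and> k \<le> p * (a - 1) - 1}
   \<union> {odd_proj p a \<sigma> (crt_index p a b' t') | \<sigma> b' t'.
        \<sigma> \<in> odd_Sigma p a - {(1, 0)} - {(b, 1) | b. b \<in> {0..a-1}}
        \<and> b' \<in> {0..a-2} \<and> t' \<in> {0..p-2}}"

definition projection_families :: "(nat \<Rightarrow> complex mat set) \<Rightarrow> bool" where
  "projection_families Fam \<longleftrightarrow>
     (\<forall>p. prime p \<longrightarrow> prime_family p (Fam p)) \<and>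
     (\<forall>p. prime p \<longrightarrow> prime_square_family p (Fam (p\<^sup>2))) \<and>
     (\<forall>a. prime a \<and> odd a \<longrightarrow> Fam (2 * a) = even_family a) \<and>
     (\<forall>p a. prime p \<and> prime a \<and> odd p \<and> p < a \<longrightarrow> Fam (p * a) = odd_family p a)"

text \<open>\<open>s j div 2\<close> is \<open>s j / 2\<close> for even \<open>s j\<close> and \<open>(s j - 1) / 2\<close> for odd \<open>s j\<close>. Factor lists are
  specified through their multisets, so the tensor factors may come in any order.\<close>

definition square_factors :: "nat \<Rightarrow> (nat \<Rightarrow> nat) \<Rightarrow> (nat \<Rightarrow> nat) \<Rightarrow> nat multiset" where
  "square_factors k p s = (\<Sum>j\<in>{1..k}. replicate_mset (s j div 2) ((p j)\<^sup>2))"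

definition pairing :: "nat set \<Rightarrow> nat set set \<Rightarrow> bool" where
  "pairing K M \<longleftrightarrow> partition_on K M \<and> (\<forall>e\<in>M. card e = 2)"

definition pair_factors :: "(nat \<Rightarrow> nat) \<Rightarrow> nat set set \<Rightarrow> nat multiset" where
  "pair_factors p M = image_mset (\<lambda>e. \<Prod>j\<in>e. p j) (mset_set M)"

end

theory Submission
  imports Defs
begin

text \<open>A family \<open>S\<close> of operators on \<open>\<complex>\<^sup>n\<close> spans all operators iff no nonzero linear functional
  vanishes on it; in this dual form the property passes to tensor products at once, by fixing one
  factor at a time. A spanning family with at most \<open>n\<^sup>2\<close> members has exactly \<open>n\<^sup>2\<close>, so the
  projections need not be shown distinct. If \<open>\<sigma> \<in> \<int>\<^sub>n\<^sup>2\<close> has order \<open>n\<close>, the eigenprojections of \<open>U\<^sub>\<sigma>\<close> are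
  Fourier transforms of its powers, which are up to phases the operators \<open>U\<^sub>l\<^sub>\<sigma>\<close>. A functional
  vanishing on the given members of a family is shown to vanish on all eigenprojections, because
  the sums over residue classes of labels only involve powers of \<open>U\<^sub>\<sigma>\<close> on which it is already
  known to vanish. The lines \<open>l \<sigma>\<close> cover \<open>\<int>\<^sub>n\<^sup>2\<close>, and the Weyl operators span. The overlap of
  two such eigenprojections is a normalised character sum over a subgroup of \<open>\<int>\<^sub>n\<close>, hence \<open>0\<close> or
  \<open>1/r\<close> with \<open>r\<close> dividing \<open>n\<close>.\<close>

section \<open>Separating families of projections\<close>

text \<open>Modulo a prime, distinct lines meet only in 0. Modulo a composite \<open>n\<close> they
  share proper subgroups, and Weyl operators obtained from one line reappear as powers on another.
  Every omitted label pays for one such operator: the number of labels kept on a line is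
  \<open>n\<close> minus the number of its points already covered. This fixes the order inside each
  separation argument: the diagonal line, then lines lacking one label, then lines lacking one label
  per residue class, and, for two distinct primes, finally lines on which two subgroups are known.
  Nothing is left over, so the cardinality bounds of the parts add up to exactly
  \<open>n\<^sup>2\<close>. Members are carried as Hermitian idempotents of trace one, since the
  trace can be read off from Weyl operators and is multiplicative on tensor products; rank one
  follows at the end. For the overlaps, orthogonal kets give 0, and each divisor of \<open>p\<close>
  and of \<open>p\<^sup>2\<close> is realised by an explicit pair; tensor products then yield all
  divisors, because a divisor of \<open>m * n\<close> is a divisor of \<open>m\<close> times a
  divisor of \<open>n\<close>.\<close>

lemma mat_adjoint_dim [simp]:
  "dim_row (mat_adjoint A) = dim_col A" "dim_col (mat_adjoint A) = dim_row A"
  by (auto simp: mat_adjoint_def)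

lemma mat_adjoint_index [simp]:
  fixes A :: "complex mat"
  assumes "i < dim_col A" "j < dim_row A"
  shows "mat_adjoint A $$ (i, j) = cnj (A $$ (j, i))"
  using assms by (simp add: mat_adjoint_def mat_of_rows_index)

lemma mat_adjoint_mult:
  fixes A B :: "complex mat"
  assumes "A \<in> carrier_mat m n" "B \<in> carrier_mat n l"
  shows "mat_adjoint (A * B) = mat_adjoint B * mat_adjoint A"
  using assms by (intro eq_matI) (auto simp: scalar_prod_def mult.commute)

lemma mult_mat_index:
  assumes "A \<in> carrier_mat m n" "B \<in> carrier_mat n l" "i < m" "j < l"
  shows "(A * B) $$ (i, j) = (\<Sum>k<n. A $$ (i, k) * B $$ (k, j))"
  using assms by (auto simp: scalar_prod_def atLeast0LessThan)

lemma mat_trace_carrier: "A \<in> carrier_mat n n \<Longrightarrow> mat_trace A = (\<Sum>i<n. A $$ (i, i))"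
  by (simp add: mat_trace_def)

text \<open>Writing \<open>k\<close> in base \<open>n\<close>. The same reindexing serves flattened
  matrices, exponents split along a subgroup, and Kronecker products.\<close>

lemma sum_lessThan_mult:
  fixes f :: "nat \<Rightarrow> nat \<Rightarrow> 'a :: comm_monoid_add"
  shows "(\<Sum>k<m * n. f (k div n) (k mod n)) = (\<Sum>i<m. \<Sum>j<n. f i j)"
proof (cases "n = 0")
  case False
  have "(\<Sum>k<m * n. f (k div n) (k mod n)) = (\<Sum>(i, j)\<in>{..<m} \<times> {..<n}. f i j)"
  proof (rule sum.reindex_bij_witness[where i = "\<lambda>(i, j). i * n + j" and j = "\<lambda>k. (k div n, k mod n)"])
    fix b assume "b \<in> {..<m} \<times> {..<n}"
    then obtain i j where b: "b = (i, j)" "i < m" "j < n" by auto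
    have "i * n + j < Suc i * n" using b by simp
    also have "\<dots> \<le> m * n" using b by (intro mult_right_mono) auto
    finally show "(case b of (i, j) \<Rightarrow> i * n + j) \<in> {..<m * n}" using b by simp
  qed (use False in \<open>auto simp: less_mult_imp_div_less\<close>)
  then show ?thesis by (simp add: sum.cartesian_product)
qed simp

text \<open>The general linear functional on \<open>n\<close> by \<open>n\<close> matrices, with
  coefficients \<open>X\<close>. A plain function spares carrier conditions, for instance when
  indices are sliced for tensor products.\<close>

definition pairing_form :: "nat \<Rightarrow> (nat \<Rightarrow> nat \<Rightarrow> complex) \<Rightarrow> complex mat \<Rightarrow> complex" where
  "pairing_form n X A = (\<Sum>i<n. \<Sum>j<n. A $$ (i, j) * X i j)"

definition separating :: "nat \<Rightarrow> complex mat set \<Rightarrow> bool" where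
  "separating n S \<longleftrightarrow> (\<forall>X. (\<forall>P\<in>S. pairing_form n X P = 0) \<longrightarrow> (\<forall>i<n. \<forall>j<n. X i j = 0))"

text \<open>The flattened members are the rows of a square matrix \<open>B\<close>. Separation means
  that \<open>B\<close> has trivial kernel, so it is invertible: there is no zero row, which fixes
  the cardinality, and the inverse yields the coefficients of any given matrix.\<close>

lemma separating_imp_informationally_complete:
  assumes fin: "finite S" and carr: "S \<subseteq> carrier_mat n n" and card: "card S \<le> n\<^sup>2"
    and sep: "separating n S"
  shows "card S = n\<^sup>2" "informationally_complete n S"
proof -
  define N where "N = n * n"
  obtain f where f: "bij_betw f {0..<card S} S"
    using ex_bij_betw_nat_finite[OF fin] by blast
  have fS: "f r \<in> S" if "r < card S" for r using f that by (auto simp: bij_betw_def)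
  \<comment> \<open>Row \<open>r\<close> is the \<open>r\<close>-th member in row-major order; zero
    rows pad up to \<open>N\<close>, so that determinants apply.\<close>
  define B where "B = mat N N (\<lambda>(r, c). if r < card S then f r $$ (c div n, c mod n) else 0)"
  have B: "B \<in> carrier_mat N N" by (simp add: B_def)
  have idx: "i * n + j < N" if "i < n" "j < n" for i j
  proof -
    have "i * n + j < Suc i * n" using that by simp
    also have "\<dots> \<le> n * n" using that by (intro mult_right_mono) auto
    finally show ?thesis by (simp add: N_def)
  qed
  have det: "det B \<noteq> 0"
  proof
    assume "det B = 0"
    then obtain v where v: "v \<in> carrier_vec N" "v \<noteq> 0\<^sub>v N" "B *\<^sub>v v = 0\<^sub>v N"
      using det_0_iff_vec_prod_zero_field[OF B] by blast
    define X where "X i j = v $ (i * n + j)" for i j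
    have "pairing_form n X P = 0" if "P \<in> S" for P
    proof -
      have "P \<in> f ` {0..<card S}" using f that by (simp add: bij_betw_def)
      then obtain r where r: "r < card S" "P = f r" by auto
      have rN: "r < N" using r card by (simp add: N_def power2_eq_square)
      have "pairing_form n X P = (\<Sum>k<n * n. P $$ (k div n, k mod n) * v $ ((k div n) * n + k mod n))"
        unfolding pairing_form_def X_def
        by (rule sum_lessThan_mult[where f = "\<lambda>i j. P $$ (i, j) * v $ (i * n + j)", symmetric])
      also have "\<dots> = (\<Sum>k<N. P $$ (k div n, k mod n) * v $ k)" by (simp add: N_def)
      also have "\<dots> = (B *\<^sub>v v) $ r"
        using r rN v(1) by (auto simp: B_def scalar_prod_def atLeast0LessThan intro!: sum.cong)
      also have "\<dots> = 0" using v rN by simp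
      finally show ?thesis .
    qed
    then have X0: "\<forall>i<n. \<forall>j<n. X i j = 0" using sep by (auto simp: separating_def)
    have "v $ k = 0" if "k < N" for k
    proof -
      have "n > 0" using that by (cases n) (auto simp: N_def)
      then have "k div n < n" "k mod n < n" using that
        by (auto simp: N_def less_mult_imp_div_less)
      then have "X (k div n) (k mod n) = 0" using X0 by blast
      then show ?thesis by (simp add: X_def)
    qed
    then have "v = 0\<^sub>v N" using v(1) by (intro eq_vecI) auto
    with v(2) show False by simp
  qed
  show cN: "card S = n\<^sup>2"
  proof (rule ccontr)
    assume "card S \<noteq> n\<^sup>2"
    then have lt: "card S < N" using card by (simp add: N_def power2_eq_square)
    \<comment> \<open>Row \<open>card S\<close> of \<open>B\<close> is zero, so the transpose kills
      this unit vector.\<close>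
    have "transpose_mat B *\<^sub>v unit_vec N (card S) = 0\<^sub>v N"
      using lt by (intro eq_vecI) (auto simp: B_def scalar_prod_def if_distrib cong: if_cong)
    moreover have "unit_vec N (card S) \<noteq> (0\<^sub>v N :: complex vec)"
      using lt by simp
    ultimately have "det (transpose_mat B) = 0"
      using det_0_iff_vec_prod_zero_field[of "transpose_mat B" N] transpose_carrier_mat[of B N N] B
        unit_vec_carrier[of N "card S"] by blast
    with det det_transpose[OF B] show False by simp
  qed
  interpret matrix_vs n n "TYPE(complex)" .
  have SC: "S \<subseteq> carrier_mat n n" by fact
  have sub: "submodule class_ring (span S) V" using span_is_submodule carr by simp
  obtain C where C: "C \<in> carrier_mat N N" "C * B = 1\<^sub>m N"
    using det_non_zero_imp_unit[OF B det, of "()"] unfolding Units_def ring_mat_def by auto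
  have "A \<in> span S" if A: "A \<in> carrier_mat n n" for A
  proof -
    \<comment> \<open>The coefficient row is the flattened \<open>A\<close> times the left inverse
      \<open>C\<close>, so its product with \<open>B\<close> is the flattened \<open>A\<close>
      again.\<close>
    define a where "a r = (\<Sum>c<N. A $$ (c div n, c mod n) * C $$ (c, r))" for r
    define M where "M k = mat n n (\<lambda>(i, j). \<Sum>r<k. a r * f r $$ (i, j))" for k
    have M: "M k \<in> span S" if "k \<le> card S" for k
      using that
    proof (induction k)
      case 0
      have "M 0 = 0\<^sub>m n n" by (intro eq_matI) (auto simp: M_def)
      then show ?case using span_zero[of S] by simp
    next
      case (Suc k)
      have fk: "f k \<in> S" using Suc fS by simp
      then have fkc: "f k \<in> carrier_mat n n" using carr by blast
      have "f k \<in> span S" using fk in_own_span[of S] carr by auto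
      then have "a k \<cdot>\<^sub>m f k \<in> span S" using submodule.smult_closed[OF sub, of "a k" "f k"] by (simp add: module_mat_simps)
      then have "M k + a k \<cdot>\<^sub>m f k \<in> span S" using Suc span_add1[of S "M k" "a k \<cdot>\<^sub>m f k"] carr by simp
      moreover have "M (Suc k) = M k + a k \<cdot>\<^sub>m f k"
        using fkc by (intro eq_matI) (auto simp: M_def)
      ultimately show ?case by simp
    qed
    have "M N = A"
    proof (intro eq_matI)
      fix i j assume "i < dim_row A" "j < dim_col A"
      then have ij: "i < n" "j < n" using A by auto
      then have n0: "n > 0" by simp
      let ?k = "i * n + j"
      have kN: "?k < N" using idx ij by simp
      have "M N $$ (i, j) = (\<Sum>r<N. a r * B $$ (r, ?k))"
        using ij kN cN by (auto simp: M_def B_def N_def power2_eq_square intro!: sum.cong)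
      also have "\<dots> = (\<Sum>r<N. \<Sum>c<N. A $$ (c div n, c mod n) * C $$ (c, r) * B $$ (r, ?k))"
        by (simp add: a_def sum_distrib_right)
      also have "\<dots> = (\<Sum>c<N. A $$ (c div n, c mod n) * (\<Sum>r<N. C $$ (c, r) * B $$ (r, ?k)))"
        by (subst sum.swap) (simp add: sum_distrib_left mult.assoc)
      also have "\<dots> = (\<Sum>c<N. A $$ (c div n, c mod n) * (C * B) $$ (c, ?k))"
        using C(1) B kN by (intro sum.cong refl) (simp only: lessThan_iff mult_mat_index[OF C(1) B])
      also have "\<dots> = (\<Sum>c<N. if c = ?k then A $$ (i, j) else 0)"
        unfolding C(2) using kN ij n0 by (intro sum.cong) auto
      also have "\<dots> = A $$ (i, j)" using kN by simp
      finally show "M N $$ (i, j) = A $$ (i, j)" .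
    qed (use A in \<open>auto simp: M_def\<close>)
    then show ?thesis using M[of N] cN by (simp add: N_def power2_eq_square)
  qed
  then have "carrier_mat n n \<subseteq> span S" by blast
  moreover have "span S \<subseteq> carrier_mat n n" using span_closed[of S] carr by auto
  ultimately show "informationally_complete n S"
    unfolding informationally_complete_def by simp
qed

section \<open>Orthogonal projections: range, trace and rank\<close>

lemma orth_projection_eqI:
  assumes P: "orth_projection n P" and Q: "orth_projection n Q"
    and W: "{P *\<^sub>v v | v. v \<in> carrier_vec n} = {Q *\<^sub>v v | v. v \<in> carrier_vec n}"
  shows "P = Q"
proof -
  \<comment> \<open>Columns of \<open>Q\<close> lie in the range of \<open>P\<close>, on which
    \<open>P\<close> acts as the identity.\<close>
  have *: "P * Q = Q" if P: "orth_projection n P" and Q: "orth_projection n Q"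
    and W: "{P *\<^sub>v v | v. v \<in> carrier_vec n} = {Q *\<^sub>v v | v. v \<in> carrier_vec n}" for P Q
  proof -
    have Pc: "P \<in> carrier_mat n n" and Qc: "Q \<in> carrier_mat n n" and PP: "P * P = P"
      using P Q by (auto simp: orth_projection_def)
    show ?thesis
    proof (rule mat_col_eqI)
      fix j assume "j < dim_col Q"
      then have j: "j < n" using Qc by simp
      have "Q *\<^sub>v unit_vec n j \<in> {P *\<^sub>v v | v. v \<in> carrier_vec n}" unfolding W by auto
      then obtain v where v: "v \<in> carrier_vec n" "Q *\<^sub>v unit_vec n j = P *\<^sub>v v" by auto
      have "col Q j = Q *\<^sub>v unit_vec n j" using Qc j by (intro eq_vecI) (auto simp: scalar_prod_def if_distrib cong: if_cong)
      then have Qj: "col Q j = P *\<^sub>v v" using v by simp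
      have "col (P * Q) j = P *\<^sub>v col Q j"
        by (rule col_mult2[OF Pc Qc j])
      also have "\<dots> = (P * P) *\<^sub>v v" unfolding Qj using Pc v by (simp add: assoc_mult_mat_vec)
      also have "\<dots> = col Q j" unfolding PP Qj ..
      finally show "col (P * Q) j = col Q j" .
    qed (use Pc Qc in auto)
  qed
  have Pc: "P \<in> carrier_mat n n" and Qc: "Q \<in> carrier_mat n n"
    and ad: "mat_adjoint P = P" "mat_adjoint Q = Q"
    using P Q by (auto simp: orth_projection_def)
  \<comment> \<open>The adjoint of \<open>Q * P = P\<close> reverses the product, which can then be
    compared with \<open>P * Q = Q\<close>.\<close>
  have "P = mat_adjoint (Q * P)" using *[OF Q P W[symmetric]] ad by simp
  also have "\<dots> = P * Q" using mat_adjoint_mult[OF Qc Pc] ad by simp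
  also have "\<dots> = Q" using *[OF P Q W] .
  finally show ?thesis .
qed

lemma projection_onto_eqI:
  assumes "orth_projection n P" and "{P *\<^sub>v v | v. v \<in> carrier_vec n} = W"
  shows "projection_onto n W = P"
  unfolding projection_onto_def
  by (rule the_equality) (use assms orth_projection_eqI in blast)+

definition trace_one_projection :: "nat \<Rightarrow> complex mat \<Rightarrow> bool" where
  "trace_one_projection n P \<longleftrightarrow> orth_projection n P \<and> mat_trace P = 1"

lemma trace_one_projection_carrier: "trace_one_projection n P \<Longrightarrow> P \<in> carrier_mat n n"
  by (simp add: trace_one_projection_def orth_projection_def)

lemma (in vec_space) rank_pos:
  assumes A: "A \<in> carrier_mat n nc" and ij: "i < n" "j < nc" "A $$ (i, j) \<noteq> 0"
  shows "rank A \<ge> 1"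
proof -
  let ?v = "col A j"
  have v: "?v \<in> carrier_vec n" using A by auto
  have "?v $ i \<noteq> 0" using A ij by simp
  then have v0: "?v \<noteq> 0\<^sub>v n" using ij by (metis index_zero_vec(1))
  have "lin_indpt {?v}"
  proof
    assume "lin_dep {?v}"
    then obtain A' a w where h: "finite A'" "A' \<subseteq> {?v}" "lincomb a A' = 0\<^sub>v n" "w \<in> A'" "a w \<noteq> 0"
      unfolding lin_dep_def by auto
    then have "A' = {?v}" by auto
    then have "a ?v \<cdot>\<^sub>v ?v = 0\<^sub>v n" using h(3) v by (simp add: lincomb_def)
    then have "(a ?v \<cdot>\<^sub>v ?v) $ i = 0" using ij by simp
    then show False using h A ij v by auto
  qed
  moreover have "{?v} \<subseteq> set (cols A)" using A ij by (auto simp: cols_def)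
  ultimately show ?thesis using rank_ge_card_indpt[OF A, of "{?v}"] by simp
qed

text \<open>Some diagonal entry \<open>c\<close> at \<open>(j, j)\<close> is nonzero, since the
  trace is 1. Subtracting from \<open>P\<close> the projection onto its column \<open>j\<close>
  leaves a Hermitian \<open>q\<close> whose squared Frobenius norm is the trace of \<open>P\<close>
  minus 1, that is 0.\<close>

lemma trace_one_projection_entries:
  assumes "trace_one_projection n P"
  shows "\<exists>j<n. P $$ (j, j) \<noteq> 0 \<and> (\<forall>i<n. \<forall>l<n. P $$ (i, l) = P $$ (i, j) * (P $$ (j, l) / P $$ (j, j)))"
proof -
  have P: "P \<in> carrier_mat n n" and PP: "P * P = P" and ad: "mat_adjoint P = P"
    and tr: "(\<Sum>i<n. P $$ (i, i)) = 1"
    using assms by (auto simp: trace_one_projection_def orth_projection_def mat_trace_carrier)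
  have "\<not> (\<forall>j<n. P $$ (j, j) = 0)"
  proof
    assume "\<forall>j<n. P $$ (j, j) = 0"
    then have "(\<Sum>i<n. P $$ (i, i)) = 0" by simp
    with tr show False by simp
  qed
  then obtain j where j: "j < n" "P $$ (j, j) \<noteq> 0" by blast
  define p where "p i l = P $$ (i, l)" for i l
  define c where "c = p j j"
  have c: "c \<noteq> 0" using j by (simp add: c_def p_def)
  have sym: "cnj (p i l) = p l i" if "i < n" "l < n" for i l
  proof -
    have "mat_adjoint P $$ (l, i) = cnj (P $$ (i, l))" using P that by simp
    then show ?thesis by (simp add: ad p_def)
  qed
  have mul: "(\<Sum>k<n. p i k * p k l) = p i l" if "i < n" "l < n" for i l
    using mult_mat_index[OF P P that] by (simp add: PP p_def)
  define e where "e = 1 / c"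
  have ce: "c * e = 1" and cnje: "cnj e = e" using c j by (simp_all add: e_def c_def sym)
  define q where "q i l = p i l - p i j * p j l * e" for i l
  have cq: "cnj (q i l) = q l i" if "i < n" "l < n" for i l
    using that j by (simp add: q_def cnje sym mult.commute mult.left_commute)
  \<comment> \<open>Diagonal entries of \<open>q\<^sup>2\<close>, expanded with
    \<open>P * P = P\<close> and \<open>c * e = 1\<close>.\<close>
  have "(\<Sum>l<n. q i l * q l i) = p i i - p i j * p j i * e" if i: "i < n" for i
  proof -
    have "q i l * q l i = p i l * p l i - p i l * p l j * (p j i * e)
      - (p i j * e) * (p j l * p l i) + (p i j * p j i * e * e) * (p j l * p l j)" for l
      by (simp add: q_def algebra_simps)
    then have "(\<Sum>l<n. q i l * q l i) = (\<Sum>l<n. p i l * p l i) - (\<Sum>l<n. p i l * p l j) * (p j i * e)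
      - (p i j * e) * (\<Sum>l<n. p j l * p l i) + (p i j * p j i * e * e) * (\<Sum>l<n. p j l * p l j)"
      by (simp only: sum.distrib sum_subtractf sum_distrib_left sum_distrib_right)
    also have "\<dots> = p i i - p i j * p j i * e - p i j * e * p j i + p i j * p j i * e * e * c"
      using i j by (simp add: mul c_def)
    also have "\<dots> = p i i - p i j * p j i * e * (2 - c * e)" by (simp add: algebra_simps)
    also have "\<dots> = p i i - p i j * p j i * e" unfolding ce by simp
    finally show ?thesis .
  qed
  then have "(\<Sum>i<n. \<Sum>l<n. q i l * q l i) = (\<Sum>i<n. p i i) - (\<Sum>i<n. p j i * p i j) * e"
    unfolding sum_distrib_right sum_subtractf[symmetric] by (intro sum.cong refl) simp
  also have "\<dots> = 0" using tr ce mul[OF j(1) j(1)] by (simp add: p_def c_def)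
  finally have "(\<Sum>i<n. \<Sum>l<n. q i l * q l i) = 0" .
  \<comment> \<open>Hermitian symmetry turns the trace of \<open>q\<^sup>2\<close> into a sum of
    squared moduli.\<close>
  moreover have "(\<Sum>i<n. \<Sum>l<n. q i l * q l i) = (\<Sum>i<n. \<Sum>l<n. q i l * cnj (q i l))"
    by (intro sum.cong refl) (simp add: cq)
  ultimately have "(\<Sum>i<n. \<Sum>l<n. q i l * cnj (q i l)) = 0" by simp
  then have "complex_of_real (\<Sum>i<n. \<Sum>l<n. (cmod (q i l))\<^sup>2) = 0"
    by (simp only: of_real_sum complex_norm_square)
  then have "(\<Sum>i<n. \<Sum>l<n. (cmod (q i l))\<^sup>2) = 0" by (simp only: of_real_eq_0_iff)
  then have "\<forall>i<n. \<forall>l<n. q i l = 0"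
    by (subst (asm) sum_nonneg_eq_0_iff) (auto simp: sum_nonneg sum_nonneg_eq_0_iff)
  then have "\<forall>i<n. \<forall>l<n. p i l = p i j * (p j l / c)" by (simp add: q_def e_def)
  then show ?thesis using j unfolding p_def c_def by blast
qed

lemma trace_one_imp_rank_one:
  assumes "trace_one_projection n P"
  shows "rank_one_projection n P"
proof -
  interpret vec_space "TYPE(complex)" n .
  have P: "P \<in> carrier_mat n n" using assms by (rule trace_one_projection_carrier)
  obtain j where j: "j < n" "P $$ (j, j) \<noteq> 0"
    "\<And>i l. i < n \<Longrightarrow> l < n \<Longrightarrow> P $$ (i, l) = P $$ (i, j) * (P $$ (j, l) / P $$ (j, j))"
    using trace_one_projection_entries[OF assms] by blast
  have "rank P \<le> 1"
    by (rule rank_le_1_product_entries[OF P, of "\<lambda>i. P $$ (i, j)" "\<lambda>l. P $$ (j, l) / P $$ (j, j)"])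
      (use P j(3) in auto)
  moreover have "rank P \<ge> 1" using rank_pos[OF P j(1) j(1) j(2)] .
  ultimately show ?thesis using assms by (simp add: rank_one_projection_def trace_one_projection_def)
qed

section \<open>Weyl operators and their eigenprojections\<close>

abbreviation unity_root :: "nat \<Rightarrow> complex" where
  "unity_root n \<equiv> cis (2 * pi / real n)"

lemma unity_root_pow_eq_1_iff:
  assumes "n > 0"
  shows "unity_root n ^ k = 1 \<longleftrightarrow> n dvd k"
proof
  assume "unity_root n ^ k = 1"
  then have "cis (real k * (2 * pi / real n)) = 1" by (simp only: DeMoivre)
  from arg_cong[OF this, of Re] have "cos (real k * (2 * pi / real n)) = 1" by simp
  then obtain i :: int where "real k * (2 * pi / real n) = real_of_int i * 2 * pi"
    by (auto simp: cos_one_2pi_int)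
  then have "real k = real_of_int i * real n" using assms by (simp add: field_simps)
  then have "real_of_int (int k) = real_of_int (i * int n)" by simp
  then have "int k = i * int n" by (simp only: of_int_eq_iff)
  then have "int n dvd int k" by simp
  then show "n dvd k" by presburger
next
  assume "n dvd k"
  then obtain i where "k = n * i" ..
  moreover have "unity_root n ^ n = 1" using assms by (simp add: DeMoivre cis_2pi)
  ultimately show "unity_root n ^ k = 1" by (simp add: power_mult)
qed

lemma unity_root_pow_cong:
  assumes "n > 0" "[a = b] (mod n)"
  shows "unity_root n ^ a = unity_root n ^ b"
proof -
  have *: "unity_root n ^ a = unity_root n ^ (a mod n)" for a
  proof -
    have "unity_root n ^ a = unity_root n ^ (n * (a div n) + a mod n)" by simp
    also have "\<dots> = unity_root n ^ (a mod n)"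
      using assms(1) by (simp only: power_add) (simp add: unity_root_pow_eq_1_iff)
    finally show ?thesis .
  qed
  show ?thesis using assms(2) *[of a] *[of b] by (simp add: cong_def)
qed

lemma sum_pow_root_of_unity:
  fixes w :: complex
  assumes "w ^ n = 1"
  shows "(\<Sum>i<n. w ^ i) = (if w = 1 then of_nat n else 0)"
  using geometric_sum[of w n] assms by auto

lemma triangular_Suc: "Suc l * l div 2 = l * (l - 1) div 2 + l"
proof (cases l)
  case (Suc k)
  have "Suc l * l = l * (l - 1) + l * 2" using Suc by (simp add: algebra_simps)
  then show ?thesis by simp
qed simp

lemma weyl_carrier [simp]: "weyl n m m' \<in> carrier_mat n n"
  by (simp add: weyl_def)

lemma weyl_dim [simp]: "dim_row (weyl n m m') = n" "dim_col (weyl n m m') = n"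
  by (simp_all add: weyl_def)

lemma weyl_index:
  "i < n \<Longrightarrow> k < n \<Longrightarrow> weyl n m m' $$ (i, k) = (if i = (m' + k) mod n then unity_root n ^ (m * k) else 0)"
  by (simp add: weyl_def)

lemma weyl_cong:
  assumes "n > 0" "[a = b] (mod n)" "[a' = b'] (mod n)"
  shows "weyl n a a' = weyl n b b'"
proof (rule eq_matI)
  fix i k assume "i < dim_row (weyl n b b')" "k < dim_col (weyl n b b')"
  moreover have "(a' + k) mod n = (b' + k) mod n"
    using assms(3) by (metis cong_add_rcancel_nat cong_def)
  moreover have "unity_root n ^ (a * k) = unity_root n ^ (b * k)"
    using assms by (intro unity_root_pow_cong cong_scalar_right)
  ultimately show "weyl n a a' $$ (i, k) = weyl n b b' $$ (i, k)"
    by (simp add: weyl_index)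
qed auto

lemma weyl_0: "weyl n 0 0 = 1\<^sub>m n"
  by (intro eq_matI) (auto simp: weyl_index)

lemma weyl_mult:
  assumes "n > 0"
  shows "weyl n a a' * weyl n b b' = unity_root n ^ (a * b') \<cdot>\<^sub>m weyl n (a + b) (a' + b')"
proof (rule eq_matI)
  fix i k assume "i < dim_row (unity_root n ^ (a * b') \<cdot>\<^sub>m weyl n (a + b) (a' + b'))"
    "k < dim_col (unity_root n ^ (a * b') \<cdot>\<^sub>m weyl n (a + b) (a' + b'))"
  then have ik: "i < n" "k < n" by auto
  let ?j = "(b' + k) mod n"
  have "(weyl n a a' * weyl n b b') $$ (i, k) = (\<Sum>j<n. weyl n a a' $$ (i, j) * weyl n b b' $$ (j, k))"
    using ik by (intro mult_mat_index) auto
  also have "\<dots> = (\<Sum>j<n. if j = ?j then weyl n a a' $$ (i, ?j) * unity_root n ^ (b * k) else 0)"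
    using ik by (intro sum.cong) (auto simp: weyl_index)
  also have "\<dots> = weyl n a a' $$ (i, ?j) * unity_root n ^ (b * k)"
    using assms by simp
  also have "\<dots> = (if i = (a' + ?j) mod n then unity_root n ^ (a * ?j) * unity_root n ^ (b * k) else 0)"
    using ik assms by (simp add: weyl_index)
  also have "unity_root n ^ (a * ?j) = unity_root n ^ (a * (b' + k))"
    using assms by (intro unity_root_pow_cong cong_scalar_left) (auto simp: cong_def)
  also have "(a' + ?j) mod n = (a' + b' + k) mod n" by (simp add: mod_add_right_eq add.assoc)
  finally show "(weyl n a a' * weyl n b b') $$ (i, k) =
      (unity_root n ^ (a * b') \<cdot>\<^sub>m weyl n (a + b) (a' + b')) $$ (i, k)"
    using ik by (simp add: weyl_index power_add[symmetric] algebra_simps)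
qed auto

lemma weyl_unitary:
  assumes "n > 0"
  shows "mat_adjoint (weyl n m m') * weyl n m m' = 1\<^sub>m n"
proof (rule eq_matI)
  fix i k assume "i < dim_row (1\<^sub>m n :: complex mat)" "k < dim_col (1\<^sub>m n :: complex mat)"
  then have ik: "i < n" "k < n" by auto
  let ?j = "(m' + k) mod n"
  have "(mat_adjoint (weyl n m m') * weyl n m m') $$ (i, k)
      = (\<Sum>j<n. mat_adjoint (weyl n m m') $$ (i, j) * weyl n m m' $$ (j, k))"
    using ik by (intro mult_mat_index) auto
  also have "\<dots> = (\<Sum>j<n. if j = ?j then cnj (weyl n m m' $$ (?j, i)) * unity_root n ^ (m * k) else 0)"
    using ik by (intro sum.cong) (auto simp: weyl_index)
  also have "\<dots> = cnj (weyl n m m' $$ (?j, i)) * unity_root n ^ (m * k)"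
    using assms by simp
  also have "\<dots> = (if ?j = (m' + i) mod n then cnj (unity_root n ^ (m * i)) * unity_root n ^ (m * k) else 0)"
    using ik assms by (simp add: weyl_index)
  also have "?j = (m' + i) mod n \<longleftrightarrow> i = k"
    using ik cong_add_lcancel_nat[of m' k i n] by (auto simp: cong_def)
  also have "(if i = k then cnj (unity_root n ^ (m * i)) * unity_root n ^ (m * k) else 0) = (if i = k then 1 else 0)"
    by (simp add: DeMoivre cis_cnj cis_mult)
  finally show "(mat_adjoint (weyl n m m') * weyl n m m') $$ (i, k) = (1\<^sub>m n :: complex mat) $$ (i, k)"
    using ik by simp
qed auto

text \<open>The \<open>l\<close>-th power of \<open>U\<^sub>m\<^sub>,\<^sub>m\<^sub>'\<close>; the exponent is \<open>m m' (0 + 1 + \<dots> + (l - 1))\<close>.\<close>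

definition wphase :: "nat \<Rightarrow> nat \<Rightarrow> nat \<Rightarrow> nat \<Rightarrow> complex" where
  "wphase n m m' l = unity_root n ^ (m * m' * (l * (l - 1) div 2))"

definition wpow :: "nat \<Rightarrow> nat \<Rightarrow> nat \<Rightarrow> nat \<Rightarrow> complex mat" where
  "wpow n m m' l = wphase n m m' l \<cdot>\<^sub>m weyl n (l * m) (l * m')"

lemma wphase_Suc: "wphase n m m' (Suc l) = wphase n m m' l * unity_root n ^ (m * m' * l)"
  unfolding wphase_def power_add[symmetric] using triangular_Suc[of l]
  by (simp add: algebra_simps)

lemma wphase_nonzero [simp]: "wphase n m m' l \<noteq> 0"
  by (simp add: wphase_def)

lemma wpow_carrier [simp]: "wpow n m m' l \<in> carrier_mat n n"
  by (simp add: wpow_def)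

lemma wpow_dim [simp]: "dim_row (wpow n m m' l) = n" "dim_col (wpow n m m' l) = n"
  by (simp_all add: wpow_def)

lemma smult_one_mat: "(1 :: 'a :: semiring_1) \<cdot>\<^sub>m A = A"
  by (intro eq_matI) auto

lemma smult_smult_mat: "a \<cdot>\<^sub>m (b \<cdot>\<^sub>m A) = (a * b :: 'a :: semigroup_mult) \<cdot>\<^sub>m A"
  by (intro eq_matI) (auto simp: mult.assoc)

lemma wpow_0: "wpow n m m' 0 = 1\<^sub>m n"
  by (intro eq_matI) (auto simp: wpow_def wphase_def weyl_0)

lemma wpow_Suc:
  assumes "n > 0"
  shows "wpow n m m' l * weyl n m m' = wpow n m m' (Suc l)"
    and "weyl n m m' * wpow n m m' l = wpow n m m' (Suc l)"
proof -
  show "wpow n m m' l * weyl n m m' = wpow n m m' (Suc l)"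
    unfolding wpow_def wphase_Suc
    by (subst mult_smult_assoc_mat[of _ n n _ n])
      (auto simp: weyl_mult[OF assms] smult_smult_mat algebra_simps)
  show "weyl n m m' * wpow n m m' l = wpow n m m' (Suc l)"
    unfolding wpow_def wphase_Suc
    by (subst mult_smult_distrib[of _ n n _ n])
      (auto simp: weyl_mult[OF assms] smult_smult_mat algebra_simps)
qed

section \<open>Spectral projections of a Weyl operator\<close>

lemma wpow_n:
  assumes "n > 0"
  shows "wpow n m m' n = wphase n m m' n \<cdot>\<^sub>m 1\<^sub>m n"
proof -
  have "weyl n (n * m) (n * m') = weyl n 0 0" using assms by (intro weyl_cong) (auto simp: cong_def)
  then show ?thesis by (simp add: wpow_def weyl_0)
qed

text \<open>The average of the powers of \<open>U / z\<close> over one period, that is, the spectral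
  projection of \<open>U\<close> for \<open>z\<close> once \<open>z\<close> satisfies the condition
  of \<open>weyl_eigenvalue\<close>.\<close>

definition wproj :: "nat \<Rightarrow> nat \<Rightarrow> nat \<Rightarrow> complex \<Rightarrow> complex mat" where
  "wproj n m m' z = mat n n (\<lambda>(i, k). (1 / of_nat n) * (\<Sum>l<n. (1 / z) ^ l * wpow n m m' l $$ (i, k)))"

text \<open>Says that \<open>(m, m')\<close> has order \<open>n\<close> in
  \<open>\<int>\<^sub>n\<^sup>2\<close>. Then the powers of \<open>U\<close> with exponents
  \<open>0 < l < n\<close> are traceless and the eigenvalues are simple.\<close>

definition generating :: "nat \<Rightarrow> nat \<Rightarrow> nat \<Rightarrow> bool" where
  "generating n m m' \<longleftrightarrow> (\<forall>l. n dvd l * m \<longrightarrow> n dvd l * m' \<longrightarrow> n dvd l)"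

lemma wproj_carrier [simp]: "wproj n m m' z \<in> carrier_mat n n"
  by (simp add: wproj_def)

lemma wproj_dim [simp]: "dim_row (wproj n m m' z) = n" "dim_col (wproj n m m' z) = n"
  by (simp_all add: wproj_def)

lemma wproj_mult_right_index:
  assumes "M \<in> carrier_mat r n" "i < r" "k < n"
  shows "(M * wproj n m m' z) $$ (i, k) = (1 / of_nat n) * (\<Sum>l<n. (1 / z) ^ l * (M * wpow n m m' l) $$ (i, k))"
proof -
  have "(M * wproj n m m' z) $$ (i, k) = (\<Sum>j<n. M $$ (i, j) * wproj n m m' z $$ (j, k))"
    using assms by (intro mult_mat_index) auto
  also have "\<dots> = (1 / of_nat n) * (\<Sum>j<n. \<Sum>l<n. (1 / z) ^ l * (M $$ (i, j) * wpow n m m' l $$ (j, k)))"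
    unfolding sum_distrib_left using assms
    by (intro sum.cong refl) (simp add: wproj_def sum_distrib_left algebra_simps)
  also have "\<dots> = (1 / of_nat n) * (\<Sum>l<n. (1 / z) ^ l * (\<Sum>j<n. M $$ (i, j) * wpow n m m' l $$ (j, k)))"
    by (subst sum.swap) (simp add: sum_distrib_left)
  also have "(\<lambda>l. \<Sum>j<n. M $$ (i, j) * wpow n m m' l $$ (j, k)) = (\<lambda>l. (M * wpow n m m' l) $$ (i, k))"
    using assms by (intro ext mult_mat_index[symmetric]) auto
  finally show ?thesis .
qed

lemma wproj_mult_left_index:
  assumes "M \<in> carrier_mat n r" "i < n" "k < r"
  shows "(wproj n m m' z * M) $$ (i, k) = (1 / of_nat n) * (\<Sum>l<n. (1 / z) ^ l * (wpow n m m' l * M) $$ (i, k))"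
proof -
  have "(wproj n m m' z * M) $$ (i, k) = (\<Sum>j<n. wproj n m m' z $$ (i, j) * M $$ (j, k))"
    using assms by (intro mult_mat_index) auto
  also have "\<dots> = (1 / of_nat n) * (\<Sum>j<n. \<Sum>l<n. (1 / z) ^ l * (wpow n m m' l $$ (i, j) * M $$ (j, k)))"
    unfolding sum_distrib_left using assms
    by (intro sum.cong refl) (simp add: wproj_def sum_distrib_right sum_distrib_left algebra_simps)
  also have "\<dots> = (1 / of_nat n) * (\<Sum>l<n. (1 / z) ^ l * (\<Sum>j<n. wpow n m m' l $$ (i, j) * M $$ (j, k)))"
    by (subst sum.swap) (simp add: sum_distrib_left)
  also have "(\<lambda>l. \<Sum>j<n. wpow n m m' l $$ (i, j) * M $$ (j, k)) = (\<lambda>l. (wpow n m m' l * M) $$ (i, k))"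
    using assms by (intro ext mult_mat_index[symmetric]) auto
  finally show ?thesis .
qed

text \<open>By \<open>wpow_n\<close> the \<open>n\<close>-th power of \<open>U\<close> is this
  scalar, so the assumption singles out the candidates for eigenvalues of \<open>U\<close>. No
  eigenvector is presupposed.\<close>

locale weyl_eigenvalue =
  fixes n m m' :: nat and z :: complex
  assumes n_pos: "n > 0" and z_pow: "z ^ n = wphase n m m' n"
begin

abbreviation "U \<equiv> weyl n m m'"
abbreviation "P \<equiv> wproj n m m' z"

lemma z_nonzero: "z \<noteq> 0"
  using z_pow n_pos wphase_nonzero[of n m m' n] by (auto simp: power_0_left simp del: wphase_nonzero)

lemma cmod_z: "cmod z = 1"
proof -
  have "cmod z ^ n = 1" using arg_cong[OF z_pow, of cmod] by (simp add: norm_power wphase_def)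
  then show ?thesis using n_pos power_eq_1_iff[of "cmod z" n] by simp
qed

lemma cnj_z_mult: "cnj z * z = 1"
  using complex_norm_square[of z] cmod_z by (simp add: mult.commute)

lemma mult_wpow:
  assumes M: "M \<in> carrier_mat r n" and MU: "M * U = z \<cdot>\<^sub>m M"
  shows "M * wpow n m m' l = z ^ l \<cdot>\<^sub>m M"
proof (induction l)
  case 0
  then show ?case using M by (simp add: wpow_0 smult_one_mat)
next
  case (Suc l)
  have "M * wpow n m m' (Suc l) = (M * wpow n m m' l) * U"
    using M n_pos by (simp add: wpow_Suc(1)[symmetric] assoc_mult_mat[of _ r n _ n _ n])
  also have "\<dots> = z ^ Suc l \<cdot>\<^sub>m M"
    unfolding Suc using M by (subst mult_smult_assoc_mat[of _ r n _ n]) (auto simp: MU)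
  finally show ?case .
qed

lemma wpow_mult:
  assumes M: "M \<in> carrier_mat n r" and MU: "U * M = z \<cdot>\<^sub>m M"
  shows "wpow n m m' l * M = z ^ l \<cdot>\<^sub>m M"
proof (induction l)
  case 0
  then show ?case using M by (simp add: wpow_0 smult_one_mat)
next
  case (Suc l)
  have "wpow n m m' (Suc l) * M = U * (wpow n m m' l * M)"
    using M n_pos by (simp add: wpow_Suc(2)[symmetric] assoc_mult_mat[of _ n n _ n _ r])
  also have "\<dots> = z ^ Suc l \<cdot>\<^sub>m M"
    unfolding Suc using M by (subst mult_smult_distrib[of _ n n _ r]) (auto simp: MU)
  finally show ?case .
qed

lemma mult_wproj:
  assumes M: "M \<in> carrier_mat r n" and MU: "M * U = z \<cdot>\<^sub>m M"
  shows "M * P = M"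
proof (rule eq_matI)
  fix i k assume "i < dim_row M" "k < dim_col M"
  then have ik: "i < r" "k < n" using M by auto
  show "(M * P) $$ (i, k) = M $$ (i, k)"
    unfolding wproj_mult_right_index[OF M ik] mult_wpow[OF assms]
    using M ik n_pos z_nonzero by (simp add: power_divide)
qed (use M in auto)

lemma wproj_mult:
  assumes M: "M \<in> carrier_mat n r" and MU: "U * M = z \<cdot>\<^sub>m M"
  shows "P * M = M"
proof (rule eq_matI)
  fix i k assume "i < dim_row M" "k < dim_col M"
  then have ik: "i < n" "k < r" using M by auto
  show "(P * M) $$ (i, k) = M $$ (i, k)"
    unfolding wproj_mult_left_index[OF M ik] wpow_mult[OF assms]
    using M ik n_pos z_nonzero by (simp add: power_divide)
qed (use M in auto)

text \<open>The summand has period \<open>n\<close> in \<open>l\<close>, because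
  \<open>z ^ n\<close> equals the scalar \<open>U ^ n\<close>; shifting the index therefore costs
  just a factor \<open>z\<close>.\<close>

lemma sum_wpow_shift:
  assumes "i < n" "k < n"
  shows "(\<Sum>l<n. (1 / z) ^ l * wpow n m m' (Suc l) $$ (i, k)) =
    z * (\<Sum>l<n. (1 / z) ^ l * wpow n m m' l $$ (i, k))"
proof -
  define f where "f l = (1 / z) ^ l * wpow n m m' l $$ (i, k)" for l
  have "f n = f 0"
    using assms n_pos z_nonzero z_pow by (simp add: f_def wpow_0 wpow_n power_divide)
  moreover have "(\<Sum>l<n. f (Suc l)) + f 0 = (\<Sum>l<n. f l) + f n"
    using sum.lessThan_Suc_shift[of f n] by simp
  ultimately have "(\<Sum>l<n. f (Suc l)) = (\<Sum>l<n. f l)" by simp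
  moreover have "(\<Sum>l<n. (1 / z) ^ l * wpow n m m' (Suc l) $$ (i, k)) = z * (\<Sum>l<n. f (Suc l))"
    unfolding sum_distrib_left using z_nonzero by (intro sum.cong) (auto simp: f_def)
  ultimately show ?thesis by (simp add: f_def)
qed

lemma weyl_wproj: "U * P = z \<cdot>\<^sub>m P"
proof (rule eq_matI)
  fix i k assume "i < dim_row (z \<cdot>\<^sub>m P)" "k < dim_col (z \<cdot>\<^sub>m P)"
  then have ik: "i < n" "k < n" by auto
  show "(U * P) $$ (i, k) = (z \<cdot>\<^sub>m P) $$ (i, k)"
    unfolding wproj_mult_right_index[OF weyl_carrier ik] wpow_Suc(2)[OF n_pos] sum_wpow_shift[OF ik]
    using ik by (simp add: wproj_def)
qed auto

text \<open>Unitarity of \<open>U\<close> turns \<open>U P = z P\<close> into \<open>P\<^sup>\<dagger> U = z P\<^sup>\<dagger>\<close>, so that \<open>P\<^sup>\<dagger> P = P\<^sup>\<dagger>\<close>.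
  The left-hand side is self-adjoint, hence so is \<open>P\<close>.\<close>

lemma orth_projection_wproj: "orth_projection n P"
proof -
  let ?A = "mat_adjoint P"
  have A: "?A \<in> carrier_mat n n" and AU: "mat_adjoint U \<in> carrier_mat n n"
    by (auto intro: carrier_matI)
  have "P = (mat_adjoint U * U) * P" using weyl_unitary[OF n_pos] by simp
  also have "\<dots> = mat_adjoint U * (U * P)" using AU by (intro assoc_mult_mat) auto
  also have "\<dots> = z \<cdot>\<^sub>m (mat_adjoint U * P)"
    unfolding weyl_wproj by (rule mult_smult_distrib[OF AU]) auto
  finally have 1: "P = z \<cdot>\<^sub>m (mat_adjoint U * P)" .
  have adadj: "mat_adjoint (mat_adjoint B) = B" for B :: "complex mat"
    by (intro eq_matI) auto
  have "?A = mat_adjoint (z \<cdot>\<^sub>m (mat_adjoint U * P))" using 1 by simp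
  also have "\<dots> = cnj z \<cdot>\<^sub>m mat_adjoint (mat_adjoint U * P)"
    using AU by (intro eq_matI) auto
  also have "mat_adjoint (mat_adjoint U * P) = ?A * U"
    using mat_adjoint_mult[OF AU wproj_carrier] by (simp add: adadj)
  finally have 2: "?A = cnj z \<cdot>\<^sub>m (?A * U)" .
  have "z \<cdot>\<^sub>m ?A = z \<cdot>\<^sub>m (cnj z \<cdot>\<^sub>m (?A * U))" using 2 by simp
  also have "\<dots> = ?A * U" using cnj_z_mult
    by (intro eq_matI) (auto simp: mult.assoc[symmetric] mult.commute[of z])
  finally have "?A * U = z \<cdot>\<^sub>m ?A" by simp
  from mult_wproj[OF A this] have AP: "?A * P = ?A" .
  have "P = mat_adjoint (?A * P)" unfolding AP adadj ..
  also have "\<dots> = ?A * P" using mat_adjoint_mult[OF A wproj_carrier] by (simp add: adadj)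
  finally have "P = ?A" using AP by simp
  with AP show ?thesis by (simp add: orth_projection_def)
qed

lemma range_wproj: "{P *\<^sub>v v | v. v \<in> carrier_vec n} = eigenspace U z"
proof (intro equalityI subsetI)
  fix w assume "w \<in> {P *\<^sub>v v | v. v \<in> carrier_vec n}"
  then obtain v where v: "v \<in> carrier_vec n" "w = P *\<^sub>v v" by auto
  have "U *\<^sub>v w = (U * P) *\<^sub>v v" using v by (simp add: assoc_mult_mat_vec[of _ n n _ n])
  also have "\<dots> = z \<cdot>\<^sub>v w" unfolding weyl_wproj using v
    by (intro eq_vecI) auto
  finally show "w \<in> eigenspace U z" using v by (auto simp: eigenspace_def intro: carrier_vecI)
next
  fix w assume "w \<in> eigenspace U z"
  then have w: "w \<in> carrier_vec n" "U *\<^sub>v w = z \<cdot>\<^sub>v w" by (auto simp: eigenspace_def)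
  \<comment> \<open>A one-column matrix, so that \<open>wproj_mult\<close> applies to the vector
    \<open>w\<close>.\<close>
  let ?M = "mat_of_cols n [w]"
  have M: "?M \<in> carrier_mat n 1" by auto
  have "col (U * ?M) 0 = col (z \<cdot>\<^sub>m ?M) 0"
    using w M by (subst col_mult2[of _ n n _ 1]) auto
  then have "U * ?M = z \<cdot>\<^sub>m ?M"
    using M by (intro mat_col_eqI) auto
  from wproj_mult[OF M this] have PM: "P * ?M = ?M" .
  have "col (P * ?M) 0 = P *\<^sub>v col ?M 0" by (rule col_mult2[of _ n n _ 1]) auto
  moreover have "col ?M 0 = w" using w by simp
  ultimately have "w = P *\<^sub>v w" unfolding PM by simp
  then show "w \<in> {P *\<^sub>v v | v. v \<in> carrier_vec n}" using w(1) by blast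
qed

lemma eigenproj_weyl: "eigenproj U z = P"
  unfolding eigenproj_def using projection_onto_eqI[OF orth_projection_wproj range_wproj] by simp

end

section \<open>Linear functionals on lines of Weyl operators\<close>

lemma unity_root_pow_eq_iff:
  assumes "n > 0"
  shows "unity_root n ^ a = unity_root n ^ b \<longleftrightarrow> [a = b] (mod n)"
proof -
  have *: "[a = b] (mod n)" if "unity_root n ^ a = unity_root n ^ b" "a \<le> b" for a b
  proof -
    have "unity_root n ^ a * unity_root n ^ (b - a) = unity_root n ^ b"
      using that(2) by (simp add: power_add[symmetric])
    then have "unity_root n ^ a * unity_root n ^ (b - a) = unity_root n ^ a * 1"
      using that(1) by simp
    then have "unity_root n ^ (b - a) = 1"
      by (subst (asm) mult_left_cancel) auto
    then have "n dvd b - a" using assms by (simp add: unity_root_pow_eq_1_iff)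
    then show ?thesis using cong_altdef_nat[OF that(2)] cong_sym by blast
  qed
  show ?thesis
    using *[of a b] *[of b a] unity_root_pow_cong[OF assms, of a b] cong_sym nat_le_linear by metis
qed

text \<open>Fourier inversion on \<open>\<int>\<^sub>n\<close>, twisted by \<open>z\<close>:
  weighting equation \<open>k\<close> with the \<open>l\<close>-th power of its base and summing
  over \<open>k\<close> leaves only the index \<open>l\<close>, by orthogonality of
  characters.\<close>

lemma dft_inversion:
  fixes u :: "nat \<Rightarrow> complex"
  assumes n: "n > 0" and z: "z \<noteq> 0" and l: "l < n"
    and zero: "\<And>k. k < n \<Longrightarrow> (\<Sum>j<n. (1 / (z * unity_root n ^ k)) ^ j * u j) = 0"
  shows "u l = 0"
proof -
  let ?w = "unity_root n"
  have w: "?w ^ k \<noteq> 0" for k by simp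
  have "0 = (\<Sum>k<n. (z * ?w ^ k) ^ l * (\<Sum>j<n. (1 / (z * ?w ^ k)) ^ j * u j))"
    using zero by simp
  also have "\<dots> = (\<Sum>k<n. \<Sum>j<n. z ^ l / z ^ j * u j * (?w ^ l / ?w ^ j) ^ k)"
    unfolding sum_distrib_left
    by (intro sum.cong refl)
      (simp add: power_mult_distrib power_divide power_mult[symmetric] mult.commute)
  also have "\<dots> = (\<Sum>j<n. z ^ l / z ^ j * u j * (\<Sum>k<n. (?w ^ l / ?w ^ j) ^ k))"
    unfolding sum_distrib_left by (rule sum.swap)
  also have "\<dots> = (\<Sum>j<n. if j = l then of_nat n * u l else 0)"
  proof (intro sum.cong refl)
    fix j assume "j \<in> {..<n}"
    then have j: "j < n" by simp
    have "(?w ^ l / ?w ^ j) ^ n = 1"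
      using unity_root_pow_eq_1_iff[OF n, of "l * n"] unity_root_pow_eq_1_iff[OF n, of "j * n"]
      by (simp add: power_divide power_mult[symmetric])
    moreover have "?w ^ l / ?w ^ j = 1 \<longleftrightarrow> j = l"
      using unity_root_pow_eq_iff[OF n, of l j] j l by (auto simp: cong_def)
    ultimately show "z ^ l / z ^ j * u j * (\<Sum>k<n. (?w ^ l / ?w ^ j) ^ k) = (if j = l then of_nat n * u l else 0)"
      using z by (simp add: sum_pow_root_of_unity)
  qed
  also have "\<dots> = of_nat n * u l" using l by simp
  finally show ?thesis using n by simp
qed

text \<open>Summing over the labels \<open>c + q * i\<close> averages out every frequency
  \<open>l\<close> unless \<open>n\<close> divides \<open>q * l\<close>, i.e. unless
  \<open>l\<close> is a multiple of \<open>r\<close>; there \<open>u\<close> is assumed to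
  vanish.\<close>

lemma dft_class_sum:
  fixes u :: "nat \<Rightarrow> complex"
  assumes n: "n = q * r" "n > 0" and u: "\<And>j. j < q \<Longrightarrow> u (r * j) = 0"
  shows "(\<Sum>i<r. \<Sum>l<n. (1 / (z * unity_root n ^ (c + q * i))) ^ l * u l) = 0"
proof -
  let ?w = "unity_root n"
  have r: "r > 0" using n by simp
  have "(\<Sum>i<r. \<Sum>l<n. (1 / (z * ?w ^ (c + q * i))) ^ l * u l)
      = (\<Sum>i<r. \<Sum>l<n. (1 / (z * ?w ^ c)) ^ l * u l * (1 / ?w ^ (q * l)) ^ i)"
    by (intro sum.cong refl)
      (simp add: power_mult_distrib power_divide power_mult[symmetric] power_add add_mult_distrib ac_simps)
  also have "\<dots> = (\<Sum>l<n. (1 / (z * ?w ^ c)) ^ l * u l * (\<Sum>i<r. (1 / ?w ^ (q * l)) ^ i))"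
    unfolding sum_distrib_left by (rule sum.swap)
  also have "\<dots> = 0"
  proof (intro sum.neutral ballI)
    fix l assume l: "l \<in> {..<n}"
    have "(1 / ?w ^ (q * l)) ^ r = 1"
      using unity_root_pow_eq_1_iff[OF n(2), of "q * l * r"] n(1)
      by (simp add: power_divide power_mult[symmetric])
    moreover have "u l = 0" if "1 / ?w ^ (q * l) = 1"
    proof -
      have "?w ^ (q * l) = 1" using that by simp
      then have "n dvd q * l" using n(2) by (simp add: unity_root_pow_eq_1_iff)
      then have "q * r dvd q * l" by (simp only: n(1))
      then have "r dvd l" using n by auto
      then obtain j where "l = r * j" ..
      moreover from this l n r have "j < q" by (simp add: mult.commute)
      ultimately show ?thesis using u by simp
    qed
    ultimately show "(1 / (z * ?w ^ c)) ^ l * u l * (\<Sum>i<r. (1 / ?w ^ (q * l)) ^ i) = 0"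
      by (auto simp: sum_pow_root_of_unity)
  qed
  finally show ?thesis .
qed

lemma pairing_form_smult:
  "A \<in> carrier_mat n n \<Longrightarrow> pairing_form n X (c \<cdot>\<^sub>m A) = c * pairing_form n X A"
  by (simp add: pairing_form_def sum_distrib_left mult.assoc)

lemma pairing_form_wproj:
  "pairing_form n X (wproj n m m' z) = (1 / of_nat n) * (\<Sum>l<n. (1 / z) ^ l * pairing_form n X (wpow n m m' l))"
proof -
  have "pairing_form n X (wproj n m m' z) =
      (1 / of_nat n) * (\<Sum>i<n. \<Sum>j<n. \<Sum>l<n. (1 / z) ^ l * (wpow n m m' l $$ (i, j) * X i j))"
    unfolding pairing_form_def sum_distrib_left
    by (intro sum.cong refl) (simp add: wproj_def sum_distrib_left sum_distrib_right mult.assoc)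
  also have "(\<Sum>i<n. \<Sum>j<n. \<Sum>l<n. (1 / z) ^ l * (wpow n m m' l $$ (i, j) * X i j))
    = (\<Sum>i<n. \<Sum>l<n. \<Sum>j<n. (1 / z) ^ l * (wpow n m m' l $$ (i, j) * X i j))"
    by (intro sum.cong refl sum.swap)
  also have "\<dots> = (\<Sum>l<n. \<Sum>i<n. \<Sum>j<n. (1 / z) ^ l * (wpow n m m' l $$ (i, j) * X i j))"
    by (rule sum.swap)
  also have "\<dots> = (\<Sum>l<n. (1 / z) ^ l * pairing_form n X (wpow n m m' l))"
    by (simp add: pairing_form_def sum_distrib_left)
  finally show ?thesis .
qed

text \<open>Stated for \<open>weyl\<close> instead of powers, hence free of phases: it depends only
  on the point \<open>(x, y)\<close> modulo \<open>n\<close>, so knowledge can be carried from one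
  line to another.\<close>

definition vanishes :: "nat \<Rightarrow> (nat \<Rightarrow> nat \<Rightarrow> complex) \<Rightarrow> nat \<Rightarrow> nat \<Rightarrow> bool" where
  "vanishes n X x y \<longleftrightarrow> pairing_form n X (weyl n x y) = 0"

lemma vanishes_cong:
  "n > 0 \<Longrightarrow> [a = b] (mod n) \<Longrightarrow> [a' = b'] (mod n) \<Longrightarrow> vanishes n X a a' \<longleftrightarrow> vanishes n X b b'"
  using weyl_cong[of n a b a' b'] by (simp add: vanishes_def)

lemma vanishes_wpow: "pairing_form n X (wpow n m m' l) = 0 \<longleftrightarrow> vanishes n X (l * m) (l * m')"
  by (simp add: wpow_def pairing_form_smult vanishes_def)

context weyl_eigenvalue
begin

lemma other_eigenvalue: "weyl_eigenvalue n m m' (z * unity_root n ^ k)"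
  using n_pos z_pow
  by unfold_locales (auto simp: power_mult_distrib power_mult[symmetric] unity_root_pow_eq_1_iff)

lemma line_vanishes:
  assumes "\<And>k. k < n \<Longrightarrow> pairing_form n X (wproj n m m' (z * unity_root n ^ k)) = 0"
  shows "vanishes n X (l * m) (l * m')"
proof -
  have "pairing_form n X (wpow n m m' (l mod n)) = 0"
  proof (rule dft_inversion[where u = "\<lambda>l. pairing_form n X (wpow n m m' l)" and n = n and z = z])
    fix k assume "k < n"
    from assms[OF this] n_pos
    show "(\<Sum>j<n. (1 / (z * unity_root n ^ k)) ^ j * pairing_form n X (wpow n m m' j)) = 0"
      unfolding pairing_form_wproj by simp
  qed (use n_pos z_nonzero in auto)
  then have "vanishes n X (l mod n * m) (l mod n * m')" by (simp add: vanishes_wpow)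
  moreover have "[l mod n = l] (mod n)" by simp
  ultimately show ?thesis
    using vanishes_cong[OF n_pos cong_scalar_right[of "l mod n" l n m] cong_scalar_right[of "l mod n" l n m'], of X]
    by simp
qed

text \<open>The sum of the eigenprojections with labels in a residue class modulo \<open>q\<close> is a combination
  of the powers \<open>U\<^sup>r\<^sup>l\<close>, so one missing projection per class can be recovered.\<close>

lemma class_vanishes:
  assumes n: "n = q * r" and van: "\<And>l. vanishes n X (r * l * m) (r * l * m')" and k: "k < n"
    and others: "\<And>k'. k' < n \<Longrightarrow> k' \<noteq> k \<Longrightarrow> k' mod q = k mod q \<Longrightarrow>
      pairing_form n X (wproj n m m' (z * unity_root n ^ k')) = 0"
  shows "pairing_form n X (wproj n m m' (z * unity_root n ^ k)) = 0"
proof -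
  define g where "g k = pairing_form n X (wproj n m m' (z * unity_root n ^ k))" for k
  define c where "c = k mod q"
  define i0 where "i0 = k div q"
  have q: "q > 0" and r: "r > 0" using n n_pos by auto
  have kc: "c + q * i0 = k" by (simp add: c_def i0_def)
  have i0: "i0 < r" using k n by (simp add: i0_def less_mult_imp_div_less mult.commute)
  have u: "pairing_form n X (wpow n m m' (r * j)) = 0" for j
    using van[of j] by (simp add: vanishes_wpow)
  have "(\<Sum>i<r. g (c + q * i)) = (1 / of_nat n) *
     (\<Sum>i<r. \<Sum>l<n. (1 / (z * unity_root n ^ (c + q * i))) ^ l * pairing_form n X (wpow n m m' l))"
    by (simp only: g_def pairing_form_wproj sum_distrib_left[of "1 / of_nat n" _ "{..<r}"])
  also have "\<dots> = 0" using dft_class_sum[where u = "\<lambda>l. pairing_form n X (wpow n m m' l)", OF n n_pos u] by simp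
  finally have "(\<Sum>i<r. g (c + q * i)) = 0" .
  moreover have "(\<Sum>i<r. g (c + q * i)) = (\<Sum>i<r. if i = i0 then g k else 0)"
  proof (intro sum.cong refl)
    fix i assume "i \<in> {..<r}"
    then have "Suc i \<le> r" by simp
    then have "q * Suc i \<le> n" using n by (metis mult_le_mono2)
    moreover have "c < q" using q by (simp add: c_def)
    ultimately have "c + q * i < n" by simp
    moreover have "(c + q * i) mod q = k mod q" by (simp add: c_def)
    moreover have "c + q * i = k \<longleftrightarrow> i = i0" using kc q by auto
    ultimately show "g (c + q * i) = (if i = i0 then g k else 0)"
      using others[of "c + q * i"] by (auto simp: g_def)
  qed
  ultimately show ?thesis using i0 by (simp add: g_def)
qed

end

text \<open>For fixed \<open>y\<close>, the values on \<open>weyl n x y\<close> are, as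
  \<open>x\<close> varies, the Fourier transform of \<open>X\<close> along one cyclic
  diagonal.\<close>

lemma vanishes_imp_zero:
  assumes n: "n > 0" and van: "\<And>x y. vanishes n X x y" and ik: "i < n" "k < n"
  shows "X i k = 0"
proof -
  \<comment> \<open>Selects the diagonal through \<open>(i, k)\<close>; adding \<open>n\<close>
    avoids truncated subtraction.\<close>
  define y where "y = i + n - k"
  define h where "h k = X ((y + k) mod n) k" for k
  have "pairing_form n X (weyl n x y) = (\<Sum>k<n. (unity_root n ^ x) ^ k * h k)" for x
  proof -
    have "pairing_form n X (weyl n x y) = (\<Sum>k<n. \<Sum>i<n. weyl n x y $$ (i, k) * X i k)"
      unfolding pairing_form_def by (rule sum.swap)
    also have "\<dots> = (\<Sum>k<n. \<Sum>i<n. if i = (y + k) mod n then unity_root n ^ (x * k) * h k else 0)"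
      by (intro sum.cong refl) (auto simp: weyl_index h_def)
    also have "\<dots> = (\<Sum>k<n. (unity_root n ^ x) ^ k * h k)"
      using n by (simp add: power_mult)
    finally show ?thesis .
  qed
  then have 0: "(\<Sum>k<n. (unity_root n ^ x) ^ k * h k) = 0" for x
    using van[of x y] by (simp add: vanishes_def)
  have "h k = 0"
  proof (rule dft_inversion[where n = n and z = 1])
    fix x assume x: "x < n"
    have "unity_root n ^ x * unity_root n ^ (n - x) = 1"
      using x n by (simp add: power_add[symmetric] unity_root_pow_eq_1_iff)
    \<comment> \<open>\<open>dft_inversion\<close> expects inverse powers of the root, so the
      exponent \<open>n - x\<close> plays the part of \<open>- x\<close>.\<close>
    then have "1 / (1 * unity_root n ^ x) = unity_root n ^ (n - x)"
      by (simp add: field_simps)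
    then show "(\<Sum>j<n. (1 / (1 * unity_root n ^ x)) ^ j * h j) = 0"
      using 0[of "n - x"] by simp
  qed (use n ik in auto)
  moreover have "(y + k) mod n = i" using ik by (simp add: y_def)
  ultimately show ?thesis by (simp add: h_def)
qed

section \<open>Traces of Weyl operators\<close>

lemma mat_trace_weyl:
  assumes n: "n > 0" and "\<not> (n dvd a \<and> n dvd b)"
  shows "mat_trace (weyl n a b) = 0"
proof (cases "n dvd b")
  case True
  then have "(b + i) mod n = i" if "i < n" for i using that by auto
  then have "mat_trace (weyl n a b) = (\<Sum>i<n. (unity_root n ^ a) ^ i)"
    by (simp add: mat_trace_def weyl_index power_mult)
  also have "\<dots> = 0"
    using assms True n
    by (subst sum_pow_root_of_unity) (auto simp: power_mult[symmetric] unity_root_pow_eq_1_iff)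
  finally show ?thesis .
next
  case False
  have "i \<noteq> (b + i) mod n" if "i < n" for i
  proof
    assume "i = (b + i) mod n"
    then have "[0 + i = b + i] (mod n)" using that by (simp add: cong_def)
    then have "[0 = b] (mod n)" by (simp only: cong_add_rcancel_nat)
    then have "[b = 0] (mod n)" by (rule cong_sym)
    with False show False by (simp add: cong_0_iff)
  qed
  then show ?thesis by (simp add: mat_trace_def weyl_index)
qed

lemma mat_trace_smult: "A \<in> carrier_mat n n \<Longrightarrow> mat_trace (c \<cdot>\<^sub>m A) = c * mat_trace A"
  by (simp add: mat_trace_def sum_distrib_left)

lemma mat_trace_one: "mat_trace (1\<^sub>m n) = of_nat n"
  by (simp add: mat_trace_def)

lemma mat_trace_mult:
  assumes "A \<in> carrier_mat m n" "B \<in> carrier_mat n m"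
  shows "mat_trace (A * B) = (\<Sum>i<m. \<Sum>j<n. A $$ (i, j) * B $$ (j, i))"
proof -
  have "mat_trace (A * B) = (\<Sum>i<m. (A * B) $$ (i, i))" using assms by (simp add: mat_trace_def)
  also have "\<dots> = (\<Sum>i<m. \<Sum>j<n. A $$ (i, j) * B $$ (j, i))"
    using assms by (intro sum.cong refl mult_mat_index) auto
  finally show ?thesis .
qed

lemma mat_trace_mult_commute:
  assumes "A \<in> carrier_mat m n" "B \<in> carrier_mat n m"
  shows "mat_trace (A * B) = mat_trace (B * A)"
  unfolding mat_trace_mult[OF assms] mat_trace_mult[OF assms(2,1)]
  by (subst sum.swap) (simp add: mult.commute)

lemma mat_trace_mult_wproj:
  assumes "M \<in> carrier_mat n n"
  shows "mat_trace (M * wproj n m m' z) = (1 / of_nat n) * (\<Sum>l<n. (1 / z) ^ l * mat_trace (M * wpow n m m' l))"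
proof -
  have "mat_trace (M * wproj n m m' z) = (\<Sum>i<n. (M * wproj n m m' z) $$ (i, i))"
    using assms by (simp add: mat_trace_def)
  also have "\<dots> = (\<Sum>i<n. (1 / of_nat n) * (\<Sum>l<n. (1 / z) ^ l * (M * wpow n m m' l) $$ (i, i)))"
    using assms by (intro sum.cong refl wproj_mult_right_index) auto
  also have "\<dots> = (1 / of_nat n) * (\<Sum>l<n. (1 / z) ^ l * (\<Sum>i<n. (M * wpow n m m' l) $$ (i, i)))"
    unfolding sum_distrib_left by (rule sum.swap)
  finally show ?thesis using assms by (simp add: mat_trace_def)
qed

text \<open>For a generating direction every power of \<open>U\<close> with \<open>0 < l < n\<close>
  is traceless, so only \<open>l = 0\<close> contributes.\<close>

lemma (in weyl_eigenvalue) trace_one_wproj: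
  assumes gen: "generating n m m'"
  shows "trace_one_projection n P"
proof -
  have "mat_trace P = mat_trace (1\<^sub>m n * P)" by simp
  also have "\<dots> = (1 / of_nat n) * (\<Sum>l<n. (1 / z) ^ l * mat_trace (1\<^sub>m n * wpow n m m' l))"
    by (rule mat_trace_mult_wproj) auto
  also have "\<dots> = (1 / of_nat n) * (\<Sum>l<n. if l = 0 then of_nat n else 0)"
  proof -
    have "(1 / z) ^ l * mat_trace (1\<^sub>m n * wpow n m m' l) = (if l = 0 then of_nat n else 0)" if "l < n" for l
    proof (cases "l = 0")
      case False
      then have "\<not> n dvd l" using that nat_dvd_not_less by blast
      then have "mat_trace (weyl n (l * m) (l * m')) = 0"
        using gen n_pos mat_trace_weyl[OF n_pos, of "l * m" "l * m'"] unfolding generating_def by blast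
      then have "mat_trace (wpow n m m' l) = 0" by (simp add: wpow_def mat_trace_smult[of _ n])
      then show ?thesis using False by simp
    qed (simp add: wpow_0 mat_trace_one)
    then show ?thesis by (intro arg_cong2[of _ _ _ _ "(*)"] sum.cong refl) simp
  qed
  also have "\<dots> = 1" using n_pos by simp
  finally show ?thesis using orth_projection_wproj by (simp add: trace_one_projection_def)
qed

section \<open>Overlaps of eigenprojections\<close>

lemma wpow_add:
  assumes "n > 0"
  shows "wpow n m m' (l + l') = wpow n m m' l * wpow n m m' l'"
proof (induction l')
  case 0
  then show ?case by (simp add: wpow_0)
next
  case (Suc l')
  have "wpow n m m' (l + Suc l') = wpow n m m' (l + l') * weyl n m m'"
    by (simp add: wpow_Suc(1)[OF assms])
  also have "\<dots> = wpow n m m' l * (wpow n m m' l' * weyl n m m')"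
    unfolding Suc by (rule assoc_mult_mat[of _ n n _ n _ n]) auto
  finally show ?case by (simp add: wpow_Suc(1)[OF assms])
qed

context weyl_eigenvalue
begin

text \<open>Splitting exponents as \<open>l = i * r + j\<close>, only \<open>j = 0\<close> survives,
  and there the power acts on \<open>Q\<close> by \<open>w ^ i\<close>. What remains is
  \<open>1 / n\<close> times the sum of the first \<open>q\<close> powers of a \<open>q\<close>-th
  root of unity, which is \<open>q\<close> or 0.\<close>

lemma overlap_periodic:
  assumes Q: "Q \<in> carrier_mat n n" "mat_trace Q = 1" and n: "n = q * r"
    and w: "wpow n m m' r * Q = w \<cdot>\<^sub>m Q"
    and zero: "\<And>l. \<not> r dvd l \<Longrightarrow> mat_trace (wpow n m m' l * Q) = 0"
  shows "mat_trace (P * Q) \<in> {0, 1 / of_nat r}"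
proof -
  have r: "r > 0" and q: "q > 0" using n n_pos by auto
  have pow: "wpow n m m' (i * r) * Q = w ^ i \<cdot>\<^sub>m Q" for i
  proof (induction i)
    case 0
    then show ?case using Q by (simp add: wpow_0 smult_one_mat)
  next
    case (Suc i)
    have "wpow n m m' (Suc i * r) * Q = wpow n m m' (i * r + r) * Q" by (simp add: add.commute)
    also have "\<dots> = wpow n m m' (i * r) * (wpow n m m' r * Q)"
      unfolding wpow_add[OF n_pos] using Q by (intro assoc_mult_mat[of _ n n _ n _ n]) auto
    also have "\<dots> = w \<cdot>\<^sub>m (wpow n m m' (i * r) * Q)"
      unfolding w using Q by (intro mult_smult_distrib[of _ n n _ n]) auto
    finally show ?case by (simp add: Suc smult_smult_mat)
  qed
  have "mat_trace (P * Q) = mat_trace (Q * P)"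
    using Q by (intro mat_trace_mult_commute[of _ n n]) auto
  also have "\<dots> = (1 / of_nat n) * (\<Sum>l<n. (1 / z) ^ l * mat_trace (Q * wpow n m m' l))"
    using Q(1) by (rule mat_trace_mult_wproj)
  also have "(\<Sum>l<n. (1 / z) ^ l * mat_trace (Q * wpow n m m' l))
      = (\<Sum>l<q * r. (1 / z) ^ (l div r * r + l mod r) * mat_trace (wpow n m m' (l div r * r + l mod r) * Q))"
    using Q by (simp add: n mat_trace_mult_commute[of Q n n])
  also have "\<dots> = (\<Sum>i<q. \<Sum>j<r. (1 / z) ^ (i * r + j) * mat_trace (wpow n m m' (i * r + j) * Q))"
    by (rule sum_lessThan_mult)
  also have "\<dots> = (\<Sum>i<q. \<Sum>j<r. if j = 0 then (w / z ^ r) ^ i else 0)"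
  proof (intro sum.cong refl)
    fix i j assume "j \<in> {..<r}"
    then have j: "j < r" by simp
    show "(1 / z) ^ (i * r + j) * mat_trace (wpow n m m' (i * r + j) * Q) = (if j = 0 then (w / z ^ r) ^ i else 0)"
    proof (cases "j = 0")
      case True
      then show ?thesis using Q pow[of i]
        by (simp add: mat_trace_smult[of _ n] power_divide power_mult[symmetric] mult.commute)
    next
      case False
      then have "\<not> r dvd i * r + j" using j nat_dvd_not_less by (simp add: dvd_add_right_iff)
      then show ?thesis using False zero by simp
    qed
  qed
  also have "\<dots> = (\<Sum>i<q. (w / z ^ r) ^ i)" using r by simp
  also have "\<dots> = (if w / z ^ r = 1 then of_nat q else 0)"
  proof (rule sum_pow_root_of_unity)
    \<comment> \<open>Both \<open>w ^ q\<close> and \<open>z ^ n\<close> equal the scalar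
      \<open>U ^ n\<close>, so \<open>w / z ^ r\<close> is a \<open>q\<close>-th root of
      unity.\<close>
    have "w ^ q = mat_trace (wpow n m m' n * Q)" using pow[of q] Q by (simp add: n mat_trace_smult[of _ n])
    also have "\<dots> = z ^ n"
      using Q n_pos by (simp add: wpow_n z_pow mult_smult_assoc_mat[of _ n n _ n] mat_trace_smult[of _ n])
    finally show "(w / z ^ r) ^ q = 1"
      using z_nonzero by (simp add: n power_divide power_mult[symmetric] mult.commute)
  qed
  finally show ?thesis using q by (auto simp: n field_simps)
qed

end

text \<open>If \<open>r\<close> is the least positive \<open>l\<close> with \<open>l (m, m')\<close> in the group generated by \<open>(k, k')\<close>, only
  multiples of \<open>r\<close> contribute to the trace, and their contributions are the values of a character.\<close>

lemma overlap_wproj: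
  assumes z: "weyl_eigenvalue n m m' z" and y: "weyl_eigenvalue n k k' y" and gen: "generating n k k'"
  shows "\<exists>r>0. r dvd n \<and> mat_trace (wproj n m m' z * wproj n k k' y) \<in> {0, 1 / of_nat r}"
proof -
  interpret Z: weyl_eigenvalue n m m' z by fact
  interpret Y: weyl_eigenvalue n k k' y by fact
  have n: "n > 0" by (rule Z.n_pos)
  define Q where "Q = wproj n k k' y"
  have Q: "Q \<in> carrier_mat n n" "mat_trace Q = 1"
    using Y.trace_one_wproj[OF gen] by (auto simp: Q_def trace_one_projection_def)
  define H where "H l \<longleftrightarrow> (\<exists>j. [l * m = j * k] (mod n) \<and> [l * m' = j * k'] (mod n))" for l
  define r where "r = (LEAST l. l > 0 \<and> H l)"
  have "H n" unfolding H_def by (rule exI[of _ 0]) (simp add: cong_0_iff)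
  then have r: "r > 0" "H r"
    using LeastI[of "\<lambda>l. l > 0 \<and> H l" n] n by (auto simp: r_def)
  have least: "r \<le> l" if "l > 0" "H l" for l using that unfolding r_def by (intro Least_le) auto
  have dvd: "r dvd l" if l: "H l" for l
  proof -
    obtain j where j: "[r * m = j * k] (mod n)" "[r * m' = j * k'] (mod n)" using r(2) by (auto simp: H_def)
    obtain i where i: "[l * m = i * k] (mod n)" "[l * m' = i * k'] (mod n)" using l by (auto simp: H_def)
    \<comment> \<open>In the naturals \<open>j * (n - 1)\<close> stands for \<open>- j\<close>
      modulo \<open>n\<close>. Thus \<open>e\<close> represents \<open>i - j * (l div r)\<close>,
      the multiplier of \<open>(k, k')\<close> belonging to \<open>l mod r\<close>.\<close>
    define e where "e = i + j * (n - 1) * (l div r)"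
    have "[(l mod r) * a = e * b] (mod n)" if jj: "[r * a = j * b] (mod n)" and ii: "[l * a = i * b] (mod n)" for a b
    proof -
      have "[int (l mod r) * int a = int e * int b] (mod int n)"
      proof -
        have 1: "[int r * int a = int j * int b] (mod int n)" "[int l * int a = int i * int b] (mod int n)"
          using jj ii by (metis cong_int_iff of_nat_mult)+
        have lm: "int (l mod r) = int l - int r * int (l div r)"
          by (simp add: zmod_int zdiv_int minus_mult_div_eq_mod)
        have "[int (l mod r) * int a = int l * int a - int (l div r) * (int r * int a)] (mod int n)"
          unfolding lm by (simp add: algebra_simps)
        also have "[int l * int a - int (l div r) * (int r * int a) = int i * int b - int (l div r) * (int j * int b)] (mod int n)"
          by (rule cong_diff[OF 1(2) cong_scalar_left[OF 1(1)]])
        also have "[int i * int b - int (l div r) * (int j * int b) = int e * int b] (mod int n)"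
        proof -
          have "int (n - 1) = int n - 1" using n by simp
          then have e: "int e = int i + int j * (int n - 1) * int (l div r)"
            unfolding e_def of_nat_add of_nat_mult by simp
          have "int e * int b = int i * int b - int (l div r) * (int j * int b) + int n * (int (l div r) * int j * int b)"
            unfolding e by (simp add: algebra_simps)
          then show ?thesis by (metis cong_iff_lin)
        qed
        finally show ?thesis .
      qed
      then show ?thesis by (metis cong_int_iff of_nat_mult)
    qed
    from this[OF j(1) i(1)] this[OF j(2) i(2)] have "H (l mod r)" by (auto simp: H_def)
    then have "l mod r = 0" using least[of "l mod r"] r(1) mod_less_divisor[OF r(1), of l] by linarith
    then show ?thesis by auto
  qed
  obtain q where q: "n = q * r" using dvd[OF \<open>H n\<close>] by (metis dvd_def mult.commute)
  obtain j where j: "[r * m = j * k] (mod n)" "[r * m' = j * k'] (mod n)" using r(2) by (auto simp: H_def)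
  \<comment> \<open>The points agree modulo \<open>n\<close>, so \<open>U ^ r\<close> is a phase
    times a power of the second Weyl operator, of which \<open>Q\<close> is an
    eigenprojection.\<close>
  have "wpow n m m' r = (wphase n m m' r / wphase n k k' j) \<cdot>\<^sub>m wpow n k k' j"
    using weyl_cong[OF n j] by (simp add: wpow_def smult_smult_mat)
  then have w: "wpow n m m' r * Q = (wphase n m m' r / wphase n k k' j * y ^ j) \<cdot>\<^sub>m Q"
    using Q Y.wpow_mult[OF wproj_carrier Y.weyl_wproj, of j]
    by (simp add: mult_smult_assoc_mat[of _ n n _ n] smult_smult_mat Q_def)
  have "mat_trace (wpow n m m' l * Q) = 0" if l: "\<not> r dvd l" for l
  proof -
    have "mat_trace (wpow n m m' l * wpow n k k' i) = 0" for i
    proof -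
      \<comment> \<open>Otherwise \<open>l\<close> times \<open>(m, m')\<close> would equal
        \<open>- i\<close> times \<open>(k, k')\<close>, with \<open>- i\<close> written as
        \<open>i * (n - 1)\<close>, and \<open>H l\<close> would follow.\<close>
      have "\<not> (n dvd l * m + i * k \<and> n dvd l * m' + i * k')"
      proof
        assume d: "n dvd l * m + i * k \<and> n dvd l * m' + i * k'"
        have "[l * a = (i * (n - 1)) * b] (mod n)" if ab: "n dvd l * a + i * b" for a b
        proof -
          obtain t where t: "l * a + i * b = n * t" using ab by (rule dvdE)
          have "l * a mod n = (l * a + n * (i * b)) mod n" by simp
          also have "l * a + n * (i * b) = (l * a + i * b) + (i * (n - 1)) * b"
            using n by (cases n) (auto simp: algebra_simps)
          also have "\<dots> mod n = (i * (n - 1)) * b mod n" unfolding t by simp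
          finally show ?thesis by (simp add: cong_def)
        qed
        with d have "H l" unfolding H_def by blast
        with dvd l show False by blast
      qed
      then have "mat_trace (weyl n (l * m + i * k) (l * m' + i * k')) = 0"
        using mat_trace_weyl[OF n] by blast
      then show ?thesis
        by (simp add: wpow_def mult_smult_assoc_mat[of _ n n _ n] mult_smult_distrib[of _ n n _ n]
            weyl_mult[OF n] mat_trace_smult[of _ n])
    qed
    then show ?thesis unfolding Q_def by (subst mat_trace_mult_wproj) auto
  qed
  from Z.overlap_periodic[OF Q q w this] show ?thesis
    using r(1) q unfolding Q_def by (intro exI[of _ r]) auto
qed

text \<open>The Weyl operator of \<open>(1, 0)\<close> is diagonal with distinct entries, so the
  kets are the eigenprojections of a line like any other.\<close>

lemma ket_proj_eq_wproj:
  assumes "j < n"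
  shows "ket_proj n j = wproj n 1 0 (unity_root n ^ j)"
proof (rule eq_matI)
  fix i k assume "i < dim_row (wproj n 1 0 (unity_root n ^ j))" "k < dim_col (wproj n 1 0 (unity_root n ^ j))"
  then have ik: "i < n" "k < n" by auto
  have n: "n > 0" using assms by simp
  have "wproj n 1 0 (unity_root n ^ j) $$ (i, k)
      = (1 / of_nat n) * (\<Sum>l<n. if i = k then (unity_root n ^ k / unity_root n ^ j) ^ l else 0)"
    using ik by (auto simp: wproj_def wpow_def wphase_def weyl_index power_divide power_mult[symmetric]
        mult.commute sum_distrib_left intro!: sum.cong)
  also have "\<dots> = (if i = j \<and> k = j then 1 else 0)"
  proof -
    have "(unity_root n ^ k / unity_root n ^ j) ^ n = 1"
      using unity_root_pow_eq_1_iff[OF n, of "k * n"] unity_root_pow_eq_1_iff[OF n, of "j * n"]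
      by (simp add: power_divide power_mult[symmetric])
    moreover have "unity_root n ^ k / unity_root n ^ j = 1 \<longleftrightarrow> k = j"
      using unity_root_pow_eq_iff[OF n, of k j] assms ik by (auto simp: cong_def)
    ultimately show ?thesis using n by (cases "i = k") (auto simp: sum_pow_root_of_unity)
  qed
  finally show "ket_proj n j $$ (i, k) = wproj n 1 0 (unity_root n ^ j) $$ (i, k)"
    using ik by (simp add: ket_proj_def)
qed (auto simp: ket_proj_def)

lemma mat_trace_mult_ket:
  assumes "A \<in> carrier_mat n n" "j < n"
  shows "mat_trace (A * ket_proj n j) = A $$ (j, j)" "mat_trace (ket_proj n j * A) = A $$ (j, j)"
proof -
  have K: "ket_proj n j \<in> carrier_mat n n" by (simp add: ket_proj_def)
  have "mat_trace (A * ket_proj n j) = (\<Sum>i<n. \<Sum>k<n. if k = j then (if i = j then A $$ (i, k) else 0) else 0)"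
    unfolding mat_trace_mult[OF assms(1) K] by (intro sum.cong refl) (auto simp: ket_proj_def)
  then show "mat_trace (A * ket_proj n j) = A $$ (j, j)" using assms(2) by simp
  then show "mat_trace (ket_proj n j * A) = A $$ (j, j)"
    using mat_trace_mult_commute[OF assms(1) K] by simp
qed

section \<open>Prime dimension\<close>

text \<open>The shape shared by the members of all families, kets included, so that traces and
  overlaps are settled once.\<close>

definition weyl_projection :: "nat \<Rightarrow> complex mat \<Rightarrow> bool" where
  "weyl_projection n P \<longleftrightarrow>
     (\<exists>m m' z. weyl_eigenvalue n m m' z \<and> generating n m m' \<and> P = wproj n m m' z)"

lemma weyl_projection_trace_one: "weyl_projection n P \<Longrightarrow> trace_one_projection n P"
  unfolding weyl_projection_def by (metis weyl_eigenvalue.trace_one_wproj)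

lemma weyl_projection_overlap:
  assumes "weyl_projection n P" "weyl_projection n Q"
  shows "\<exists>r>0. r dvd n \<and> mat_trace (P * Q) \<in> {0, 1 / of_nat r}"
  using assms overlap_wproj unfolding weyl_projection_def by metis

text \<open>Bounds the cardinality from above only, so that passing to tensor products requires no
  injectivity.\<close>

definition good_system :: "nat \<Rightarrow> complex mat set \<Rightarrow> bool" where
  "good_system n S \<longleftrightarrow> finite S \<and> card S \<le> n\<^sup>2 \<and> (\<forall>P\<in>S. trace_one_projection n P) \<and> separating n S"

lemma good_system_imp_info_complete:
  assumes "good_system n S"
  shows "info_complete_system n S"
proof -
  have S: "S \<subseteq> carrier_mat n n"
    using assms trace_one_projection_carrier by (auto simp: good_system_def)
  show ?thesis
    using assms separating_imp_informationally_complete[OF _ S] trace_one_imp_rank_one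
    by (auto simp: good_system_def info_complete_system_def)
qed

lemma separating_if_vanishes:
  assumes n: "n > 0"
    and van: "\<And>X. (\<And>P. P \<in> S \<Longrightarrow> pairing_form n X P = 0) \<Longrightarrow> (\<And>x y. vanishes n X x y)"
  shows "separating n S"
  unfolding separating_def using vanishes_imp_zero[OF n] van by blast

section \<open>Spectra and eigenbases of single Weyl operators\<close>

lemma generating_left [simp]: "generating n 1 m" "generating n (Suc 0) m"
  by (simp_all add: generating_def)

lemma generating_right [simp]: "generating n m 1" "generating n m (Suc 0)"
  by (simp_all add: generating_def)

text \<open>The exponent is a multiple of \<open>n / 2\<close>, so the phase is a sign. It is 1 for
  odd \<open>n\<close>; for even \<open>n\<close> and odd \<open>m * m'\<close> it is
  \<open>-1\<close>, which moves the eigenvalues by half a step.\<close>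

lemma wphase_full:
  assumes "n > 0"
  shows "wphase n m m' n = (- 1) ^ (m * m' * (n - 1))"
proof -
  have "even (n * (n - 1))" by (cases n) auto
  then have "real (n * (n - 1) div 2) = real n * real (n - 1) / 2" by (simp add: real_of_nat_div)
  then have e: "real (m * m' * (n * (n - 1) div 2)) * (2 * pi / real n) = real (m * m' * (n - 1)) * pi"
    using assms by (simp only: of_nat_mult) (simp add: field_simps)
  have "wphase n m m' n = cis (real (m * m' * (n - 1)) * pi)"
    unfolding wphase_def DeMoivre e ..
  also have "\<dots> = cis pi ^ (m * m' * (n - 1))" by (simp only: DeMoivre)
  finally show ?thesis by simp
qed

lemma weyl_eigenvalue_exists:
  assumes "n > 0"
  shows "\<exists>z. weyl_eigenvalue n m m' z"
proof -
  have "cis (pi * real (m * m' * (n - 1)) / real n) ^ n = cis (real (m * m' * (n - 1)) * pi)"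
    using assms by (simp add: DeMoivre mult.commute)
  also have "\<dots> = (- 1) ^ (m * m' * (n - 1))"
    using DeMoivre[of pi "m * m' * (n - 1)"] by simp
  finally show ?thesis using assms unfolding weyl_eigenvalue_def by (metis wphase_full)
qed

lemma weyl_eigenvalue_1_0: "n > 0 \<Longrightarrow> weyl_eigenvalue n 1 0 1"
  by unfold_locales (simp_all add: wphase_def)

lemma root_of_unity_eq_pow:
  assumes "n > 0" "w ^ n = 1"
  shows "\<exists>k<n. w = unity_root n ^ k"
proof -
  have "w \<in> (\<lambda>k. cis (2 * pi * real k / real n)) ` {..<n}"
    using bij_betw_roots_unity[OF assms(1)] assms(2) by (auto simp: bij_betw_def)
  then obtain k where "k < n" "w = cis (2 * pi * real k / real n)" by auto
  then show ?thesis by (intro exI[of _ k]) (simp add: DeMoivre mult.commute)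
qed

context weyl_eigenvalue
begin

lemma weyl_eigenvalue_other:
  assumes "weyl_eigenvalue n m m' y"
  shows "\<exists>k<n. y = z * unity_root n ^ k"
proof -
  have "(y / z) ^ n = 1"
    using assms z_pow z_nonzero n_pos wphase_nonzero[of n m m' n]
    by (simp add: power_divide weyl_eigenvalue_def)
  from root_of_unity_eq_pow[OF n_pos this] show ?thesis
    using z_nonzero by (metis nonzero_mult_div_cancel_left times_divide_eq_right)
qed

end

lemma wpow_mult_vec:
  assumes n: "n > 0" and v: "v \<in> carrier_vec n" "weyl n m m' *\<^sub>v v = y \<cdot>\<^sub>v v"
  shows "wpow n m m' l *\<^sub>v v = y ^ l \<cdot>\<^sub>v v"
proof (induction l)
  case 0
  then show ?case using v by (simp add: wpow_0)
next
  case (Suc l)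
  have "wpow n m m' (Suc l) *\<^sub>v v = wpow n m m' l *\<^sub>v (weyl n m m' *\<^sub>v v)"
    unfolding wpow_Suc(1)[OF n, symmetric] using v(1) by (intro assoc_mult_mat_vec) auto
  also have "\<dots> = y \<cdot>\<^sub>v (wpow n m m' l *\<^sub>v v)"
    unfolding v(2) using v(1) by (intro mult_mat_vec) auto
  finally show ?case using v(1) by (simp add: Suc smult_smult_assoc)
qed

lemma eigenvector_imp_weyl_eigenvalue:
  assumes n: "n > 0" and v: "v \<in> carrier_vec n" "v \<noteq> 0\<^sub>v n" "weyl n m m' *\<^sub>v v = y \<cdot>\<^sub>v v"
  shows "weyl_eigenvalue n m m' y"
proof
  obtain i where i: "i < n" "v $ i \<noteq> 0"
    using v(1,2) by (metis carrier_vecD eq_vecI index_zero_vec(1,2))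
  have "wphase n m m' n \<cdot>\<^sub>v v = (wphase n m m' n \<cdot>\<^sub>m 1\<^sub>m n) *\<^sub>v v"
    using v(1) by (intro eq_vecI) auto
  also have "\<dots> = y ^ n \<cdot>\<^sub>v v"
    using wpow_mult_vec[OF n v(1,3), of n] by (simp add: wpow_n[OF n])
  finally have "(wphase n m m' n \<cdot>\<^sub>v v) $ i = (y ^ n \<cdot>\<^sub>v v) $ i" by simp
  then show "y ^ n = wphase n m m' n" using i v(1) by simp
qed fact

context weyl_eigenvalue
begin

lemma eigenvector_exists:
  assumes "generating n m m'"
  shows "\<exists>v. v \<in> carrier_vec n \<and> v \<noteq> 0\<^sub>v n \<and> U *\<^sub>v v = z \<cdot>\<^sub>v v"
proof -
  obtain j where j: "j < n" "P $$ (j, j) \<noteq> 0"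
    using trace_one_projection_entries[OF trace_one_wproj[OF assms]] by blast
  let ?v = "P *\<^sub>v unit_vec n j"
  have "?v \<in> eigenspace U z" unfolding range_wproj[symmetric] by auto
  moreover have "?v \<noteq> 0\<^sub>v n"
  proof
    assume "?v = 0\<^sub>v n"
    then have "?v $ j = 0" using j by simp
    then show False using j by (simp add: scalar_prod_def if_distrib cong: if_cong)
  qed
  ultimately show ?thesis using j by (intro exI[of _ ?v]) (auto simp: eigenspace_def)
qed

lemma wproj_neq:
  assumes "generating n m m'" "wproj n m m' y = P" "weyl_eigenvalue n m m' y"
  shows "y = z"
proof -
  interpret Y: weyl_eigenvalue n m m' y by fact
  obtain j where j: "j < n" "P $$ (j, j) \<noteq> 0"
    using trace_one_projection_entries[OF trace_one_wproj[OF assms(1)]] by blast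
  have "y \<cdot>\<^sub>m P = z \<cdot>\<^sub>m P" using weyl_wproj Y.weyl_wproj assms(2) by simp
  then have "(y \<cdot>\<^sub>m P) $$ (j, j) = (z \<cdot>\<^sub>m P) $$ (j, j)" by simp
  then show ?thesis using j by simp
qed

lemma wproj_unity_root_inj:
  assumes "generating n m m'" "k < n" "k' < n"
    and "wproj n m m' (z * unity_root n ^ k) = wproj n m m' (z * unity_root n ^ k')"
  shows "k = k'"
proof -
  interpret Z: weyl_eigenvalue n m m' "z * unity_root n ^ k'" by (rule other_eigenvalue)
  have "z * unity_root n ^ k = z * unity_root n ^ k'"
    using Z.wproj_neq[OF assms(1,4) other_eigenvalue] .
  then have "[k = k'] (mod n)" using z_nonzero unity_root_pow_eq_iff[OF n_pos] by simp
  then show ?thesis using assms(2,3) by (simp add: cong_def)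
qed

text \<open>Any eigenvalue differs from \<open>z\<close> by an \<open>n\<close>-th root of unity as
  a factor; conversely each such value has an eigenvector, since its projection has trace
  one.\<close>

lemma rank_one_eigenprojs_weyl:
  assumes gen: "generating n m m'"
  shows "rank_one_eigenprojs U = (\<lambda>k. wproj n m m' (z * unity_root n ^ k)) ` {..<n}"
proof (intro equalityI subsetI)
  fix Q assume "Q \<in> rank_one_eigenprojs U"
  then obtain y where y: "Q = eigenproj U y" "eigenvalue U y" by (auto simp: rank_one_eigenprojs_def)
  then obtain v where "v \<in> carrier_vec n" "v \<noteq> 0\<^sub>v n" "U *\<^sub>v v = y \<cdot>\<^sub>v v"
    by (auto simp: eigenvalue_def eigenvector_def)
  then have Y: "weyl_eigenvalue n m m' y" by (intro eigenvector_imp_weyl_eigenvalue[OF n_pos])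
  then show "Q \<in> (\<lambda>k. wproj n m m' (z * unity_root n ^ k)) ` {..<n}"
    using weyl_eigenvalue_other[OF Y] y(1) weyl_eigenvalue.eigenproj_weyl[OF Y] by auto
next
  fix Q assume "Q \<in> (\<lambda>k. wproj n m m' (z * unity_root n ^ k)) ` {..<n}"
  then obtain k where k: "Q = wproj n m m' (z * unity_root n ^ k)" by auto
  interpret Z: weyl_eigenvalue n m m' "z * unity_root n ^ k" by (rule other_eigenvalue)
  have "eigenvalue U (z * unity_root n ^ k)"
    using Z.eigenvector_exists[OF gen] by (auto simp: eigenvalue_def eigenvector_def)
  moreover have "rank_one_projection n Q"
    using Z.trace_one_wproj[OF gen] trace_one_imp_rank_one k by blast
  ultimately show "Q \<in> rank_one_eigenprojs U"
    unfolding rank_one_eigenprojs_def using Z.eigenproj_weyl k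
    by (intro CollectI exI[of _ "z * unity_root n ^ k"]) simp
qed

end

lemma vanishes_diagonal:
  assumes n: "n > 0" and "\<And>k. k < n \<Longrightarrow> pairing_form n X (ket_proj n k) = 0" and y: "[y = 0] (mod n)"
  shows "vanishes n X x y"
proof -
  interpret weyl_eigenvalue n 1 0 1 by (rule weyl_eigenvalue_1_0[OF n])
  have "vanishes n X (x * 1) (x * 0)"
    by (rule line_vanishes) (use assms(2) ket_proj_eq_wproj in auto)
  then show ?thesis using vanishes_cong[OF n cong_refl y] by simp
qed

text \<open>The case of a single residue class: all eigenprojections sum to the identity, so
  vanishing at the origin recovers one missing label.\<close>

lemma (in weyl_eigenvalue) line_vanishes_but_one:
  assumes "vanishes n X 0 0"
    and "\<And>k. k < n \<Longrightarrow> k \<noteq> k0 \<Longrightarrow> pairing_form n X (wproj n m m' (z * unity_root n ^ k)) = 0"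
  shows "vanishes n X (l * m) (l * m')"
proof (rule line_vanishes)
  fix k assume k: "k < n"
  have van: "vanishes n X (n * l * m) (n * l * m')" for l
    using assms(1) vanishes_cong[OF n_pos, of "n * l * m" 0 "n * l * m'" 0 X] by (simp add: cong_0_iff)
  show "pairing_form n X (wproj n m m' (z * unity_root n ^ k)) = 0"
  proof (cases "k = k0")
    case True
    show ?thesis
      by (rule class_vanishes[where q = 1 and r = n]) (use van k True assms(2) in auto)
  qed (use assms(2) k in auto)
qed

lemma ex_cong_mult_nat:
  fixes x y n :: nat
  assumes "coprime y n" "n > 0"
  shows "\<exists>b<n. [y * b = x] (mod n)"
proof -
  obtain i where i: "[y * i = 1] (mod n)" using cong_solve_coprime_nat[OF assms(1)] by auto
  have "[y * (i * x mod n) = y * (i * x)] (mod n)" by (intro cong_scalar_left) (simp add: cong_def)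
  also have "y * (i * x) = y * i * x" by simp
  also have "[y * i * x = 1 * x] (mod n)" by (rule cong_scalar_right[OF i])
  finally show ?thesis using assms(2) by (intro exI[of _ "i * x mod n"]) auto
qed

lemma coprime_prime_iff: "prime (p :: nat) \<Longrightarrow> coprime y p \<longleftrightarrow> \<not> p dvd y"
  by (metis coprime_commute dvd_refl not_coprimeI not_prime_unit prime_imp_coprime)

lemma overlaps_eqI:
  assumes w: "\<And>P. P \<in> S \<Longrightarrow> weyl_projection n P"
    and z: "0 \<in> overlaps S" and d: "\<And>d. d > 0 \<Longrightarrow> d dvd n \<Longrightarrow> 1 / of_nat d \<in> overlaps S"
  shows "overlaps S = {0} \<union> {1 / of_nat d' | d'. d' > 0 \<and> d' dvd n}"
proof (intro equalityI subsetI)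
  fix x assume "x \<in> overlaps S"
  then obtain P Q where "P \<in> S" "Q \<in> S" "x = mat_trace (P * Q)" by (auto simp: overlaps_def)
  then show "x \<in> {0} \<union> {1 / of_nat d' | d'. d' > 0 \<and> d' dvd n}"
    using weyl_projection_overlap[OF w w, of P Q] by auto
qed (use z d in auto)

lemma weyl_projection_wprojI:
  "weyl_eigenvalue n m m' z \<Longrightarrow> generating n m m' \<Longrightarrow> weyl_projection n (wproj n m m' z)"
  by (auto simp: weyl_projection_def)

lemma weyl_projection_ket: "k < n \<Longrightarrow> weyl_projection n (ket_proj n k)"
  using weyl_eigenvalue.other_eigenvalue[OF weyl_eigenvalue_1_0, of n k] ket_proj_eq_wproj[of k n]
    weyl_projection_wprojI[of n 1 0 "1 * unity_root n ^ k"] by simp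

text \<open>With \<open>m' = 1\<close> the powers with \<open>0 < l < n\<close> have zero diagonal.
  This is the unbiasedness to the kets that produces the overlap \<open>1 / n\<close>.\<close>

lemma (in weyl_eigenvalue) wproj_diagonal:
  assumes "m' = 1" "j < n"
  shows "P $$ (j, j) = 1 / of_nat n"
proof -
  have "(1 / z) ^ l * wpow n m m' l $$ (j, j) = (if l = 0 then 1 else 0)" if l: "l < n" for l
  proof (cases "l = 0")
    case False
    have "j \<noteq> (l + j) mod n"
    proof
      assume "j = (l + j) mod n"
      then have "[0 + j = l + j] (mod n)" using assms by (simp add: cong_def)
      then have "[0 = l] (mod n)" by (simp only: cong_add_rcancel_nat)
      then show False using l False by (simp add: cong_def)
    qed
    then show ?thesis using False assms by (simp add: wpow_def weyl_index)
  qed (use assms in \<open>simp add: wpow_0\<close>)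
  then show ?thesis using assms n_pos by (simp add: wproj_def)
qed

lemma basic_overlaps:
  assumes n: "n \<ge> 2" and ket: "\<And>k. k < n \<Longrightarrow> ket_proj n k \<in> S"
    and P: "weyl_eigenvalue n m 1 z" "wproj n m 1 z \<in> S"
  shows "0 \<in> overlaps S" "1 \<in> overlaps S" "1 / of_nat n \<in> overlaps S"
proof -
  have K: "ket_proj n k \<in> carrier_mat n n" for k by (simp add: ket_proj_def)
  have 0: "ket_proj n 0 \<in> S" and 1: "ket_proj n 1 \<in> S" using n ket by auto
  have "mat_trace (ket_proj n 0 * ket_proj n 1) = 0"
    using n by (subst mat_trace_mult_ket(1)[OF K]) (auto simp: ket_proj_def)
  with 0 1 show "0 \<in> overlaps S" by (force simp: overlaps_def)
  have "mat_trace (ket_proj n 0 * ket_proj n 0) = 1"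
    using n by (subst mat_trace_mult_ket(1)[OF K]) (auto simp: ket_proj_def)
  with 0 show "1 \<in> overlaps S" by (force simp: overlaps_def)
  have "mat_trace (wproj n m 1 z * ket_proj n 0) = 1 / of_nat n"
    using n weyl_eigenvalue.wproj_diagonal[OF P(1)] by (subst mat_trace_mult_ket(1)) auto
  with 0 P(2) show "1 / of_nat n \<in> overlaps S" by (force simp: overlaps_def)
qed

lemma prime_line_cover:
  assumes p: "prime (p :: nat)" 
  shows "[y = 0] (mod p) \<or> (\<exists>b<p. [y * b = x] (mod p))"
  using ex_cong_mult_nat[of y p x] p coprime_prime_iff[OF p, of y] prime_gt_0_nat[OF p]
  by (auto simp: cong_0_iff)

lemma prime_family_properties:
  assumes p: "prime p" and F: "prime_family p F"
  shows "good_system p F"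
    and "overlaps F = {0} \<union> {1 / of_nat d' | d'. d' > 0 \<and> d' dvd p}"
proof -
  have p2: "p \<ge> 2" and p0: "p > 0" using p by (auto simp: prime_ge_2_nat prime_gt_0_nat)
  obtain Q where Q: "\<And>j. j < p \<Longrightarrow> Q j \<in> rank_one_eigenprojs (weyl p j 1)"
    and FQ: "F = {ket_proj p k | k. k < p} \<union> (\<Union>j<p. rank_one_eigenprojs (weyl p j 1) - {Q j})"
    using F unfolding prime_family_def by blast
  obtain z where z: "\<And>j. weyl_eigenvalue p j 1 (z j)" using weyl_eigenvalue_exists[OF p0, of _ 1] by metis
  define R where "R j k = wproj p j 1 (z j * unity_root p ^ k)" for j k
  have R: "rank_one_eigenprojs (weyl p j 1) = R j ` {..<p}" for j
    using weyl_eigenvalue.rank_one_eigenprojs_weyl[OF z[of j]] by (simp add: R_def)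
  \<comment> \<open>The omission removes a matrix and not a label, so here the eigenprojections
    within one basis must be distinct.\<close>
  have inj: "k = k'" if "R j k = R j k'" "k < p" "k' < p" for j k k'
    using weyl_eigenvalue.wproj_unity_root_inj[OF z[of j] _ that(2,3)] that(1) by (simp add: R_def)
  have "\<exists>k0<p. Q j = R j k0" if "j < p" for j using Q[OF that] R by auto
  then obtain k0 where k0: "\<And>j. j < p \<Longrightarrow> k0 j < p" "\<And>j. j < p \<Longrightarrow> Q j = R j (k0 j)" by metis
  have RF: "R j k \<in> F" if "j < p" "k < p" "k \<noteq> k0 j" for j k
  proof -
    have "R j k \<noteq> Q j" using inj[of j k "k0 j"] k0[OF that(1)] that by auto
    then show ?thesis using that R[of j] by (auto simp: FQ)
  qed
  have wp: "weyl_projection p (R j k)" for j k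
    unfolding R_def using weyl_eigenvalue.other_eigenvalue[OF z[of j]] by (intro weyl_projection_wprojI) auto
  then have wF: "weyl_projection p P" if "P \<in> F" for P
    using that R by (auto simp: FQ weyl_projection_ket)
  have fin: "finite F" using R by (auto simp: FQ)
  have "card F \<le> card {ket_proj p k | k. k < p} + card (\<Union>j<p. rank_one_eigenprojs (weyl p j 1) - {Q j})"
    unfolding FQ by (rule card_Un_le)
  also have "\<dots> \<le> p + (\<Sum>j<p. card (rank_one_eigenprojs (weyl p j 1) - {Q j}))"
  proof (rule add_mono)
    have "{ket_proj p k | k. k < p} = ket_proj p ` {..<p}" by auto
    then show "card {ket_proj p k | k. k < p} \<le> p" using card_image_le[of "{..<p}" "ket_proj p"] by simp
  qed (simp add: card_UN_le)
  also have "\<dots> \<le> p + (\<Sum>j<p. p - 1)"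
  proof (intro add_left_mono sum_mono)
    fix j assume "j \<in> {..<p}"
    then have "card (R j ` {..<p} - {Q j}) = card (R j ` {..<p}) - 1" using Q[of j] R[of j] by simp
    moreover have "card (R j ` {..<p}) \<le> p" using card_image_le[of "{..<p}" "R j"] by simp
    ultimately show "card (rank_one_eigenprojs (weyl p j 1) - {Q j}) \<le> p - 1" using R[of j] by simp
  qed
  also have "\<dots> = p\<^sup>2" using p0 by (cases p) (auto simp: power2_eq_square)
  finally have card: "card F \<le> p\<^sup>2" .
  have "separating p F"
  proof (rule separating_if_vanishes[OF p0])
    fix X x y assume X: "\<And>P. P \<in> F \<Longrightarrow> pairing_form p X P = 0"
    have diag: "vanishes p X x y" if "[y = 0] (mod p)" for x y
      by (rule vanishes_diagonal[OF p0 _ that]) (use X in \<open>auto simp: FQ\<close>)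
    have line: "vanishes p X (l * j) (l * 1)" if "j < p" for l j
      using X RF[OF that] weyl_eigenvalue.line_vanishes_but_one[OF z[of j] diag[OF cong_refl], of "k0 j"]
      by (simp add: R_def)
    show "vanishes p X x y"
      using prime_line_cover[OF p, of y x]
    proof
      assume "\<exists>b<p. [y * b = x] (mod p)"
      then obtain b where b: "b < p" "[y * b = x] (mod p)" by auto
      then show ?thesis using line[OF b(1), of y] vanishes_cong[OF p0 b(2) cong_refl] by simp
    qed (rule diag)
  qed
  then show "good_system p F"
    using fin card wF weyl_projection_trace_one by (simp add: good_system_def)
  \<comment> \<open>A label that survives the omission in the eigenbasis of
    \<open>weyl p 0 1\<close>.\<close>
  define k1 where "k1 = (if k0 0 = 0 then 1 else 0 :: nat)"
  have "R 0 k1 \<in> F" using p2 by (intro RF) (auto simp: k1_def)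
  then have b: "0 \<in> overlaps F" "1 \<in> overlaps F" "1 / of_nat p \<in> overlaps F"
    using basic_overlaps[OF p2, of F 0 "z 0 * unity_root p ^ k1"] weyl_eigenvalue.other_eigenvalue[OF z[of 0]]
    by (auto simp: R_def FQ)
  show "overlaps F = {0} \<union> {1 / of_nat d' | d'. d' > 0 \<and> d' dvd p}"
  proof (rule overlaps_eqI[OF wF b(1)])
    fix d :: nat assume "d dvd p"
    then have "d = 1 \<or> d = p" using p by (simp add: prime_nat_iff)
    then show "1 / of_nat d \<in> overlaps F" using b by auto
  qed
qed

section \<open>Dimension \<open>p\<^sup>2\<close>\<close>

text \<open>Turns membership into a condition on the support, which is what the eigenvalue equation
  controls.\<close>

lemma residue_span_eq:
  assumes t: "t < p"
  shows "residue_span p t = {v \<in> carrier_vec (p\<^sup>2). \<forall>i<p\<^sup>2. i mod p \<noteq> t \<longrightarrow> v $ i = 0}" (is "_ = ?W")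
proof -
  define n where "n = p\<^sup>2"
  interpret vec_space "TYPE(complex)" n .
  define S where "S = {unit_vec n (v * p + t) :: complex vec | v. v < p}"
  have S: "S \<subseteq> carrier_vec n" by (auto simp: S_def)
  have SW: "S \<subseteq> ?W" using t by (auto simp: S_def n_def unit_vec_def)
  have "submodule class_ring ?W V"
    by unfold_locales (auto simp: module_vec_simps n_def)
  then have "span S \<subseteq> ?W" using span_is_subset[OF SW] by simp
  moreover have "v \<in> span S" if v: "v \<in> ?W" for v
  proof -
    \<comment> \<open>\<open>M k\<close> keeps the first \<open>k\<close> coordinates of
      \<open>v\<close>; each step adds a multiple of one spanning vector or nothing.\<close>
    define M where "M k = vec n (\<lambda>i. if i < k then v $ i else 0)" for k
    have "M k \<in> span S" if "k \<le> n" for k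
      using that
    proof (induction k)
      case 0
      have "M 0 = 0\<^sub>v n" by (intro eq_vecI) (auto simp: M_def)
      then show ?case using submodule.zero_closed[OF span_is_submodule[OF S]] by (simp add: module_vec_simps)
    next
      case (Suc k)
      have 1: "M k \<in> span S" using Suc by simp
      show ?case
      proof (cases "k mod p = t")
        case True
        have "k div p < p" using Suc.prems by (simp add: n_def power2_eq_square less_mult_imp_div_less)
        then have "unit_vec n k \<in> S" using True unfolding S_def
          by (intro CollectI exI[of _ "k div p"]) (simp add: True[symmetric])
        then have "unit_vec n k \<in> span S" using in_own_span[OF S] by blast
        then have "v $ k \<cdot>\<^sub>v unit_vec n k \<in> span S"
          using submodule.smult_closed[OF span_is_submodule[OF S], of "v $ k" "unit_vec n k"] by (simp add: module_vec_simps)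
        then have "M k + v $ k \<cdot>\<^sub>v unit_vec n k \<in> span S" using span_add1[OF S 1] by simp
        moreover have "M (Suc k) = M k + v $ k \<cdot>\<^sub>v unit_vec n k"
          by (intro eq_vecI) (auto simp: M_def less_Suc_eq unit_vec_def)
        ultimately show ?thesis by simp
      next
        case False
        then have "v $ k = 0" using v Suc.prems by (auto simp: n_def)
        then have "M (Suc k) = M k" by (intro eq_vecI) (auto simp: M_def less_Suc_eq)
        then show ?thesis using 1 by simp
      qed
    qed
    moreover have "M n = v" using v by (intro eq_vecI) (auto simp: M_def n_def)
    ultimately show ?thesis by (metis order_refl)
  qed
  ultimately show ?thesis unfolding residue_span_def S_def n_def by blast
qed

locale prime_square =
  fixes p n :: nat
  assumes p: "prime p" and n_eq: "n = p\<^sup>2"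
begin

lemma p_ge_2: "p \<ge> 2" and p_pos: "p > 0" and n_pos: "n > 0" and n_mult: "n = p * p" and n_ge_2: "n \<ge> 2"
proof -
  show "p \<ge> 2" "p > 0" using p by (auto simp: prime_ge_2_nat prime_gt_0_nat)
  then show "n > 0" "n = p * p" by (auto simp: n_eq power2_eq_square)
  have "2 * 1 \<le> p * p" using \<open>p \<ge> 2\<close> by (intro mult_le_mono) auto
  then show "n \<ge> 2" by (simp add: n_eq power2_eq_square)
qed

lemma odd_p: "p \<noteq> 2 \<Longrightarrow> odd p"
  using p primes_dvd_imp_eq two_is_prime_nat by blast

text \<open>\<open>U\<^sub>1\<^sub>,\<^sub>b\<^sub>p\<close> acts on the span of \<open>|vp + t\<rangle>\<close> with eigenvalues \<open>\<eta>\<^sup>k\<close>, \<open>k \<equiv> t + shift (mod p)\<close>.\<close>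

definition shift :: nat where "shift = (if p = 2 then 1 else 0)"

lemma base_eigenvalue: "weyl_eigenvalue n 1 (b * p) 1"
proof
  have "even (b * p * (n - 1))"
    using odd_p by (cases "p = 2") (auto simp: n_mult)
  then show "1 ^ n = wphase n 1 (b * p) n" by (simp add: wphase_full[OF n_pos])
qed (rule n_pos)

text \<open>For odd \<open>p\<close> the number \<open>p\<close> divides
  \<open>p * (p - 1) div 2\<close> and the phase is 1; for \<open>p = 2\<close> it is
  \<open>-1\<close>, the origin of \<open>shift\<close>.\<close>

lemma wphase_p:
  assumes "b \<in> {1..p-1}"
  shows "wphase n 1 (b * p) p = unity_root n ^ (p * shift)"
proof (cases "p = 2")
  case True
  then have b: "b = 1" using assms by auto
  have s: "shift = 1" unfolding shift_def using True by simp
  show ?thesis unfolding s wphase_def b using True by simp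
next
  case False
  then have "odd p" by (rule odd_p)
  then obtain q where q: "p = 2 * q + 1" by (rule oddE)
  then have "p * (p - 1) div 2 = p * q" by simp
  then have "1 * (b * p) * (p * (p - 1) div 2) = n * (b * q)" by (simp add: n_mult)
  then show ?thesis using False n_pos
    by (simp only: wphase_def) (simp add: shift_def unity_root_pow_eq_1_iff)
qed

text \<open>The \<open>p\<close>-th power of the operator is diagonal, with exponent
  \<open>p * (i + shift)\<close> of the root at position \<open>i\<close>. On an eigenvector it acts
  as the scalar with exponent \<open>k * p\<close>, so the exponents agree modulo
  \<open>p * p\<close> wherever \<open>v $ i\<close> is nonzero.\<close>

lemma eigenvector_support:
  assumes b: "b \<in> {1..p-1}" and v: "v \<in> carrier_vec n" "weyl n 1 (b * p) *\<^sub>v v = unity_root n ^ k \<cdot>\<^sub>v v"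
    and i: "i < n" "v $ i \<noteq> 0"
  shows "[i + shift = k] (mod p)"
proof -
  have "weyl n (p * 1) (p * (b * p)) = weyl n p 0"
    by (rule weyl_cong[OF n_pos]) (auto simp: cong_0_iff n_mult)
  then have "wpow n 1 (b * p) p = unity_root n ^ (p * shift) \<cdot>\<^sub>m weyl n p 0"
    unfolding wpow_def wphase_p[OF b] by simp
  moreover have "wpow n 1 (b * p) p *\<^sub>v v = (unity_root n ^ k) ^ p \<cdot>\<^sub>v v"
    by (rule wpow_mult_vec[OF n_pos v])
  ultimately have "((unity_root n ^ (p * shift) \<cdot>\<^sub>m weyl n p 0) *\<^sub>v v) $ i = ((unity_root n ^ k) ^ p \<cdot>\<^sub>v v) $ i"
    by simp
  moreover have "((unity_root n ^ (p * shift) \<cdot>\<^sub>m weyl n p 0) *\<^sub>v v) $ i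
      = (\<Sum>j<n. unity_root n ^ (p * shift) * weyl n p 0 $$ (i, j) * v $ j)"
    using i v by (simp add: scalar_prod_def atLeast0LessThan)
  moreover have "\<dots> = (\<Sum>j<n. if j = i then unity_root n ^ (p * shift) * unity_root n ^ (p * i) * v $ i else 0)"
    using i by (intro sum.cong refl) (auto simp: weyl_index)
  ultimately have "unity_root n ^ (p * shift) * unity_root n ^ (p * i) * v $ i = unity_root n ^ (k * p) * v $ i"
    using i v by (simp add: power_mult)
  then have "unity_root n ^ (p * (i + shift)) = unity_root n ^ (p * k)"
    using i by (simp add: power_add[symmetric] algebra_simps)
  then have "[p * (i + shift) = p * k] (mod p * p)"
    using unity_root_pow_eq_iff[OF n_pos] n_mult by simp
  then show ?thesis using p_pos by (simp add: cong_def)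
qed

lemma eigenspace_subset_residue_span:
  assumes b: "b \<in> {1..p-1}" and t: "t < p" and k: "[k = t + shift] (mod p)"
  shows "eigenspace (weyl n 1 (b * p)) (unity_root n ^ k) \<subseteq> residue_span p t"
proof
  fix v assume "v \<in> eigenspace (weyl n 1 (b * p)) (unity_root n ^ k)"
  then have v: "v \<in> carrier_vec n" "weyl n 1 (b * p) *\<^sub>v v = unity_root n ^ k \<cdot>\<^sub>v v"
    by (auto simp: eigenspace_def)
  have "i mod p = t" if "i < n" "v $ i \<noteq> 0" for i
  proof -
    have "[i + shift = t + shift] (mod p)" using eigenvector_support[OF b v that] k by (rule cong_trans)
    then have "[i = t] (mod p)" by (simp only: cong_add_rcancel_nat)
    then show ?thesis using t by (simp add: cong_def)
  qed
  then show "v \<in> residue_span p t" using v(1) unfolding residue_span_eq[OF t] n_eq by blast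
qed

lemma projection_onto_residue:
  assumes b: "b \<in> {1..p-1}" and t: "t < p" and k: "[k = t + shift] (mod p)"
  shows "projection_onto n (residue_span p t \<inter> eigenspace (weyl n 1 (b * p)) (unity_root n ^ k))
    = wproj n 1 (b * p) (1 * unity_root n ^ k)"
proof -
  interpret B: weyl_eigenvalue n 1 "b * p" "1 * unity_root n ^ k"
    by (rule weyl_eigenvalue.other_eigenvalue[OF base_eigenvalue])
  have "residue_span p t \<inter> eigenspace (weyl n 1 (b * p)) (unity_root n ^ k)
      = eigenspace (weyl n 1 (b * p)) (unity_root n ^ k)"
    using eigenspace_subset_residue_span[OF assms] by blast
  then show ?thesis using B.eigenproj_weyl by (simp add: eigenproj_def)
qed

lemma residue_eigenvalues:
  assumes b: "b \<in> {1..p-1}" and t: "t < p"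
  shows "{z. \<exists>v\<in>residue_span p t. eigenvector (weyl n 1 (b * p)) v z}
    = {unity_root n ^ k | k. k < n \<and> [k = t + shift] (mod p)}"
proof (intro equalityI subsetI)
  fix z assume "z \<in> {z. \<exists>v\<in>residue_span p t. eigenvector (weyl n 1 (b * p)) v z}"
  then obtain v where v: "v \<in> residue_span p t" "v \<in> carrier_vec n" "v \<noteq> 0\<^sub>v n"
    "weyl n 1 (b * p) *\<^sub>v v = z \<cdot>\<^sub>v v" by (auto simp: eigenvector_def)
  have "weyl_eigenvalue n 1 (b * p) z" by (rule eigenvector_imp_weyl_eigenvalue[OF n_pos v(2-4)])
  then obtain k where k: "k < n" "z = unity_root n ^ k"
    using weyl_eigenvalue.weyl_eigenvalue_other[OF base_eigenvalue] by fastforce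
  obtain i where i: "i < n" "v $ i \<noteq> 0"
    using v(2,3) by (metis carrier_vecD eq_vecI index_zero_vec(1,2))
  have "i mod p = t" using v(1) i unfolding residue_span_eq[OF t] n_eq by blast
  then have "[i = t] (mod p)" using t by (simp add: cong_def)
  then have "[i + shift = t + shift] (mod p)" by (simp only: cong_add_rcancel_nat)
  moreover have "[i + shift = k] (mod p)"
    using eigenvector_support[OF b v(2) _ i] v(4) k by simp
  ultimately have "[k = t + shift] (mod p)" using cong_trans cong_sym by blast
  then show "z \<in> {unity_root n ^ k | k. k < n \<and> [k = t + shift] (mod p)}" using k by blast
next
  fix z assume "z \<in> {unity_root n ^ k | k. k < n \<and> [k = t + shift] (mod p)}"
  then obtain k where k: "z = unity_root n ^ k" "[k = t + shift] (mod p)" by blast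
  obtain v where v: "v \<in> carrier_vec n" "v \<noteq> 0\<^sub>v n" "weyl n 1 (b * p) *\<^sub>v v = z \<cdot>\<^sub>v v"
    using weyl_eigenvalue.eigenvector_exists[OF
        weyl_eigenvalue.other_eigenvalue[OF base_eigenvalue[of b], of k] generating_left(1)] k(1) by auto
  then have "v \<in> residue_span p t"
    using eigenspace_subset_residue_span[OF b t k(2)] k(1) by (auto simp: eigenspace_def)
  then show "z \<in> {z. \<exists>v\<in>residue_span p t. eigenvector (weyl n 1 (b * p)) v z}"
    using v by (auto simp: eigenvector_def)
qed

lemma unity_root_split:
  "cis (2 * pi * real t / (real p)\<^sup>2) * cis (2 * pi * real s / real p) = unity_root n ^ (t + p * s)"
proof -
  have "real (t + p * s) * (2 * pi / real n) = 2 * pi * real t / (real p)\<^sup>2 + 2 * pi * real s / real p"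
    using p_pos by (simp add: n_eq field_simps power2_eq_square)
  then show ?thesis by (simp only: DeMoivre cis_mult)
qed

text \<open>In each class only the label \<open>s = 0\<close> is absent. Its exponent
  \<open>k0\<close> is \<open>t\<close> for odd \<open>p\<close>; for \<open>p = 2\<close> it is
  whatever \<open>\<mu> b t 0\<close> stands for, so either order of labels works.\<close>

lemma labelling:
  assumes \<mu>: "eigen_labelling p \<mu>" and b: "b \<in> {1..p-1}" and t: "t < p"
  shows "s \<in> {1..p-1} \<Longrightarrow> \<exists>k<n. [k = t + shift] (mod p) \<and> \<mu> b t s = unity_root n ^ k"
    and "\<exists>k0. \<forall>k<n. [k = t + shift] (mod p) \<longrightarrow> k \<noteq> k0 \<longrightarrow> (\<exists>s\<in>{1..p-1}. \<mu> b t s = unity_root n ^ k)"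
proof -
  have t': "t \<in> {0..p-1}" using t by auto
  have "(s \<in> {1..p-1} \<longrightarrow> (\<exists>k<n. [k = t + shift] (mod p) \<and> \<mu> b t s = unity_root n ^ k)) \<and>
    (\<exists>k0. \<forall>k<n. [k = t + shift] (mod p) \<longrightarrow> k \<noteq> k0 \<longrightarrow> (\<exists>s\<in>{1..p-1}. \<mu> b t s = unity_root n ^ k))"
  proof (cases "p = 2")
    case True
    then have "bij_betw (\<mu> b t) {0, 1} {z. \<exists>v\<in>residue_span p t. eigenvector (weyl n 1 (b * p)) v z}"
      using \<mu> b t' unfolding eigen_labelling_def n_eq by meson
    then have img: "\<mu> b t ` {0, 1} = {unity_root n ^ k | k. k < n \<and> [k = t + shift] (mod p)}"
      unfolding residue_eigenvalues[OF b t] by (simp add: bij_betw_def)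
    then obtain k0 where k0: "\<mu> b t 0 = unity_root n ^ k0" "k0 < n" by blast
    have 1: "\<exists>k<n. [k = t + shift] (mod p) \<and> \<mu> b t 1 = unity_root n ^ k" using img by blast
    have "\<mu> b t 1 = unity_root n ^ k" if k: "k < n" "[k = t + shift] (mod p)" "k \<noteq> k0" for k
    proof -
      have "unity_root n ^ k \<in> \<mu> b t ` {0, 1}" using img k by blast
      moreover have "unity_root n ^ k \<noteq> \<mu> b t 0"
        using k k0 unity_root_pow_eq_iff[OF n_pos, of k k0] by (auto simp: cong_def)
      ultimately show ?thesis by auto
    qed
    then show ?thesis using 1 True by auto
  next
    case False
    then have lab: "\<mu> b t s = unity_root n ^ (t + p * s)" if "s \<in> {0..p-1}" for s
      using \<mu> b t' that unfolding eigen_labelling_def unity_root_split[symmetric] by meson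
    have "\<exists>k<n. [k = t + shift] (mod p) \<and> \<mu> b t s = unity_root n ^ k" if s: "s \<in> {1..p-1}" for s
    proof (intro exI conjI)
      have "t + p * s < p * Suc s" using t by simp
      also have "\<dots> \<le> p * p" using s p_pos by (intro mult_le_mono2) auto
      finally show "t + p * s < n" by (simp add: n_mult)
    qed (use lab s False in \<open>auto simp: shift_def cong_def\<close>)
    moreover have "\<exists>s\<in>{1..p-1}. \<mu> b t s = unity_root n ^ k" if k: "k < n" "[k = t + shift] (mod p)" "k \<noteq> t" for k
    proof -
      have kt: "k mod p = t" using k(2) t False by (simp add: shift_def cong_def)
      then have "k = t + p * (k div p)" by (metis mod_mult_div_eq)
      moreover from this k(3) have "k div p \<noteq> 0" by (metis add.right_neutral mult_0_right)
      moreover have "k div p < p" using k(1) by (simp add: n_mult less_mult_imp_div_less)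
      ultimately show ?thesis using lab[of "k div p"] by (intro bexI[of _ "k div p"]) auto
    qed
    ultimately show ?thesis by blast
  qed
  then show "s \<in> {1..p-1} \<Longrightarrow> \<exists>k<n. [k = t + shift] (mod p) \<and> \<mu> b t s = unity_root n ^ k"
    and "\<exists>k0. \<forall>k<n. [k = t + shift] (mod p) \<longrightarrow> k \<noteq> k0 \<longrightarrow> (\<exists>s\<in>{1..p-1}. \<mu> b t s = unity_root n ^ k)"
    by blast+
qed

definition phase :: "nat \<Rightarrow> complex" where
  "phase m = cis (pi * real m * (real p - 1) / (real p)\<^sup>2)"

text \<open>Rests on \<open>p - 1\<close> and \<open>p * p - 1\<close> having the same parity, so
  that the \<open>n\<close>-th power of \<open>phase m\<close> has the sign prescribed by
  \<open>wphase_full\<close>.\<close>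

lemma phase_eigenvalue: "weyl_eigenvalue n m 1 (phase m)"
proof
  have "real n * (pi * real m * (real p - 1) / (real p)\<^sup>2) = real (m * (p - 1)) * pi"
    using p_pos by (simp add: n_eq of_nat_diff)
  then have "phase m ^ n = cis (real (m * (p - 1)) * pi)"
    by (simp only: phase_def DeMoivre)
  also have "\<dots> = (- 1) ^ (m * (p - 1))" using DeMoivre[of pi "m * (p - 1)"] by simp
  also have "\<dots> = (- 1) ^ (m * 1 * (n - 1))"
  proof -
    have "even (p - 1) \<longleftrightarrow> even (n - 1)" using p_pos n_pos by (simp add: n_mult even_diff_nat)
    then show ?thesis by (simp add: minus_one_power_iff)
  qed
  finally show "phase m ^ n = wphase n m 1 n" by (simp add: wphase_full[OF n_pos])
qed (rule n_pos)

lemma proj_rcs_eq: "proj_rcs p r a c s = wproj n (a * p + r) 1 (phase (a * p + r) * unity_root n ^ (c + p * s))"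
proof -
  have "proj_rcs p r a c s = eigenproj (weyl n (a * p + r) 1) (phase (a * p + r) * unity_root n ^ (c + p * s))"
    unfolding proj_rcs_def phase_def n_eq unity_root_split[unfolded n_eq, symmetric] by (simp only: mult.assoc)
  then show ?thesis
    using weyl_eigenvalue.eigenproj_weyl[OF weyl_eigenvalue.other_eigenvalue[OF phase_eigenvalue]] by simp
qed

text \<open>The lines \<open>(r, 1)\<close> with \<open>r < p\<close> lack only the label 0. A line
  \<open>(a * p + r, 1)\<close> with \<open>a \<ge> 1\<close> shares its multiples of
  \<open>p\<close> with \<open>(r, 1)\<close>, and \<open>(1, b * p)\<close> shares them with the
  diagonal line; both lack \<open>p\<close> labels, one in each class modulo
  \<open>p\<close>.\<close>

lemma family_properties:
  assumes "prime_square_family p F"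
  shows "good_system n F"
    and "overlaps F = {0} \<union> {1 / of_nat d' | d'. d' > 0 \<and> d' dvd n}"
proof -
  obtain \<mu> where \<mu>: "eigen_labelling p \<mu>" and F0:
     "F = {ket_proj (p\<^sup>2) j | j. j \<le> p\<^sup>2 - 1}
       \<union> {projection_onto (p\<^sup>2) (residue_span p t \<inter> eigenspace (weyl (p\<^sup>2) 1 (b * p)) (\<mu> b t s)) | b t s.
            b \<in> {1..p-1} \<and> t \<in> {0..p-1} \<and> s \<in> {1..p-1}}
       \<union> {proj_rcs p r 0 c s | r c s.
            r \<in> {0..p-1} \<and> c \<in> {0..p-1} \<and> s \<in> {0..p-1} \<and> (c, s) \<noteq> (0, 0)}
       \<union> {proj_rcs p r a c s | r a c s.
            r \<in> {0..p-1} \<and> c \<in> {0..p-1} \<and> a \<in> {1..p-1} \<and> s \<in> {1..p-1}}"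
    using assms unfolding prime_square_family_def by blast
  define T where "T b t s = projection_onto n (residue_span p t \<inter> eigenspace (weyl n 1 (b * p)) (\<mu> b t s))" for b t s
  define F1 where "F1 = {ket_proj n j | j. j \<le> n - 1}"
  define F2 where "F2 = {T b t s | b t s. b \<in> {1..p-1} \<and> t \<in> {0..p-1} \<and> s \<in> {1..p-1}}"
  define F3 where "F3 = {proj_rcs p r 0 c s | r c s.
            r \<in> {0..p-1} \<and> c \<in> {0..p-1} \<and> s \<in> {0..p-1} \<and> (c, s) \<noteq> (0, 0)}"
  define F4 where "F4 = {proj_rcs p r a c s | r a c s.
            r \<in> {0..p-1} \<and> c \<in> {0..p-1} \<and> a \<in> {1..p-1} \<and> s \<in> {1..p-1}}"
  have F: "F = F1 \<union> F2 \<union> F3 \<union> F4"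
    unfolding F0 F1_def F2_def F3_def F4_def T_def n_eq ..
  have T1: "\<exists>k<n. T b t s = wproj n 1 (b * p) (1 * unity_root n ^ k)"
    if b: "b \<in> {1..p-1}" and t': "t \<in> {0..p-1}" and s: "s \<in> {1..p-1}" for b t s
  proof -
    have t: "t < p" using t' p_pos by auto
    obtain k where "k < n" "[k = t + shift] (mod p)" "\<mu> b t s = unity_root n ^ k"
      using labelling(1)[OF \<mu> b t s] by blast
    then show ?thesis unfolding T_def using projection_onto_residue[OF b t] by auto
  qed
  have wF: "weyl_projection n P" if PF: "P \<in> F" for P
  proof -
    have 2: "weyl_projection n (wproj n 1 (b * p) (1 * unity_root n ^ k))" for b k
      by (intro weyl_projection_wprojI weyl_eigenvalue.other_eigenvalue base_eigenvalue generating_left)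
    have 34: "weyl_projection n (proj_rcs p r a c s)" for r a c s
      unfolding proj_rcs_eq
      by (intro weyl_projection_wprojI weyl_eigenvalue.other_eigenvalue phase_eigenvalue generating_right)
    have 1: "weyl_projection n (ket_proj n j)" if "j \<le> n - 1" for j
      using that n_pos by (intro weyl_projection_ket) auto
    consider "P \<in> F1" | "P \<in> F2" | "P \<in> F3 \<union> F4" using PF unfolding F by blast
    then show ?thesis
    proof cases
      case 1
      then show ?thesis using \<open>\<And>j. j \<le> n - 1 \<Longrightarrow> weyl_projection n (ket_proj n j)\<close> unfolding F1_def by blast
    next
      case 2
      then obtain b t s where "P = T b t s" "b \<in> {1..p-1}" "t \<in> {0..p-1}" "s \<in> {1..p-1}"
        unfolding F2_def by blast
      then show ?thesis
        using T1[of b t s] \<open>\<And>b k. weyl_projection n (wproj n 1 (b * p) (1 * unity_root n ^ k))\<close> by metis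
    next
      case 3
      then show ?thesis using 34 unfolding F3_def F4_def by blast
    qed
  qed
  have i1: "F1 = ket_proj n ` {..<n}" using n_pos by (auto simp: F1_def)
  have i2: "F2 \<subseteq> (\<lambda>(b, t, s). T b t s) ` ({1..p-1} \<times> {0..p-1} \<times> {1..p-1})"
  proof
    fix P assume "P \<in> F2"
    then obtain b t s where "P = T b t s" "(b, t, s) \<in> {1..p-1} \<times> {0..p-1} \<times> {1..p-1}"
      unfolding F2_def by blast
    then show "P \<in> (\<lambda>(b, t, s). T b t s) ` ({1..p-1} \<times> {0..p-1} \<times> {1..p-1})" by (intro image_eqI[of _ _ "(b, t, s)"]) simp_all
  qed
  have i3: "F3 \<subseteq> (\<lambda>(r, c, s). proj_rcs p r 0 c s) ` ({0..p-1} \<times> ({0..p-1} \<times> {0..p-1} - {(0, 0)}))"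
  proof
    fix P assume "P \<in> F3"
    then obtain r c s where "P = proj_rcs p r 0 c s" "(r, c, s) \<in> {0..p-1} \<times> ({0..p-1} \<times> {0..p-1} - {(0, 0)})"
      unfolding F3_def by blast
    then show "P \<in> (\<lambda>(r, c, s). proj_rcs p r 0 c s) ` ({0..p-1} \<times> ({0..p-1} \<times> {0..p-1} - {(0, 0)}))" by (intro image_eqI[of _ _ "(r, c, s)"]) simp_all
  qed
  have i4: "F4 \<subseteq> (\<lambda>(r, a, c, s). proj_rcs p r a c s) ` ({0..p-1} \<times> {1..p-1} \<times> {0..p-1} \<times> {1..p-1})"
  proof
    fix P assume "P \<in> F4"
    then obtain r a c s where "P = proj_rcs p r a c s" "(r, a, c, s) \<in> {0..p-1} \<times> {1..p-1} \<times> {0..p-1} \<times> {1..p-1}"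
      unfolding F4_def by blast
    then show "P \<in> (\<lambda>(r, a, c, s). proj_rcs p r a c s) ` ({0..p-1} \<times> {1..p-1} \<times> {0..p-1} \<times> {1..p-1})" by (intro image_eqI[of _ _ "(r, a, c, s)"]) simp_all
  qed
  have fin: "finite F"
    unfolding F i1 using finite_subset[OF i2] finite_subset[OF i3] finite_subset[OF i4] by blast
  have "card F \<le> card F1 + card F2 + card F3 + card F4"
    unfolding F using card_Un_le[of "F1 \<union> F2 \<union> F3" F4] card_Un_le[of "F1 \<union> F2" F3] card_Un_le[of F1 F2] by linarith
  also have "\<dots> \<le> n + (p - 1) * (p * (p - 1)) + p * (p * p - 1) + p * ((p - 1) * (p * (p - 1)))"
  proof (intro add_mono)
    show "card F1 \<le> n" unfolding i1 using card_image_le[of "{..<n}"] by fastforce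
    show "card F2 \<le> (p - 1) * (p * (p - 1))"
      using p_pos by (rule_tac order_trans[OF surj_card_le[OF _ i2]]) (auto simp: card_cartesian_product)
    show "card F3 \<le> p * (p * p - 1)"
      using p_pos by (rule_tac order_trans[OF surj_card_le[OF _ i3]]) (auto simp: card_cartesian_product)
    show "card F4 \<le> p * ((p - 1) * (p * (p - 1)))"
      using p_pos by (rule_tac order_trans[OF surj_card_le[OF _ i4]]) (auto simp: card_cartesian_product)
  qed
  also have "\<dots> = n\<^sup>2"
  proof -
    \<comment> \<open>Eliminates truncated subtraction before expanding.\<close>
    obtain q where q: "p = Suc q" using p_pos by (cases p) auto
    have "Suc q * Suc q - 1 = q * q + 2 * q" by simp
    then show ?thesis unfolding n_mult q by (simp add: power2_eq_square algebra_simps)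
  qed
  finally have card: "card F \<le> n\<^sup>2" .
  have "separating n F"
  proof (rule separating_if_vanishes[OF n_pos])
    fix X x y assume X: "\<And>P. P \<in> F \<Longrightarrow> pairing_form n X P = 0"
    have diag: "vanishes n X x y" if "[y = 0] (mod n)" for x y
      by (rule vanishes_diagonal[OF n_pos _ that]) (use X in \<open>auto simp: F i1\<close>)
    have k_split: "k mod p \<in> {0..p-1}" "k div p \<in> {0..p-1}" "k = k mod p + p * (k div p)" if "k < n" for k
    proof -
      have "k mod p \<le> p - 1"
        using mod_less_divisor[OF p_pos, of k] by linarith
      moreover have "k div p < p"
        using that by (simp add: n_mult less_mult_imp_div_less)
      ultimately show "k mod p \<in> {0..p-1}" "k div p \<in> {0..p-1}" by auto
    qed simp
    \<comment> \<open>The label is \<open>k = c + p * s\<close>, so the omitted pair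
      \<open>(0, 0)\<close> is \<open>k = 0\<close>.\<close>
    have line0: "vanishes n X (l * r) (l * 1)" if r: "r < p" for l r
    proof (rule weyl_eigenvalue.line_vanishes_but_one[where ?k0.0 = 0, OF phase_eigenvalue diag[OF cong_refl]])
      fix k assume k: "k < n" "k \<noteq> 0"
      have "(k mod p, k div p) \<noteq> (0, 0)" using k_split(3)[OF k(1)] k(2) by (metis Pair_inject add_0 mult_0_right)
      then have "proj_rcs p r 0 (k mod p) (k div p) \<in> F"
        using k_split(1,2)[OF k(1)] r unfolding F F3_def by fastforce
      from X[OF this] show "pairing_form n X (wproj n r 1 (phase r * unity_root n ^ k)) = 0"
        unfolding proj_rcs_eq k_split(3)[OF k(1), symmetric] by simp
    qed
    have line: "vanishes n X (l * (a * p + r)) (l * 1)" if r: "r < p" and a: "a \<in> {1..p-1}" for l a r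
    proof (rule weyl_eigenvalue.line_vanishes[OF phase_eigenvalue])
      let ?m = "a * p + r"
      \<comment> \<open>\<open>k \<ge> p\<close> means \<open>s \<ge> 1\<close>, exactly the labels
        kept for \<open>a \<ge> 1\<close>; the missing \<open>k < p\<close> lie in distinct classes
        modulo \<open>p\<close>.\<close>
      have zero: "pairing_form n X (wproj n ?m 1 (phase ?m * unity_root n ^ k)) = 0" if k: "k < n" "k \<ge> p" for k
      proof -
        have "k div p \<noteq> 0" using k(2) p_pos by (simp add: div_eq_0_iff)
        then have "k div p \<in> {1..p-1}" using k_split(2)[OF k(1)] by auto
        then have "proj_rcs p r a (k mod p) (k div p) \<in> F"
          using k_split(1)[OF k(1)] r a unfolding F F4_def by fastforce
        from X[OF this] show ?thesis
          unfolding proj_rcs_eq k_split(3)[OF k(1), symmetric] .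
      qed
      fix k assume k: "k < n"
      show "pairing_form n X (wproj n ?m 1 (phase ?m * unity_root n ^ k)) = 0"
      proof (cases "k \<ge> p")
        case False
        show ?thesis
        proof (rule weyl_eigenvalue.class_vanishes[OF phase_eigenvalue n_mult _ k])
          fix l
          have "p * l * ?m = n * (l * a) + p * l * r" by (simp add: n_mult algebra_simps)
          then have "[p * l * ?m = p * l * r] (mod n)" by (simp add: cong_def)
          then show "vanishes n X (p * l * ?m) (p * l * 1)"
            using line0[OF r, of "p * l"] vanishes_cong[OF n_pos _ cong_refl] by blast
        next
          fix k' assume k': "k' < n" "k' \<noteq> k" "k' mod p = k mod p"
          then have "k' \<ge> p" using False by (metis linorder_not_le mod_less)
          with k'(1) show "pairing_form n X (wproj n ?m 1 (phase ?m * unity_root n ^ k')) = 0" by (rule zero)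
        qed
      qed (use zero k in blast)
    qed
    have line1: "vanishes n X (l * 1) (l * (b * p))" if b: "b \<in> {1..p-1}" for l b
    proof (rule weyl_eigenvalue.line_vanishes[OF base_eigenvalue])
      fix k assume k: "k < n"
      obtain t where t: "t < p" "[k = t + shift] (mod p)"
      proof
        \<comment> \<open>The residue sought is \<open>k - shift\<close>;
          \<open>shift * (p - 1)\<close> represents \<open>- shift\<close> modulo
          \<open>p\<close>.\<close>
        have "[k + shift * p = k] (mod p)" by (simp add: cong_def)
        moreover have "k + shift * p = (k + shift * (p - 1)) + shift" using p_pos by (cases p) auto
        moreover have "[(k + shift * (p - 1)) + shift = (k + shift * (p - 1)) mod p + shift] (mod p)"
          by (simp add: cong_def mod_add_left_eq)
        ultimately show "[k = (k + shift * (p - 1)) mod p + shift] (mod p)"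
          using cong_trans cong_sym by metis
      qed (use p_pos in simp)
      have t': "t \<in> {0..p-1}" using t(1) by auto
      obtain k0 where k0: "\<And>k'. k' < n \<Longrightarrow> [k' = t + shift] (mod p) \<Longrightarrow> k' \<noteq> k0 \<Longrightarrow>
          (\<exists>s\<in>{1..p-1}. \<mu> b t s = unity_root n ^ k')"
        using labelling(2)[OF \<mu> b t(1)] by blast
      have zero: "pairing_form n X (wproj n 1 (b * p) (1 * unity_root n ^ k')) = 0"
        if k': "k' < n" "[k' = t + shift] (mod p)" "k' \<noteq> k0" for k'
      proof -
        obtain s where s: "s \<in> {1..p-1}" "\<mu> b t s = unity_root n ^ k'" using k0[OF k'] by blast
        have "T b t s \<in> F" using b t' s(1) unfolding F F2_def by blast
        moreover have "T b t s = wproj n 1 (b * p) (1 * unity_root n ^ k')"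
          unfolding T_def s(2) by (rule projection_onto_residue[OF b t(1) k'(2)])
        ultimately show ?thesis using X by metis
      qed
      show "pairing_form n X (wproj n 1 (b * p) (1 * unity_root n ^ k)) = 0"
      proof (cases "k = k0")
        case True
        show ?thesis
        proof (rule weyl_eigenvalue.class_vanishes[OF base_eigenvalue n_mult _ k])
          fix l
          show "vanishes n X (p * l * 1) (p * l * (b * p))"
            by (rule diag) (simp add: cong_0_iff n_mult)
        next
          fix k' assume k': "k' < n" "k' \<noteq> k" "k' mod p = k mod p"
          then have "[k' = t + shift] (mod p)" using t(2) by (simp add: cong_def)
          then show "pairing_form n X (wproj n 1 (b * p) (1 * unity_root n ^ k')) = 0"
            using zero k' True by blast
        qed
      qed (use zero k t in blast)
    qed
    \<comment> \<open>Distinguished by the power of \<open>p\<close> in \<open>y\<close>: for a unit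
      \<open>y\<close> the line has slope \<open>x / y\<close>. For \<open>y = p * y'\<close> with a
      unit \<open>y'\<close> it is \<open>(M, 1)\<close> with \<open>M = x' / y'\<close> modulo
      \<open>p\<close> if \<open>x = p * x'\<close>, and \<open>(1, b * p)\<close> with
      \<open>b = y' / x\<close> modulo \<open>p\<close> if \<open>x\<close> is a unit.\<close>
    show "vanishes n X x y"
    proof (cases "p dvd y")
      case False
      then have "coprime y n" using coprime_prime_iff[OF p] by (simp add: n_mult)
      then obtain M where M: "M < n" "[y * M = x] (mod n)" using ex_cong_mult_nat n_pos by blast
      have "vanishes n X (y * (M div p * p + M mod p)) (y * 1)"
      proof (cases "M div p = 0")
        case True
        then show ?thesis using line0[of "M mod p" y] p_pos by simp
      next
        case False
        then have "M div p \<in> {1..p-1}" using k_split(2)[OF M(1)] by auto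
        then show ?thesis using line[of "M mod p" "M div p" y] p_pos by simp
      qed
      then show ?thesis using vanishes_cong[OF n_pos M(2) cong_refl, of X y] by simp
    next
      case True
      then obtain y' where y: "y = p * y'" ..
      show ?thesis
      proof (cases "p dvd y'")
        case True
        then show ?thesis by (intro diag) (auto simp: y n_mult cong_0_iff)
      next
        case y': False
        show ?thesis
        proof (cases "p dvd x")
          case True
          then obtain x' where x: "x = p * x'" ..
          obtain M where M: "M < p" "[y' * M = x'] (mod p)"
            using ex_cong_mult_nat[of y' p x'] coprime_prime_iff[OF p] y' p_pos by blast
          have "[p * (y' * M) = p * x'] (mod p * p)" using cong_cmult_leftI[OF M(2)] .
          then have "[y * M = x] (mod n)" by (simp add: x y n_mult mult.assoc)
          then show ?thesis using line0[OF M(1), of y] vanishes_cong[OF n_pos _ cong_refl, of "y * M" x X y] by simp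
        next
          case False
          obtain b where b: "b < p" "[x * b = y'] (mod p)"
            using ex_cong_mult_nat[of x p y'] coprime_prime_iff[OF p] False p_pos by blast
          have "b \<noteq> 0"
          proof
            assume "b = 0"
            then have "[y' = 0] (mod p)" using cong_sym[OF b(2)] by simp
            then show False using y' by (simp add: cong_0_iff)
          qed
          then have b1: "b \<in> {1..p-1}" using b(1) by auto
          have e: "p * (x * b) = x * (b * p)" by simp
          have "[x * (b * p) = y] (mod n)" using cong_cmult_leftI[OF b(2), of p] unfolding y n_mult e .
          from vanishes_cong[OF n_pos cong_refl this, of X x] line1[OF b1, of x]
          show ?thesis unfolding mult_1_right by blast
        qed
      qed
    qed
  qed
  then show "good_system n F"
    using fin card wF weyl_projection_trace_one by (simp add: good_system_def)
  have ketF: "ket_proj n k \<in> F" if "k < n" for k using that by (auto simp: F i1)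
  have "proj_rcs p 0 0 0 1 \<in> F3" unfolding F3_def
    using p_ge_2 by (rule_tac CollectI, rule_tac exI[of _ 0], rule_tac exI[of _ 0], rule_tac exI[of _ 1]) auto
  then have "proj_rcs p 0 0 0 1 \<in> F" by (simp add: F)
  then have base: "0 \<in> overlaps F" "1 \<in> overlaps F" "1 / of_nat n \<in> overlaps F"
    using basic_overlaps[OF n_ge_2 ketF weyl_eigenvalue.other_eigenvalue[OF phase_eigenvalue]] unfolding proj_rcs_eq by blast+
  \<comment> \<open>Taken from an eigenprojection of \<open>weyl n 1 p\<close> and a ket at which
    its diagonal entry is nonzero, so that the alternative 0 is ruled out.\<close>
  have "1 / of_nat p \<in> overlaps F"
  proof -
    have "1 \<in> {1..p-1}" using p_ge_2 by auto
    then obtain k where k: "k < n" "T 1 0 1 = wproj n 1 (1 * p) (1 * unity_root n ^ k)" using T1[of 1 0 1] by auto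
    interpret B: weyl_eigenvalue n 1 "1 * p" "1 * unity_root n ^ k"
      by (rule weyl_eigenvalue.other_eigenvalue[OF base_eigenvalue])
    have "T 1 0 1 \<in> F2" unfolding F2_def
      using p_ge_2 by (rule_tac CollectI, rule_tac exI[of _ 1], rule_tac exI[of _ 0], rule_tac exI[of _ 1]) auto
    then have PF: "B.P \<in> F" unfolding k(2)[symmetric] F by blast
    obtain j where j: "j < n" "B.P $$ (j, j) \<noteq> 0"
      using trace_one_projection_entries[OF B.trace_one_wproj[OF generating_left(1)]] by blast
    have K: "ket_proj n j \<in> carrier_mat n n" "mat_trace (ket_proj n j) = 1"
      using j by (simp_all add: ket_proj_def mat_trace_def)
    have tr0: "mat_trace (wpow n 1 (1 * p) l * ket_proj n j) = 0" if "\<not> p dvd l" for l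
    proof -
      have "j \<noteq> (l * p + j) mod n"
      proof
        assume "j = (l * p + j) mod n"
        then have "[0 + j = l * p + j] (mod n)" using j by (simp add: cong_def)
        then have "[0 = l * p] (mod n)" by (simp only: cong_add_rcancel_nat)
        then have "n dvd l * p" by (metis cong_0_iff cong_sym)
        then show False using that p_pos by (simp add: n_mult)
      qed
      then show ?thesis using j by (simp add: mat_trace_mult_ket wpow_def weyl_index)
    qed
    \<comment> \<open>The \<open>p\<close>-th power is diagonal, as \<open>p * p\<close> is 0 modulo
      \<open>n\<close>; so it maps the ket to a multiple of itself.\<close>
    have w: "wpow n 1 (1 * p) p * ket_proj n j = wpow n 1 (1 * p) p $$ (j, j) \<cdot>\<^sub>m ket_proj n j"
    proof (rule eq_matI)
      fix i i' assume "i < dim_row (wpow n 1 (1 * p) p $$ (j, j) \<cdot>\<^sub>m ket_proj n j)"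
        "i' < dim_col (wpow n 1 (1 * p) p $$ (j, j) \<cdot>\<^sub>m ket_proj n j)"
      then have ii: "i < n" "i' < n" by (auto simp: ket_proj_def)
      have "(wpow n 1 (1 * p) p * ket_proj n j) $$ (i, i')
          = (\<Sum>u<n. wpow n 1 (1 * p) p $$ (i, u) * ket_proj n j $$ (u, i'))"
        using ii K by (intro mult_mat_index) auto
      also have "\<dots> = (\<Sum>u<n. if u = j then (if i' = j then wpow n 1 (1 * p) p $$ (i, j) else 0) else 0)"
        using ii by (intro sum.cong refl) (auto simp: ket_proj_def)
      also have "\<dots> = (if i' = j then wpow n 1 (1 * p) p $$ (i, j) else 0)" using j by simp
      also have "\<dots> = (wpow n 1 (1 * p) p $$ (j, j) \<cdot>\<^sub>m ket_proj n j) $$ (i, i')"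
        using ii j by (auto simp: ket_proj_def wpow_def weyl_index n_mult)
      finally show "(wpow n 1 (1 * p) p * ket_proj n j) $$ (i, i')
        = (wpow n 1 (1 * p) p $$ (j, j) \<cdot>\<^sub>m ket_proj n j) $$ (i, i')" .
    qed (auto simp: ket_proj_def)
    have "mat_trace (B.P * ket_proj n j) \<in> {0, 1 / of_nat p}"
      by (rule B.overlap_periodic[OF K n_mult w tr0])
    moreover have "mat_trace (B.P * ket_proj n j) \<noteq> 0" using j by (simp add: mat_trace_mult_ket(1))
    ultimately have "1 / of_nat p = mat_trace (B.P * ket_proj n j)" by simp
    then show ?thesis using PF ketF[OF j(1)] unfolding overlaps_def by blast
  qed
  with base show "overlaps F = {0} \<union> {1 / of_nat d' | d'. d' > 0 \<and> d' dvd n}"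
  proof (intro overlaps_eqI[OF wF])
    fix d :: nat assume "d dvd n"
    then obtain i where "i \<le> 2" "d = p ^ i"
      using divides_primepow_nat[OF p, of d 2] by (auto simp: n_eq)
    then consider "d = 1" | "d = p" | "d = n"
      by (metis One_nat_def le_Suc_eq le_zero_eq numeral_2_eq_2 n_eq power_0 power_one_right)
    then show "1 / of_nat d \<in> overlaps F"
      using base \<open>1 / of_nat p \<in> overlaps F\<close> by cases auto
  qed auto
qed

end

section \<open>Dimension \<open>2a\<close>\<close>

definition directions :: "nat \<Rightarrow> (nat \<times> nat) set" where
  "directions q = insert (1, 0) ((\<lambda>b. (b, 1)) ` {..<q})"

lemma prime_direction:
  assumes q: "prime (q :: nat)"
  shows "\<exists>\<alpha> \<beta> l. (\<alpha>, \<beta>) \<in> directions q \<and> [l * \<alpha> = x] (mod q) \<and> [l * \<beta> = y] (mod q)"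
  using prime_line_cover[OF q, of y x]
proof
  assume "[y = 0] (mod q)"
  then have "[x * 0 = y] (mod q)" using cong_sym by fastforce
  then show ?thesis
    by (intro exI[of _ 1] exI[of _ 0] exI[of _ x]) (auto simp: directions_def)
next
  assume "\<exists>b<q. [y * b = x] (mod q)"
  then obtain b where "b < q" "[y * b = x] (mod q)" by auto
  then show ?thesis
    by (intro exI[of _ b] exI[of _ 1] exI[of _ y]) (auto simp: directions_def)
qed

lemma generating_two_primes:
  assumes q: "prime q" "prime q'" "q \<noteq> q'"
    and m: "\<not> q dvd m \<or> \<not> q dvd m'" "\<not> q' dvd m \<or> \<not> q' dvd m'"
  shows "generating (q * q') m m'"
  unfolding generating_def
proof (intro allI impI)
  fix l assume l: "q * q' dvd l * m" "q * q' dvd l * m'"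
  have "q dvd l * m" "q dvd l * m'" "q' dvd l * m" "q' dvd l * m'"
    using l dvd_trans[OF dvd_triv_left] dvd_trans[OF dvd_triv_right] by blast+
  then have "q dvd l" "q' dvd l" using m q by (auto simp: prime_dvd_mult_iff)
  moreover have "coprime q q'" using q primes_coprime by blast
  ultimately show "q * q' dvd l" by (rule divides_mult)
qed

text \<open>A line in \<open>\<int>\<^sub>q\<^sub>q\<^sub>'\<^sup>2\<close> is the product of a line in \<open>\<int>\<^sub>q\<^sup>2\<close> and one in \<open>\<int>\<^sub>q\<^sub>'\<^sup>2\<close>.\<close>

lemma two_primes_cover:
  assumes q: "prime q" "prime q'" "q \<noteq> q'" and n: "n = q * q'"
    and lines: "\<And>\<alpha> \<beta> \<alpha>' \<beta>'. (\<alpha>, \<beta>) \<in> directions q \<Longrightarrow> (\<alpha>', \<beta>') \<in> directions q' \<Longrightarrow>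
      \<exists>m m'. [m = \<alpha>] (mod q) \<and> [m' = \<beta>] (mod q) \<and> [m = \<alpha>'] (mod q') \<and> [m' = \<beta>'] (mod q') \<and>
        (\<forall>l. vanishes n X (l * m) (l * m'))"
  shows "vanishes n X x y"
proof -
  have cop: "coprime q q'" using q primes_coprime by blast
  have n0: "n > 0" using q n prime_gt_0_nat by simp
  obtain \<alpha> \<beta> l where 1: "(\<alpha>, \<beta>) \<in> directions q" "[l * \<alpha> = x] (mod q)" "[l * \<beta> = y] (mod q)"
    using prime_direction[OF q(1)] by blast
  obtain \<alpha>' \<beta>' l' where 2: "(\<alpha>', \<beta>') \<in> directions q'" "[l' * \<alpha>' = x] (mod q')" "[l' * \<beta>' = y] (mod q')"
    using prime_direction[OF q(2)] by blast
  obtain m m' where m: "[m = \<alpha>] (mod q)" "[m' = \<beta>] (mod q)" "[m = \<alpha>'] (mod q')" "[m' = \<beta>'] (mod q')"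
    "\<And>l. vanishes n X (l * m) (l * m')" using lines[OF 1(1) 2(1)] by blast
  obtain j where j: "[j = l] (mod q)" "[j = l'] (mod q')"
    using binary_chinese_remainder_nat[OF cop] by blast
  have "[j * m = x] (mod n)" unfolding n
    using cong_trans[OF cong_mult[OF j(1) m(1)] 1(2)] cong_trans[OF cong_mult[OF j(2) m(3)] 2(2)] cop
    by (rule coprime_cong_mult_nat)
  moreover have "[j * m' = y] (mod n)" unfolding n
    using cong_trans[OF cong_mult[OF j(1) m(2)] 1(3)] cong_trans[OF cong_mult[OF j(2) m(4)] 2(3)] cop
    by (rule coprime_cong_mult_nat)
  ultimately show ?thesis using vanishes_cong[OF n0, of "j * m" x "j * m'" y X] m(5) by blast
qed

text \<open>Classes modulo \<open>q\<close> other than \<open>c0\<close> are completed first; afterwards each class modulo \<open>r\<close>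
  lacks a single label.\<close>

lemma (in weyl_eigenvalue) grid_line_vanishes:
  assumes n: "n = q * r" and cop: "coprime q r"
    and van: "\<And>l. vanishes n X (r * l * m) (r * l * m')" "\<And>l. vanishes n X (q * l * m) (q * l * m')"
    and zero: "\<And>c. c < q \<Longrightarrow> c \<noteq> c0 \<Longrightarrow> \<exists>k0. \<forall>k<n. k mod q = c \<longrightarrow> k \<noteq> k0 \<longrightarrow>
      pairing_form n X (wproj n m m' (z * unity_root n ^ k)) = 0"
  shows "vanishes n X (l * m) (l * m')"
proof (rule line_vanishes)
  have q: "q > 0" using n n_pos by auto
  have off: "pairing_form n X (wproj n m m' (z * unity_root n ^ k)) = 0" if k: "k < n" "k mod q \<noteq> c0" for k
  proof -
    obtain k0 where k0: "\<And>k'. k' < n \<Longrightarrow> k' mod q = k mod q \<Longrightarrow> k' \<noteq> k0 \<Longrightarrow>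
      pairing_form n X (wproj n m m' (z * unity_root n ^ k')) = 0"
      using zero[of "k mod q"] k q by auto
    show ?thesis
    proof (cases "k = k0")
      case True
      show ?thesis by (rule class_vanishes[OF n van(1) k(1)]) (use k0 True in auto)
    qed (use k0 k in auto)
  qed
  fix k assume k: "k < n"
  show "pairing_form n X (wproj n m m' (z * unity_root n ^ k)) = 0"
  proof (cases "k mod q = c0")
    case True
    show ?thesis
    proof (rule class_vanishes[of r q, OF _ van(2) k])
      fix k' assume k': "k' < n" "k' \<noteq> k" "k' mod r = k mod r"
      \<comment> \<open>By the Chinese remainder theorem the class of \<open>k\<close> modulo
        \<open>r\<close> meets the class \<open>c0\<close> modulo \<open>q\<close> only in
        \<open>k\<close>.\<close>
      have "k' mod q \<noteq> c0"
      proof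
        assume "k' mod q = c0"
        then have "[k' = k] (mod q * r)"
          using k' True cop by (intro coprime_cong_mult_nat) (auto simp: cong_def)
        then show False using k k' n by (simp add: cong_def)
      qed
      then show "pairing_form n X (wproj n m m' (z * unity_root n ^ k')) = 0" using off k' by blast
    qed (simp add: n mult.commute)
  qed (use off k in blast)
qed

lemma card_subset_image_le:
  assumes "finite A" "F \<subseteq> f ` A"
  shows "finite F" "card F \<le> card A"
  using assms by (auto intro: finite_subset surj_card_le)

section \<open>Counting and separation for the family in dimension \<open>2 * a\<close>\<close>

locale even_dimension =
  fixes a n :: nat
  assumes a: "prime a" "odd a" and n_eq: "n = 2 * a"
begin

lemma a_ge_3: "a \<ge> 3"
  using a prime_ge_2_nat[OF a(1)] by (cases "a = 2") auto

lemma n_pos: "n > 0" and a_pos: "a > 0"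
  using a_ge_3 n_eq by auto

lemma cong_Suc_a: "[a + 1 = 1] (mod a)"
  unfolding cong_def by (rule mod_add_self1)

definition eps :: "nat \<Rightarrow> nat \<Rightarrow> complex" where
  "eps m m' = (if even (m * m') then 1 else cis (pi / (2 * real a)))"

text \<open>Since \<open>n - 1\<close> is odd, \<open>U ^ n\<close> is \<open>-1\<close> exactly
  when \<open>m * m'\<close> is odd; \<open>eps\<close> is then an \<open>n\<close>-th root of
  \<open>-1\<close>.\<close>

lemma eps_eigenvalue: "weyl_eigenvalue n m m' (eps m m')"
proof
  have "odd (n - 1)" using a_pos by (simp add: n_eq)
  then have "wphase n m m' n = (if even (m * m') then 1 else - 1)"
    by (simp add: wphase_full[OF n_pos])
  moreover have "cis (pi / (2 * real a)) ^ n = - 1"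
    using a_pos by (simp add: DeMoivre n_eq)
  ultimately show "eps m m' ^ n = wphase n m m' n" by (simp add: eps_def)
qed (rule n_pos)

lemma even_proj_eq: "even_proj a (m, m') k = wproj n m m' (eps m m' * unity_root n ^ k)"
proof -
  have "cis (pi * real k / real a) = unity_root n ^ k"
    using a_pos by (simp add: DeMoivre n_eq mult.commute)
  then have "even_proj a (m, m') k = eigenproj (weyl n m m') (eps m m' * unity_root n ^ k)"
    by (simp add: even_proj_def eps_def n_eq)
  then show ?thesis
    using weyl_eigenvalue.eigenproj_weyl[OF weyl_eigenvalue.other_eigenvalue[OF eps_eigenvalue]] by simp
qed

lemma weyl_projection_even_proj: "generating n m m' \<Longrightarrow> weyl_projection n (even_proj a (m, m') k)"
  unfolding even_proj_eq
  by (intro weyl_projection_wprojI weyl_eigenvalue.other_eigenvalue eps_eigenvalue)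

text \<open>Adding the odd number \<open>a\<close> flips the parity and keeps the residue modulo
  \<open>a\<close>, so the case distinctions are explicit Chinese remainders: residue
  \<open>t\<close> modulo \<open>a\<close> with a prescribed parity.\<close>

lemma odd_even_j: "odd (even_j a t)" and even_even_k: "even (even_k a t)" and odd_even_g: "odd (even_g a t)"
  using a by (auto simp: even_j_def even_k_def even_g_def)

lemma cong_even_j: "[even_j a t = t] (mod a)" and cong_even_k: "[even_k a t = t] (mod a)"
  and cong_even_g: "[even_g a t = t] (mod a)"
  by (auto simp: even_j_def even_k_def even_g_def cong_def)

lemma generating_Sigma:
  assumes "(m, m') \<in> even_Sigma a"
  shows "generating n m m'"
proof -
  have "\<not> a dvd 1" using a_ge_3 by simp
  then have a1: "\<not> a dvd 1" "\<not> a dvd a + 1" using dvd_add_right_iff[OF dvd_refl, of a 1] by blast+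
  then have "\<not> a dvd Suc a" by simp
  show ?thesis unfolding n_eq
  proof (rule generating_two_primes)
    show "\<not> 2 dvd m \<or> \<not> 2 dvd m'" "\<not> a dvd m \<or> \<not> a dvd m'"
      using assms a a1 \<open>\<not> a dvd Suc a\<close> odd_even_j by (auto simp: even_Sigma_def)
  qed (use a in auto)
qed

definition rest :: "(nat \<times> nat) set" where
  "rest = even_Sigma a - {(1, 0), (0, 1), (1, 1)} - {(even_j a t, a + 1) | t. t \<in> {2..a-1}}"

text \<open>In the \<open>even_k\<close> part \<open>t = 0\<close> gives \<open>(0, 1)\<close>, and
  in the \<open>even_g\<close> part \<open>t = 1\<close> gives \<open>(1, 1)\<close>; both are
  excluded. Together with \<open>(a + 1, a)\<close>, \<open>(1, a)\<close> and \<open>even_j\<close>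
  for \<open>t < 2\<close> at most \<open>4 + 2 * (a - 1)\<close> directions remain.\<close>

lemma card_rest: "finite rest" "card rest \<le> 2 * a + 2"
proof -
  define R where "R = {(a + 1, a), (1, a), (even_j a 0, a + 1), (even_j a 1, a + 1)}
    \<union> (\<lambda>t. (even_k a t, 1)) ` {1..a-1} \<union> (\<lambda>t. (even_g a t, 1)) ` ({0..a-1} - {1})"
  have sub: "rest \<subseteq> R"
  proof
    fix \<sigma> assume \<sigma>: "\<sigma> \<in> rest"
    then consider "\<sigma> = (a + 1, a)" | "\<sigma> = (1, a)" | t where "\<sigma> = (even_j a t, a + 1)" "t \<in> {0..a-1}"
      | t where "\<sigma> = (even_k a t, 1)" "t \<in> {0..a-1}" | t where "\<sigma> = (even_g a t, 1)" "t \<in> {0..a-1}"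
      unfolding rest_def even_Sigma_def by blast
    then show "\<sigma> \<in> R"
    proof cases
      case (3 t)
      then have "t \<notin> {2..a-1}" using \<sigma> unfolding rest_def by blast
      then have "t = 0 \<or> t = 1" using 3(2) by auto
      then show ?thesis using 3(1) by (auto simp: R_def)
    next
      case (4 t)
      have "t \<noteq> 0"
      proof
        assume "t = 0"
        then have "\<sigma> = (0, 1)" using 4(1) by (simp add: even_k_def)
        then show False using \<sigma> by (simp add: rest_def)
      qed
      then show ?thesis using 4 by (auto simp: R_def)
    next
      case (5 t)
      then have "t \<noteq> 1" using \<sigma> by (auto simp: rest_def even_g_def)
      then show ?thesis using 5 by (auto simp: R_def)
    qed (auto simp: R_def)
  qed
  have fin: "finite R" by (simp add: R_def)
  show "finite rest" using finite_subset[OF sub fin] .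
  have "card R \<le> card {(a + 1, a), (1, a), (even_j a 0, a + 1), (even_j a 1, a + 1)}
      + card ((\<lambda>t. (even_k a t, 1 :: nat)) ` {1..a-1}) + card ((\<lambda>t. (even_g a t, 1 :: nat)) ` ({0..a-1} - {1}))"
    unfolding R_def by (intro order_trans[OF card_Un_le] add_mono order_refl)
  also have "\<dots> \<le> 4 + (a - 1) + (a - 1)"
  proof (intro add_mono)
    show "card {(a + 1, a), (1, a), (even_j a 0, a + 1), (even_j a 1, a + 1)} \<le> 4"
      using card_length[of "[(a + 1, a), (1, a), (even_j a 0, a + 1), (even_j a 1, a + 1)]"] by simp
    show "card ((\<lambda>t. (even_k a t, 1 :: nat)) ` {1..a-1}) \<le> a - 1"
      using card_image_le[of "{1..a-1}" "\<lambda>t. (even_k a t, 1 :: nat)"] by simp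
    have "card ({0..a-1} - {1}) = a - 1" using a_ge_3 by simp
    then show "card ((\<lambda>t. (even_g a t, 1 :: nat)) ` ({0..a-1} - {1})) \<le> a - 1"
      using card_image_le[of "{0..a-1} - {1}" "\<lambda>t. (even_g a t, 1 :: nat)"] by simp
  qed
  finally show "card rest \<le> 2 * a + 2" using card_mono[OF fin sub] a_ge_3 by simp
qed

definition "F1 = {even_proj a (1, 0) k | k. k \<le> 2 * a - 1}"
definition "F2 = {even_proj a \<sigma> k | \<sigma> k. \<sigma> \<in> {(0, 1), (1, 1)} \<and> k \<le> 2 * a - 2}"
definition "F3 = {even_proj a (even_j a t, a + 1) k | t k. t \<in> {2..a-1} \<and> k \<le> 2 * a - 3}"
definition "F4 = {even_proj a \<sigma> k | \<sigma> k. \<sigma> \<in> rest \<and> k \<le> a - 2}"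

lemma family_eq: "even_family a = F1 \<union> F2 \<union> F3 \<union> F4"
  unfolding even_family_def F1_def F2_def F3_def F4_def rest_def ..

lemma family_card: "finite (even_family a)" "card (even_family a) \<le> n\<^sup>2"
proof -
  have i1: "F1 \<subseteq> (\<lambda>k. even_proj a (1, 0) k) ` {..2 * a - 1}"
    unfolding F1_def by blast
  have i2: "F2 \<subseteq> case_prod (even_proj a) ` ({(0, 1), (1, 1)} \<times> {..2 * a - 2})"
    unfolding F2_def by fast
  have i3: "F3 \<subseteq> (\<lambda>(t, k). even_proj a (even_j a t, a + 1) k) ` ({2..a-1} \<times> {..2 * a - 3})"
    unfolding F3_def by fast
  have i4: "F4 \<subseteq> case_prod (even_proj a) ` (rest \<times> {..a - 2})"
    unfolding F4_def by fast
  note c = card_subset_image_le[OF _ i1] card_subset_image_le[OF _ i2] card_subset_image_le[OF _ i3] card_subset_image_le[OF _ i4]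
  show "finite (even_family a)" unfolding family_eq using c card_rest(1) by blast
  have "card (even_family a) \<le> card F1 + card F2 + card F3 + card F4"
    unfolding family_eq
    using card_Un_le[of "F1 \<union> F2 \<union> F3" F4] card_Un_le[of "F1 \<union> F2" F3] card_Un_le[of F1 F2] by linarith
  \<comment> \<open>Labels kept per line: all \<open>2 * a\<close>, all but one, all but two, and
    \<open>a - 1\<close>.\<close>
  also have "\<dots> \<le> 2 * a + 2 * (2 * a - 1) + (a - 2) * (2 * a - 2) + (2 * a + 2) * (a - 1)"
  proof (intro add_mono)
    show "card F1 \<le> 2 * a" using c(2) a_ge_3 by simp
    show "card F2 \<le> 2 * (2 * a - 1)" using c(4) a_ge_3 by (simp add: card_cartesian_product Suc_diff_Suc)
    have "Suc (2 * a - 3) = 2 * a - 2" "Suc (a - 2) = a - 1" "Suc (a - 1) - 2 = a - 2" using a_ge_3 by auto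
    then have "card F3 \<le> (a - 2) * (2 * a - 2)" and 4: "card F4 \<le> card rest * (a - 1)"
      using c(6) c(8) card_rest(1) by (simp_all add: card_cartesian_product)
    then show "card F3 \<le> (a - 2) * (2 * a - 2)" by blast
    show "card F4 \<le> (2 * a + 2) * (a - 1)"
      by (rule order_trans[OF 4 mult_le_mono1[OF card_rest(2)]])
  qed
  also have "\<dots> = n\<^sup>2"
  proof -
    define b where "b = a - 2"
    have "a = b + 2" using a_ge_3 by (simp add: b_def)
    then show ?thesis unfolding n_eq by (simp add: power2_eq_square algebra_simps)
  qed
  finally show "card (even_family a) \<le> n\<^sup>2" .
qed

lemma family_weyl_projection:
  assumes "P \<in> even_family a"
  shows "weyl_projection n P"
proof -
  consider "P \<in> F1" | "P \<in> F2" | "P \<in> F3" | "P \<in> F4" using assms unfolding family_eq by blast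
  then show ?thesis
  proof cases
    case 3
    then obtain t k where tk: "P = even_proj a (even_j a t, a + 1) k" "t \<in> {2..a-1}" unfolding F3_def by blast
    then have "(even_j a t, a + 1) \<in> even_Sigma a" by (auto simp: even_Sigma_def)
    then show ?thesis unfolding tk(1) by (intro weyl_projection_even_proj generating_Sigma)
  next
    case 4
    then obtain \<sigma> k where "P = even_proj a \<sigma> k" "\<sigma> \<in> rest" unfolding F4_def by blast
    then show ?thesis using weyl_projection_even_proj[OF generating_Sigma] unfolding rest_def
      by (cases \<sigma>) blast
  qed (auto simp: F1_def F2_def intro!: weyl_projection_even_proj)
qed

text \<open>The multiples \<open>a * l\<close> of a direction depend only on parities, and
  \<open>(1, 0)\<close>, \<open>(0, 1)\<close>, \<open>(1, 1)\<close> represent all lines modulo 2.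
  The multiples \<open>2 * l\<close> depend only on residues modulo \<open>a\<close>, where these
  three and the \<open>even_j\<close> lines with \<open>t \<ge> 2\<close> represent all lines. So
  both subgroups are known on each line of \<open>rest\<close>.\<close>

lemma family_separating: "separating n (even_family a)"
proof (rule separating_if_vanishes[OF n_pos])
  fix X x y assume X: "\<And>P. P \<in> even_family a \<Longrightarrow> pairing_form n X P = 0"
  have l10: "vanishes n X (l * 1) (l * 0)" for l
  proof (rule weyl_eigenvalue.line_vanishes[OF eps_eigenvalue])
    fix k assume "k < n"
    then have "even_proj a (1, 0) k \<in> F1" unfolding F1_def n_eq by auto
    then show "pairing_form n X (wproj n 1 0 (eps 1 0 * unity_root n ^ k)) = 0"
      using X unfolding family_eq even_proj_eq by blast
  qed
  have diag: "vanishes n X x y" if "[y = 0] (mod n)" for x y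
    using l10[of x] vanishes_cong[OF n_pos cong_refl that, of X x] by simp
  have l1: "vanishes n X (l * m) (l * 1)" if m: "m \<in> {0, 1}" for l m
  proof (rule weyl_eigenvalue.line_vanishes_but_one[where ?k0.0 = "2 * a - 1", OF eps_eigenvalue diag[OF cong_refl]])
    fix k assume k: "k < n" "k \<noteq> 2 * a - 1"
    then have "k \<le> 2 * a - 2" by (simp add: n_eq)
    moreover have "(m, 1) \<in> {(0, 1), (1, 1 :: nat)}" using m by auto
    ultimately have "even_proj a (m, 1) k \<in> F2" unfolding F2_def by blast
    then show "pairing_form n X (wproj n m 1 (eps m 1 * unity_root n ^ k)) = 0"
      using X unfolding family_eq even_proj_eq by blast
  qed
  have lj: "vanishes n X (l * even_j a t) (l * (a + 1))" if t: "t \<in> {2..a-1}" for l t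
  proof (rule weyl_eigenvalue.line_vanishes[OF eps_eigenvalue])
    let ?j = "even_j a t"
    have zero: "pairing_form n X (wproj n ?j (a + 1) (eps ?j (a + 1) * unity_root n ^ k)) = 0" if k: "k \<le> 2 * a - 3" for k
    proof -
      have "even_proj a (?j, a + 1) k \<in> F3" using k t unfolding F3_def by blast
      then show ?thesis using X unfolding family_eq even_proj_eq by blast
    qed
    fix k assume k: "k < n"
    show "pairing_form n X (wproj n ?j (a + 1) (eps ?j (a + 1) * unity_root n ^ k)) = 0"
    proof (cases "k \<le> 2 * a - 3")
      case False
      show ?thesis
      proof (rule weyl_eigenvalue.class_vanishes[OF eps_eigenvalue n_eq _ k])
        fix l
        \<comment> \<open>As \<open>a + 1\<close> is even, the \<open>a\<close>-multiples of this
          direction lie on the diagonal line.\<close>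
        obtain b where "a + 1 = 2 * b" using a(2) by (meson dvdE even_plus_one_iff)
        then have "a * l * (a + 1) = n * (l * b)" by (simp add: n_eq)
        then show "vanishes n X (a * l * ?j) (a * l * (a + 1))" by (intro diag) (simp add: cong_0_iff)
      next
        fix k' assume k': "k' < n" "k' \<noteq> k" "k' mod 2 = k mod 2"
        \<comment> \<open>The missing labels \<open>2 * a - 2\<close> and \<open>2 * a - 1\<close>
          have different parity.\<close>
        have "k' \<le> 2 * a - 3"
        proof (rule ccontr)
          assume "\<not> k' \<le> 2 * a - 3"
          with False k k' have "k' + 1 = k \<or> k + 1 = k'" unfolding n_eq by linarith
          then show False using k'(3) by presburger
        qed
        then show "pairing_form n X (wproj n ?j (a + 1) (eps ?j (a + 1) * unity_root n ^ k')) = 0" by (rule zero)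
      qed
    qed (use zero in blast)
  qed
  have va: "vanishes n X (a * l * m) (a * l * m')" for l m m'
  proof (cases "even m'")
    case True
    then obtain b where "m' = 2 * b" ..
    then show ?thesis by (intro diag) (simp add: n_eq cong_0_iff)
  next
    case False
    have *: "[a * l * m = a * l * (m mod 2)] (mod n)" for m
    proof -
      have "[a * (l * m) = a * (l * (m mod 2))] (mod a * 2)"
        by (intro cong_cmult_leftI cong_scalar_left) (simp add: cong_def)
      then show ?thesis by (simp add: n_eq mult.assoc mult.commute[of a 2])
    qed
    have "m mod 2 \<in> {0, 1}" "m' mod 2 = 1" using False by (auto simp: odd_iff_mod_2_eq_one)
    then show ?thesis using vanishes_cong[OF n_pos *[of m] *[of m'], of X] l1[of "m mod 2" "a * l"] by simp
  qed
  have v2: "vanishes n X (2 * l * m) (2 * l * m')" if m': "[m' = 0] (mod a) \<or> [m' = 1] (mod a)" for l m m'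
  proof -
    have *: "[2 * l * b = 2 * l * c] (mod n)" if "[b = c] (mod a)" for b c
    proof -
      have "[2 * (l * b) = 2 * (l * c)] (mod 2 * a)"
        by (intro cong_cmult_leftI cong_scalar_left that)
      then show ?thesis by (simp add: n_eq mult.assoc)
    qed
    show ?thesis
    proof (cases "[m' = 0] (mod a)")
      case True
      then show ?thesis using *[of m' 0] by (intro diag) simp
    next
      case False
      then have m1: "[m' = 1] (mod a)" using m' by blast
      define t where "t = m mod a"
      have mt: "[m = t] (mod a)" by (simp add: t_def cong_def)
      have t: "t < a" using a_pos by (simp add: t_def)
      show ?thesis
      proof (cases "t \<ge> 2")
        case False
        then have "t \<in> {0, 1}" by auto
        then show ?thesis using l1[of t "2 * l"] vanishes_cong[OF n_pos *[OF mt] *[OF m1], of X] by simp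
      next
        case True
        \<comment> \<open>\<open>1\<close> and \<open>a + 1\<close> agree modulo \<open>a\<close>,
          so \<open>lj\<close> serves here.\<close>
        have "[m' = a + 1] (mod a)" using m1 cong_Suc_a cong_sym cong_trans by blast
        moreover have "[m = even_j a t] (mod a)" using mt cong_even_j cong_sym cong_trans by blast
        ultimately show ?thesis
          using True t lj[of t "2 * l"] vanishes_cong[OF n_pos * *, of m "even_j a t" m' "a + 1" X] by simp
      qed
    qed
  qed
  have lrest: "vanishes n X (l * m) (l * m')" if r: "(m, m') \<in> rest" for l m m'
  proof (rule weyl_eigenvalue.grid_line_vanishes[where q = a and r = 2 and ?c0.0 = "a - 1", OF eps_eigenvalue])
    have "m' \<in> {0, 1, a, a + 1}" using r by (auto simp: rest_def even_Sigma_def)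
    moreover have "[a = 0] (mod a)" by (simp add: cong_0_iff)
    ultimately have "[m' = 0] (mod a) \<or> [m' = 1] (mod a)" using cong_Suc_a cong_refl by blast
    then show "vanishes n X (2 * l * m) (2 * l * m')" for l by (rule v2)
    fix c assume c: "c < a" "c \<noteq> a - 1"
    show "\<exists>k0. \<forall>k<n. k mod a = c \<longrightarrow> k \<noteq> k0 \<longrightarrow>
        pairing_form n X (wproj n m m' (eps m m' * unity_root n ^ k)) = 0"
    proof (intro exI allI impI)
      \<comment> \<open>The class of \<open>c\<close> modulo \<open>a\<close> is
        \<open>{c, a + c}\<close>. For \<open>c \<le> a - 2\<close> only \<open>a + c\<close> is
        missing; the class \<open>a - 1\<close>, exempted as \<open>c0\<close>, lacks both.\<close>
      fix k assume k: "k < n" "k mod a = c" "k \<noteq> a + c"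
      have "k = c"
      proof (cases "k < a")
        case False
        then have "(k - a) mod a = c" "k - a < a" using k(1,2) le_mod_geq[of a k] by (auto simp: n_eq)
        then show ?thesis using k(3) False by simp
      qed (use k in simp)
      then have "k \<le> a - 2" using c by simp
      then have "even_proj a (m, m') k \<in> F4" using r unfolding F4_def by blast
      then show "pairing_form n X (wproj n m m' (eps m m' * unity_root n ^ k)) = 0"
        using X unfolding family_eq even_proj_eq by blast
    qed
  qed (use va a in \<open>auto simp: n_eq\<close>)
  have lSigma: "vanishes n X (l * m) (l * m')" if s: "(m, m') \<in> even_Sigma a" for l m m'
  proof -
    consider "(m, m') \<in> rest" | "(m, m') = (1, 0)" | "m \<in> {0, 1}" "m' = 1"
      | t where "(m, m') = (even_j a t, a + 1)" "t \<in> {2..a-1}"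
      using s unfolding rest_def by blast
    then show ?thesis
      by cases (use lrest l10[of l] l1[of m l] lj in auto)
  qed
  show "vanishes n X x y"
  proof (rule two_primes_cover[of 2 a])
    fix \<alpha> \<beta> \<alpha>' \<beta>' assume d: "(\<alpha>, \<beta>) \<in> directions 2" "(\<alpha>', \<beta>') \<in> directions a"
    have "\<exists>m m'. (m, m') \<in> even_Sigma a \<and>
      [m = \<alpha>] (mod 2) \<and> [m' = \<beta>] (mod 2) \<and> [m = \<alpha>'] (mod a) \<and> [m' = \<beta>'] (mod a)"
    proof -
      have d2: "(\<alpha>, \<beta>) = (1, 0) \<or> (\<alpha>, \<beta>) = (0, 1) \<or> (\<alpha>, \<beta>) = (1, 1)"
        using d(1) by (auto simp: directions_def less_2_cases_iff)
      have odd2: "[b = 1] (mod 2)" if "odd b" for b :: nat using that by (simp add: cong_def odd_iff_mod_2_eq_one)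
      have even2: "[b = 0] (mod 2)" if "even b" for b :: nat using that by (simp add: cong_0_iff)
      consider "(\<alpha>', \<beta>') = (1, 0)" | t where "(\<alpha>', \<beta>') = (t, 1)" "t \<in> {0..a-1}"
        using d(2) by (auto simp: directions_def)
      then show ?thesis
      proof cases
        case 1
        have aa: "[a + 1 = 1] (mod a)" "[a = 0] (mod a)" using cong_Suc_a by (simp_all add: cong_0_iff)
        show ?thesis
        proof -
          have "(1, 0) \<in> even_Sigma a" "(a + 1, a) \<in> even_Sigma a" "(1, a) \<in> even_Sigma a"
            by (auto simp: even_Sigma_def)
          moreover have "[a + 1 = 0] (mod 2)" "[a = 1] (mod 2)" using odd2[OF a(2)] even2[of "a + 1"] a(2) by auto
          ultimately show ?thesis using d2 1 aa by (metis Pair_inject cong_refl)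
        qed
      next
        case (2 t)
        note a1 = cong_Suc_a
        have "(even_j a t, a + 1) \<in> even_Sigma a" "(even_k a t, 1) \<in> even_Sigma a" "(even_g a t, 1) \<in> even_Sigma a"
          using 2(2) unfolding even_Sigma_def by blast+
        moreover have "[a + 1 = 0] (mod 2)" using a(2) even2[of "a + 1"] by auto
        moreover note odd2[OF odd_even_j] even2[OF even_even_k] odd2[OF odd_even_g] cong_even_j cong_even_k cong_even_g
        ultimately show ?thesis using d2 2(1) a1 by (metis Pair_inject cong_refl)
      qed
    qed
    then show "\<exists>m m'. [m = \<alpha>] (mod 2) \<and> [m' = \<beta>] (mod 2) \<and> [m = \<alpha>'] (mod a) \<and> [m' = \<beta>'] (mod a) \<and>
        (\<forall>l. vanishes n X (l * m) (l * m'))"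
      using lSigma by blast
  qed (use a n_eq in auto)
qed

lemma family_good: "good_system n (even_family a)"
  using family_card family_separating weyl_projection_trace_one[OF family_weyl_projection]
  by (simp add: good_system_def)

end

section \<open>Dimension \<open>pa\<close>\<close>

locale odd_dimension =
  fixes p a n :: nat
  assumes p: "prime p" "odd p" and a: "prime a" and less: "p < a" and n_eq: "n = p * a"
begin

lemma p_ge_3: "p \<ge> 3"
  using p prime_ge_2_nat[OF p(1)] by (cases "p = 2") auto

lemma a_pos: "a > 0" and p_pos: "p > 0" and n_pos: "n > 0"
  using p_ge_3 less n_eq by auto

lemma odd_a: "odd a"
  using primes_dvd_imp_eq[OF two_is_prime_nat a] less p_ge_3 by auto

lemma coprime_ap: "coprime a p"
  using a p less primes_coprime by blast

lemma crt_index: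
  "crt_index p a b t < n" "[crt_index p a b t = b] (mod a)" "[crt_index p a b t = t] (mod p)"
proof -
  have "\<exists>!m. m < a * p \<and> [m = b] (mod a) \<and> [m = t] (mod p)"
    by (rule binary_chinese_remainder_unique_nat[OF coprime_ap]) (use a_pos p_pos in auto)
  then have "\<exists>!m. m < p * a \<and> [m = b] (mod a) \<and> [m = t] (mod p)" by (simp only: mult.commute)
  from theI'[OF this] show "crt_index p a b t < n" "[crt_index p a b t = b] (mod a)" "[crt_index p a b t = t] (mod p)"
    unfolding crt_index_def n_eq by blast+
qed

lemma crt_index_unique:
  assumes "m < n" "[m = b] (mod a)" "[m = t] (mod p)"
  shows "crt_index p a b t = m"
proof -
  have "[crt_index p a b t = m] (mod p * a)"
  proof (rule coprime_cong_mult_nat)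
    show "[crt_index p a b t = m] (mod p)" using crt_index(3) assms(3) cong_sym cong_trans by blast
    show "[crt_index p a b t = m] (mod a)" using crt_index(2) assms(2) cong_sym cong_trans by blast
  qed (use coprime_ap in \<open>simp add: coprime_commute\<close>)
  then show ?thesis using assms(1) crt_index(1)[of b t] by (simp add: cong_def n_eq)
qed

text \<open>For odd \<open>n\<close> the sign in \<open>wphase_full\<close> is 1, so 1 is an
  admissible base point for every direction.\<close>

lemma base_eigenvalue: "weyl_eigenvalue n m m' 1"
proof
  have "even (n - 1)" using odd_a p(2) by (simp add: n_eq)
  then show "1 ^ n = wphase n m m' n" by (simp add: wphase_full[OF n_pos])
qed (rule n_pos)

lemma odd_proj_eq: "odd_proj p a (m, m') k = wproj n m m' (1 * unity_root n ^ k)"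
  using weyl_eigenvalue.eigenproj_weyl[OF weyl_eigenvalue.other_eigenvalue[OF base_eigenvalue]]
  by (simp add: odd_proj_def n_eq)

lemma weyl_projection_odd_proj: "generating n m m' \<Longrightarrow> weyl_projection n (odd_proj p a (m, m') k)"
  unfolding odd_proj_eq
  by (intro weyl_projection_wprojI weyl_eigenvalue.other_eigenvalue base_eigenvalue)

lemma generating_Sigma:
  assumes "(m, m') \<in> odd_Sigma p a"
  shows "generating n m m'"
proof -
  have nd: "\<not> q dvd x" if "[x = 1] (mod q)" "prime q" for x q :: nat
    using that by (metis cong_dvd_iff not_prime_unit)
  consider "m = 1" | "m' = 1" | t where "m = crt_index p a 1 t" "m' = crt_index p a 0 1"
    | b where "m = crt_index p a b 1" "m' = crt_index p a 1 0"
    using assms unfolding odd_Sigma_def by blast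
  then have "(\<not> p dvd m \<or> \<not> p dvd m') \<and> (\<not> a dvd m \<or> \<not> a dvd m')"
  proof cases
    case (3 t)
    then show ?thesis using nd[OF crt_index(3) p(1)] nd[OF crt_index(2) a] by blast
  next
    case (4 b)
    then show ?thesis using nd[OF crt_index(3) p(1)] nd[OF crt_index(2) a] by blast
  qed (use nd[OF cong_refl p(1)] nd[OF cong_refl a] in auto)
  then show ?thesis unfolding n_eq
    by (intro generating_two_primes) (use p a less in auto)
qed

definition rest :: "(nat \<times> nat) set" where
  "rest = odd_Sigma p a - {(1, 0)} - {(b, 1) | b. b \<in> {0..a-1}}"

text \<open>All values of \<open>crt_index\<close> lie below \<open>n\<close>, and those below
  \<open>a\<close> are excluded for second component 1. This leaves at most \<open>n - a\<close>
  directions of that kind, besides \<open>p + a\<close> others.\<close>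

lemma card_rest: "finite rest" "card rest \<le> p * a + p"
proof -
  define R where "R = (\<lambda>m. (m, 1)) ` {a..<n} \<union> (\<lambda>t. (crt_index p a 1 t, crt_index p a 0 1)) ` {..<p}
    \<union> (\<lambda>b. (crt_index p a b 1, crt_index p a 1 0)) ` {..<a}"
  have sub: "rest \<subseteq> R"
  proof
    fix \<sigma> assume \<sigma>: "\<sigma> \<in> rest"
    then consider b t where "\<sigma> = (crt_index p a b t, 1)"
      | t where "\<sigma> = (crt_index p a 1 t, crt_index p a 0 1)" "t \<in> {0..p-1}"
      | b where "\<sigma> = (crt_index p a b 1, crt_index p a 1 0)" "b \<in> {0..a-1}"
      unfolding rest_def odd_Sigma_def by blast
    then show "\<sigma> \<in> R"
    proof cases
      case (1 b t)
      then have "crt_index p a b t \<notin> {0..a-1}" using \<sigma> unfolding rest_def by blast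
      then have "crt_index p a b t \<in> {a..<n}" using crt_index(1) by auto
      then show ?thesis unfolding R_def 1 by blast
    next
      case (2 t)
      then have "t \<in> {..<p}" using p_pos by auto
      then show ?thesis unfolding R_def 2 by blast
    next
      case (3 b)
      then have "b \<in> {..<a}" using a_pos by auto
      then show ?thesis unfolding R_def 3 by blast
    qed
  qed
  have fin: "finite R" by (simp add: R_def)
  show "finite rest" using finite_subset[OF sub fin] .
  have "card R \<le> card ((\<lambda>m. (m, 1 :: nat)) ` {a..<n})
    + card ((\<lambda>t. (crt_index p a 1 t, crt_index p a 0 1)) ` {..<p})
    + card ((\<lambda>b. (crt_index p a b 1, crt_index p a 1 0)) ` {..<a})"
    unfolding R_def by (intro order_trans[OF card_Un_le] add_mono order_refl)
  also have "\<dots> \<le> (n - a) + p + a"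
    using card_image_le[of "{a..<n}" "\<lambda>m. (m, 1 :: nat)"]
      card_image_le[of "{..<p}" "\<lambda>t. (crt_index p a 1 t, crt_index p a 0 1)"]
      card_image_le[of "{..<a}" "\<lambda>b. (crt_index p a b 1, crt_index p a 1 0)"] by (intro add_mono) auto
  also have "\<dots> = p * a + p"
  proof -
    have "a \<le> p * a" using p_pos by simp
    then show ?thesis unfolding n_eq by linarith
  qed
  finally show "card rest \<le> p * a + p" using card_mono[OF fin sub] by simp
qed

definition "F1 = {odd_proj p a (1, 0) k | k. k \<le> p * a - 1}"
definition "F2 = {odd_proj p a (b, 1) k | b k. b \<in> {0..p-1} \<and> k \<le> p * a - 2}"
definition "F3 = {odd_proj p a (b, 1) k | b k. b \<in> {p..a-1} \<and> k \<le> p * (a - 1) - 1}"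
definition "F4 = {odd_proj p a \<sigma> (crt_index p a b' t') | \<sigma> b' t'.
  \<sigma> \<in> rest \<and> b' \<in> {0..a-2} \<and> t' \<in> {0..p-2}}"

lemma family_eq: "odd_family p a = F1 \<union> F2 \<union> F3 \<union> F4"
  unfolding odd_family_def F1_def F2_def F3_def F4_def rest_def by simp

lemma family_card: "finite (odd_family p a)" "card (odd_family p a) \<le> n\<^sup>2"
proof -
  have i1: "F1 \<subseteq> (\<lambda>k. odd_proj p a (1, 0) k) ` {..p * a - 1}"
    unfolding F1_def by blast
  have i2: "F2 \<subseteq> (\<lambda>(b, k). odd_proj p a (b, 1) k) ` ({0..p-1} \<times> {..p * a - 2})"
    unfolding F2_def by fast
  have i3: "F3 \<subseteq> (\<lambda>(b, k). odd_proj p a (b, 1) k) ` ({p..a-1} \<times> {..p * (a - 1) - 1})"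
    unfolding F3_def by fast
  have i4: "F4 \<subseteq> (\<lambda>(\<sigma>, b, t). odd_proj p a \<sigma> (crt_index p a b t)) ` (rest \<times> {0..a-2} \<times> {0..p-2})"
  proof
    fix P assume "P \<in> F4"
    then obtain \<sigma> b t where "P = odd_proj p a \<sigma> (crt_index p a b t)" "(\<sigma>, b, t) \<in> rest \<times> {0..a-2} \<times> {0..p-2}"
      unfolding F4_def by blast
    then show "P \<in> (\<lambda>(\<sigma>, b, t). odd_proj p a \<sigma> (crt_index p a b t)) ` (rest \<times> {0..a-2} \<times> {0..p-2})"
      by (intro image_eqI[of _ _ "(\<sigma>, b, t)"]) simp_all
  qed
  note c = card_subset_image_le[OF _ i1] card_subset_image_le[OF _ i2] card_subset_image_le[OF _ i3] card_subset_image_le[OF _ i4]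
  show "finite (odd_family p a)" unfolding family_eq using c card_rest(1) by blast
  \<comment> \<open>Natural parameters for \<open>p\<close> and \<open>a\<close>, so that the count
    becomes a polynomial identity.\<close>
  define u v where "u = p - 2" and "v = a - p"
  have u: "p = u + 2" using p_ge_3 by (simp add: u_def)
  have v: "a = u + v + 2" using less u by (simp add: v_def)
  have "card (odd_family p a) \<le> card F1 + card F2 + card F3 + card F4"
    unfolding family_eq
    using card_Un_le[of "F1 \<union> F2 \<union> F3" F4] card_Un_le[of "F1 \<union> F2" F3] card_Un_le[of F1 F2] by linarith
  \<comment> \<open>Labels kept per line: all \<open>p * a\<close>, all but one, all but
    \<open>p\<close>, and \<open>(a - 1) * (p - 1)\<close>.\<close>
  also have "\<dots> \<le> p * a + p * (p * a - 1) + (a - p) * (p * (a - 1)) + (p * a + p) * ((a - 1) * (p - 1))"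
  proof (intro add_mono)
    have "p * a \<ge> 2" using mult_le_mono[of 2 p 1 a] p_ge_3 a_pos by simp
    moreover have "p * (a - 1) \<ge> 1" using p_pos u v by simp
    ultimately have s: "Suc (p * a - 1) = p * a" "Suc (p * a - 2) = p * a - 1" "Suc (p - 1) - 0 = p"
      "Suc (p * (a - 1) - 1) = p * (a - 1)" "Suc (a - 1) - p = a - p" "Suc (a - 2) - 0 = a - 1" "Suc (p - 2) - 0 = p - 1"
      using u v by linarith+
    note s = card_cartesian_product card_atMost card_atLeastAtMost s
    show "card F1 \<le> p * a" using c(2)[OF finite_atMost] unfolding s .
    show "card F2 \<le> p * (p * a - 1)" using c(4)[OF finite_cartesian_product] unfolding s by simp
    show "card F3 \<le> (a - p) * (p * (a - 1))" using c(6)[OF finite_cartesian_product] unfolding s by simp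
    have "card F4 \<le> card rest * ((a - 1) * (p - 1))"
      using c(8)[OF finite_cartesian_product[OF card_rest(1) finite_cartesian_product]] unfolding s by simp
    then show "card F4 \<le> (p * a + p) * ((a - 1) * (p - 1))"
      by (rule order_trans[OF _ mult_le_mono1[OF card_rest(2)]])
  qed
  also have "\<dots> = n\<^sup>2"
  proof -
    \<comment> \<open>The factor \<open>p * a - 1\<close> is kept as \<open>q\<close>; adding
      \<open>p\<close> on both sides turns \<open>p * q\<close> into
      \<open>p * (p * a)\<close>.\<close>
    define q where "q = p * a - 1"
    have q: "p * a = Suc q" using p_pos a_pos by (simp add: q_def)
    have 1: "a - p = v" "a - 1 = u + v + 1" "p - 1 = u + 1" by (simp_all add: u v)
    have "p * q + p = p * (p * a)" by (simp add: q)
    moreover have "p * a + p * (p * a) + v * (p * (u + v + 1)) + (p * a + p) * ((u + v + 1) * (u + 1)) = (p * a)\<^sup>2 + p"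
      unfolding u v by (simp add: power2_eq_square algebra_simps)
    ultimately have "p * a + p * q + v * (p * (u + v + 1)) + (p * a + p) * ((u + v + 1) * (u + 1)) = (p * a)\<^sup>2"
      by linarith
    then show ?thesis unfolding 1 n_eq using q by simp
  qed
  finally show "card (odd_family p a) \<le> n\<^sup>2" .
qed

lemma family_weyl_projection:
  assumes "P \<in> odd_family p a"
  shows "weyl_projection n P"
proof -
  consider "P \<in> F1 \<union> F2 \<union> F3" | "P \<in> F4" using assms unfolding family_eq by blast
  then show ?thesis
  proof cases
    case 2
    then obtain \<sigma> k where "P = odd_proj p a \<sigma> k" "\<sigma> \<in> rest" unfolding F4_def by blast
    then show ?thesis using weyl_projection_odd_proj[OF generating_Sigma] unfolding rest_def
      by (cases \<sigma>) blast
  qed (auto simp: F1_def F2_def F3_def intro!: weyl_projection_odd_proj)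
qed

text \<open>The lines \<open>(b, 1)\<close> with \<open>b < p\<close> and the diagonal line
  represent all lines modulo \<open>p\<close>, so the \<open>a\<close>-multiples of every direction
  in use are known. This completes the lines \<open>(b, 1)\<close> with \<open>b < a\<close>, which
  together with the diagonal line represent all lines modulo \<open>a\<close> and give the
  \<open>p\<close>-multiples.\<close>

lemma family_separating: "separating n (odd_family p a)"
proof (rule separating_if_vanishes[OF n_pos])
  fix X x y assume X: "\<And>P. P \<in> odd_family p a \<Longrightarrow> pairing_form n X P = 0"
  have l10: "vanishes n X (l * 1) (l * 0)" for l
  proof (rule weyl_eigenvalue.line_vanishes[OF base_eigenvalue])
    fix k assume "k < n"
    then have "odd_proj p a (1, 0) k \<in> F1" unfolding F1_def n_eq by auto
    then show "pairing_form n X (wproj n 1 0 (1 * unity_root n ^ k)) = 0"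
      using X unfolding family_eq odd_proj_eq by blast
  qed
  have diag: "vanishes n X x y" if "[y = 0] (mod n)" for x y
    using l10[of x] vanishes_cong[OF n_pos cong_refl that, of X x] by simp
  have l1: "vanishes n X (l * b) (l * 1)" if b: "b < p" for l b
  proof (rule weyl_eigenvalue.line_vanishes_but_one[where ?k0.0 = "n - 1", OF base_eigenvalue diag[OF cong_refl]])
    fix k assume k: "k < n" "k \<noteq> n - 1"
    then have "k \<le> p * a - 2" "b \<in> {0..p-1}" using b by (auto simp: n_eq)
    then have "odd_proj p a (b, 1) k \<in> F2" unfolding F2_def by blast
    then show "pairing_form n X (wproj n b 1 (1 * unity_root n ^ k)) = 0"
      using X unfolding family_eq odd_proj_eq by blast
  qed
  have *: "[a * l * b = a * l * c] (mod n)" if "[b = c] (mod p)" for l b c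
  proof -
    have "[a * (l * b) = a * (l * c)] (mod a * p)" by (intro cong_cmult_leftI cong_scalar_left that)
    then show ?thesis by (simp add: n_eq mult.assoc mult.commute[of a p])
  qed
  have **: "[p * l * b = p * l * c] (mod n)" if "[b = c] (mod a)" for l b c
  proof -
    have "[p * (l * b) = p * (l * c)] (mod p * a)" by (intro cong_cmult_leftI cong_scalar_left that)
    then show ?thesis by (simp add: n_eq mult.assoc)
  qed
  have va: "vanishes n X (a * l * m) (a * l * m')" if m': "[m' = 0] (mod p) \<or> [m' = 1] (mod p)" for l m m'
  proof (cases "[m' = 0] (mod p)")
    case True
    then show ?thesis using *[of m' 0] by (intro diag) simp
  next
    case False
    then have m1: "[m' = 1] (mod p)" using m' by blast
    have "[m = m mod p] (mod p)" "m mod p < p" using p_pos by (auto simp: cong_def)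
    then show ?thesis
      using l1[of "m mod p" "a * l"] vanishes_cong[OF n_pos * *[OF m1], of m "m mod p" X] by blast
  qed
  have l2: "vanishes n X (l * b) (l * 1)" if b: "b < a" for l b
  proof (cases "b < p")
    case False
    have zero: "pairing_form n X (wproj n b 1 (1 * unity_root n ^ k)) = 0" if k: "k < p * (a - 1)" for k
    proof -
      have "k \<le> p * (a - 1) - 1" "b \<in> {p..a-1}" using k b False by auto
      then have "odd_proj p a (b, 1) k \<in> F3" unfolding F3_def by blast
      then show ?thesis using X unfolding family_eq odd_proj_eq by blast
    qed
    show ?thesis
    proof (rule weyl_eigenvalue.line_vanishes[OF base_eigenvalue])
      fix k assume k: "k < n"
      show "pairing_form n X (wproj n b 1 (1 * unity_root n ^ k)) = 0"
      proof (cases "k < p * (a - 1)")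
        case False
        show ?thesis
        proof (rule weyl_eigenvalue.class_vanishes[OF base_eigenvalue n_eq va k])
          fix k' assume k': "k' < n" "k' \<noteq> k" "k' mod p = k mod p"
          \<comment> \<open>The missing labels are the last \<open>p\<close> ones; being
            consecutive, they lie in distinct classes modulo \<open>p\<close>.\<close>
          have "k' < p * (a - 1)"
          proof (rule ccontr)
            assume nk: "\<not> k' < p * (a - 1)"
            have "n = p * (a - 1) + p" using a_pos by (cases a) (auto simp: n_eq)
            then have "k - p * (a - 1) < p" "k' - p * (a - 1) < p" using k k'(1) False nk by linarith+
            moreover have "k = p * (a - 1) + (k - p * (a - 1))" "k' = p * (a - 1) + (k' - p * (a - 1))"
              using False nk by linarith+
            ultimately have "k mod p = k - p * (a - 1)" "k' mod p = k' - p * (a - 1)"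
              by (metis mod_less mod_mult_self4)+
            then show False using k' False nk by linarith
          qed
          then show "pairing_form n X (wproj n b 1 (1 * unity_root n ^ k')) = 0" by (rule zero)
        qed simp
      qed (use zero in blast)
    qed
  qed (use l1 in blast)
  have vp: "vanishes n X (p * l * m) (p * l * m')" if m': "[m' = 0] (mod a) \<or> [m' = 1] (mod a)" for l m m'
  proof (cases "[m' = 0] (mod a)")
    case True
    then show ?thesis using **[of m' 0] by (intro diag) simp
  next
    case False
    then have m1: "[m' = 1] (mod a)" using m' by blast
    have "[m = m mod a] (mod a)" "m mod a < a" using a_pos by (auto simp: cong_def)
    then show ?thesis
      using l2[of "m mod a" "p * l"] vanishes_cong[OF n_pos ** **[OF m1], of m "m mod a" X] by blast
  qed
  have lrest: "vanishes n X (l * m) (l * m')" if r: "(m, m') \<in> rest" for l m m'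
  proof (rule weyl_eigenvalue.grid_line_vanishes[where q = a and r = p and ?c0.0 = "a - 1", OF base_eigenvalue])
    have "m' = 1 \<or> m' = crt_index p a 0 1 \<or> m' = crt_index p a 1 0"
      using r unfolding rest_def odd_Sigma_def by blast
    then show "vanishes n X (p * l * m) (p * l * m')" "vanishes n X (a * l * m) (a * l * m')" for l
      using vp[of m'] va[of m'] crt_index(2,3) cong_refl by blast+
    fix c assume c: "c < a" "c \<noteq> a - 1"
    show "\<exists>k0. \<forall>k<n. k mod a = c \<longrightarrow> k \<noteq> k0 \<longrightarrow>
        pairing_form n X (wproj n m m' (1 * unity_root n ^ k)) = 0"
    proof (intro exI allI impI)
      \<comment> \<open>In the class of \<open>c\<close> modulo \<open>a\<close> the kept labels
        have residue at most \<open>p - 2\<close> modulo \<open>p\<close>, so only the one with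
        residue \<open>p - 1\<close> is missing.\<close>
      fix k assume k: "k < n" "k mod a = c" "k \<noteq> crt_index p a c (p - 1)"
      have kc: "[k = c] (mod a)" using k(2) c by (simp add: cong_def)
      have kp: "[k = k mod p] (mod p)" by (simp add: cong_def)
      have "k mod p \<noteq> p - 1" using crt_index_unique[OF k(1) kc] kp k(3) by metis
      moreover have "k mod p < p" using p_pos by simp
      ultimately have "k mod p \<in> {0..p-2}" by auto
      moreover have "c \<in> {0..a-2}" using c by auto
      ultimately have "odd_proj p a (m, m') (crt_index p a c (k mod p)) \<in> F4" using r unfolding F4_def by blast
      then show "pairing_form n X (wproj n m m' (1 * unity_root n ^ k)) = 0"
        using X unfolding crt_index_unique[OF k(1) kc kp] family_eq odd_proj_eq by blast
    qed
  qed (use coprime_ap in \<open>simp_all add: n_eq\<close>)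
  have lSigma: "vanishes n X (l * m) (l * m')" if s: "(m, m') \<in> odd_Sigma p a" for l m m'
  proof -
    consider "(m, m') \<in> rest" | "(m, m') = (1, 0)" | b where "(m, m') = (b, 1)" "b \<in> {0..a-1}"
      using s unfolding rest_def by blast
    then show ?thesis
    proof cases
      case (3 b)
      then have "b < a" using a_pos by auto
      then show ?thesis using l2[of b l] 3(1) by simp
    qed (use lrest l10[of l] in auto)
  qed
  show "vanishes n X x y"
  proof (rule two_primes_cover[of p a])
    fix \<alpha> \<beta> \<alpha>' \<beta>' assume d: "(\<alpha>, \<beta>) \<in> directions p" "(\<alpha>', \<beta>') \<in> directions a"
    have "\<exists>m m'. (m, m') \<in> odd_Sigma p a \<and>
      [m = \<alpha>] (mod p) \<and> [m' = \<beta>] (mod p) \<and> [m = \<alpha>'] (mod a) \<and> [m' = \<beta>'] (mod a)"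
    proof -
      consider "(\<alpha>, \<beta>) = (1, 0)" "(\<alpha>', \<beta>') = (1, 0)"
        | t where "(\<alpha>, \<beta>) = (t, 1)" "t \<in> {0..p-1}" "(\<alpha>', \<beta>') = (1, 0)"
        | b where "(\<alpha>, \<beta>) = (1, 0)" "(\<alpha>', \<beta>') = (b, 1)" "b \<in> {0..a-1}"
        | t b where "(\<alpha>, \<beta>) = (t, 1)" "t \<in> {0..p-1}" "(\<alpha>', \<beta>') = (b, 1)" "b \<in> {0..a-1}"
        using d by (auto simp: directions_def)
      then show ?thesis
      proof cases
        case 1
        then show ?thesis by (intro exI[of _ 1] exI[of _ 0]) (auto simp: odd_Sigma_def)
      next
        case (2 t)
        then have "(crt_index p a 1 t, crt_index p a 0 1) \<in> odd_Sigma p a" unfolding odd_Sigma_def by blast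
        then show ?thesis using 2(1,3) crt_index(2,3) by blast
      next
        case (3 b)
        then have "(crt_index p a b 1, crt_index p a 1 0) \<in> odd_Sigma p a" unfolding odd_Sigma_def by blast
        then show ?thesis using 3(1,2) crt_index(2,3) by blast
      next
        case (4 t b)
        then have "(crt_index p a b t, 1) \<in> odd_Sigma p a" unfolding odd_Sigma_def by blast
        then show ?thesis using 4(1,3) crt_index(2,3) cong_refl by blast
      qed
    qed
    then show "\<exists>m m'. [m = \<alpha>] (mod p) \<and> [m' = \<beta>] (mod p) \<and> [m = \<alpha>'] (mod a) \<and> [m' = \<beta>'] (mod a) \<and>
        (\<forall>l. vanishes n X (l * m) (l * m'))"
      using lSigma by blast
  qed (use p a less n_eq in auto)
qed

lemma family_good: "good_system n (odd_family p a)"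
  using family_card family_separating weyl_projection_trace_one[OF family_weyl_projection]
  by (simp add: good_system_def)

end

section \<open>Tensor products\<close>

lemma tensor_mat_dim [simp]:
  "dim_row (tensor_mat A B) = dim_row A * dim_row B" "dim_col (tensor_mat A B) = dim_col A * dim_col B"
  by (simp_all add: tensor_mat_def)

lemma tensor_mat_carrier:
  "A \<in> carrier_mat m m' \<Longrightarrow> B \<in> carrier_mat n n' \<Longrightarrow> tensor_mat A B \<in> carrier_mat (m * n) (m' * n')"
  by (auto intro: carrier_matI)

lemma tensor_mat_index:
  assumes "A \<in> carrier_mat m m'" "B \<in> carrier_mat n n'" "i < m * n" "j < m' * n'"
  shows "tensor_mat A B $$ (i, j) = A $$ (i div n, j div n') * B $$ (i mod n, j mod n')"
  using assms by (auto simp: tensor_mat_def)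

lemma index_div_mod_less:
  fixes i m n :: nat
  assumes "i < m * n"
  shows "i div n < m" "i mod n < n"
proof -
  have "n > 0" using assms by (cases n) auto
  then show "i div n < m" "i mod n < n" using assms by (auto simp: less_mult_imp_div_less)
qed

lemma tensor_mat_mult:
  assumes A: "A \<in> carrier_mat m m" "C \<in> carrier_mat m m" and B: "B \<in> carrier_mat n n" "D \<in> carrier_mat n n"
  shows "tensor_mat A B * tensor_mat C D = tensor_mat (A * C) (B * D)"
proof (rule eq_matI)
  fix i j assume "i < dim_row (tensor_mat (A * C) (B * D))" "j < dim_col (tensor_mat (A * C) (B * D))"
  then have ij: "i < m * n" "j < m * n" using A B by auto
  note [simp] = index_div_mod_less[OF ij(1)] index_div_mod_less[OF ij(2)]
  have "(tensor_mat A B * tensor_mat C D) $$ (i, j)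
      = (\<Sum>k<m * n. tensor_mat A B $$ (i, k) * tensor_mat C D $$ (k, j))"
    using A B ij by (intro mult_mat_index[OF tensor_mat_carrier tensor_mat_carrier])
  also have "\<dots> = (\<Sum>k<m * n. (A $$ (i div n, k div n) * C $$ (k div n, j div n))
      * (B $$ (i mod n, k mod n) * D $$ (k mod n, j mod n)))"
    using A B ij by (intro sum.cong refl) (simp add: tensor_mat_index[of _ m m _ n n])
  also have "\<dots> = (\<Sum>k<m. \<Sum>l<n. (A $$ (i div n, k) * C $$ (k, j div n)) * (B $$ (i mod n, l) * D $$ (l, j mod n)))"
    by (rule sum_lessThan_mult)
  also have "\<dots> = (\<Sum>k<m. A $$ (i div n, k) * C $$ (k, j div n)) * (\<Sum>l<n. B $$ (i mod n, l) * D $$ (l, j mod n))"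
    by (simp add: sum_product)
  also have "\<dots> = (A * C) $$ (i div n, j div n) * (B * D) $$ (i mod n, j mod n)"
    using A B by (simp add: mult_mat_index[of _ m m _ m] mult_mat_index[of _ n n _ n] del: index_mult_mat)
  also have "\<dots> = tensor_mat (A * C) (B * D) $$ (i, j)"
    using A B ij by (intro tensor_mat_index[symmetric]) auto
  finally show "(tensor_mat A B * tensor_mat C D) $$ (i, j) = tensor_mat (A * C) (B * D) $$ (i, j)" .
qed (use A B in auto)

lemma mat_trace_tensor:
  assumes "A \<in> carrier_mat m m" "B \<in> carrier_mat n n"
  shows "mat_trace (tensor_mat A B) = mat_trace A * mat_trace B"
proof -
  have "mat_trace (tensor_mat A B) = (\<Sum>k<m * n. A $$ (k div n, k div n) * B $$ (k mod n, k mod n))"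
    using assms by (simp add: mat_trace_def tensor_mat_index[of _ m m _ n n])
  also have "\<dots> = (\<Sum>i<m. \<Sum>j<n. A $$ (i, i) * B $$ (j, j))"
    by (rule sum_lessThan_mult)
  finally show ?thesis using assms by (simp add: mat_trace_def sum_product)
qed

lemma mat_adjoint_tensor:
  assumes "A \<in> carrier_mat m m" "B \<in> carrier_mat n n"
  shows "mat_adjoint (tensor_mat A B) = tensor_mat (mat_adjoint A) (mat_adjoint B)"
proof (rule eq_matI)
  fix i j assume "i < dim_row (tensor_mat (mat_adjoint A) (mat_adjoint B))"
    "j < dim_col (tensor_mat (mat_adjoint A) (mat_adjoint B))"
  then have ij: "i < m * n" "j < m * n" using assms by auto
  have "mat_adjoint A \<in> carrier_mat m m" "mat_adjoint B \<in> carrier_mat n n"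
    using assms by (auto intro: carrier_matI)
  then show "mat_adjoint (tensor_mat A B) $$ (i, j) = tensor_mat (mat_adjoint A) (mat_adjoint B) $$ (i, j)"
    using assms ij index_div_mod_less[OF ij(1)] index_div_mod_less[OF ij(2)]
    by (simp add: tensor_mat_index[of _ m m _ n n])
qed (use assms in auto)

lemma trace_one_projection_tensor:
  assumes "trace_one_projection m P" "trace_one_projection n Q"
  shows "trace_one_projection (m * n) (tensor_mat P Q)"
  using assms tensor_mat_mult[of P m P Q n Q] mat_adjoint_tensor[of P m Q n] mat_trace_tensor[of P m Q n]
    tensor_mat_carrier[of P m m Q n n]
  by (simp add: trace_one_projection_def orth_projection_def)

lemma separating_tensor:
  assumes S: "separating m S" "S \<subseteq> carrier_mat m m" and T: "separating n T" "T \<subseteq> carrier_mat n n"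
  shows "separating (m * n) {tensor_mat P Q | P Q. P \<in> S \<and> Q \<in> T}"
  unfolding separating_def
proof (intro allI impI)
  fix X i j assume X: "\<forall>R\<in>{tensor_mat P Q | P Q. P \<in> S \<and> Q \<in> T}. pairing_form (m * n) X R = 0"
    and ij: "i < m * n" "j < m * n"
  \<comment> \<open>\<open>Y Q\<close> is the functional on the first factor obtained by freezing
    \<open>Q\<close>; once it vanishes, each block of \<open>X\<close> is a functional on the second
    factor.\<close>
  define Y where "Y Q i' j' = pairing_form n (\<lambda>i'' j''. X (i' * n + i'') (j' * n + j'')) Q" for Q i' j'
  have Y0: "Y Q i' j' = 0" if Q: "Q \<in> T" and ij': "i' < m" "j' < m" for Q i' j'
  proof -
    have "pairing_form m (Y Q) P = 0" if P: "P \<in> S" for P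
    proof -
      have Pc: "P \<in> carrier_mat m m" and Qc: "Q \<in> carrier_mat n n" using P Q S T by auto
      define f where "f i' i'' j' j'' = P $$ (i', j') * Q $$ (i'', j'') * X (i' * n + i'') (j' * n + j'')" for i' i'' j' j''
      have "0 = pairing_form (m * n) X (tensor_mat P Q)" using X P Q by fastforce
      also have "\<dots> = (\<Sum>i<m * n. \<Sum>j<m * n. f (i div n) (i mod n) (j div n) (j mod n))"
        unfolding pairing_form_def using Pc Qc
        by (intro sum.cong refl) (simp add: tensor_mat_index[of _ m m _ n n] f_def)
      also have "\<dots> = (\<Sum>i<m * n. \<Sum>j'<m. \<Sum>j''<n. f (i div n) (i mod n) j' j'')"
        by (rule sum.cong[OF refl], rule sum_lessThan_mult)
      also have "\<dots> = (\<Sum>i'<m. \<Sum>i''<n. \<Sum>j'<m. \<Sum>j''<n. f i' i'' j' j'')"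
        by (rule sum_lessThan_mult)
      also have "\<dots> = (\<Sum>i'<m. \<Sum>j'<m. \<Sum>i''<n. \<Sum>j''<n. f i' i'' j' j'')"
        by (rule sum.cong[OF refl], rule sum.swap)
      also have "\<dots> = pairing_form m (Y Q) P"
        by (simp add: pairing_form_def Y_def f_def sum_distrib_left mult.assoc)
      finally show ?thesis by simp
    qed
    then show ?thesis using S(1) ij' unfolding separating_def by blast
  qed
  have d: "i div n < m" "i mod n < n" "j div n < m" "j mod n < n"
    using index_div_mod_less ij by blast+
  define Z where "Z i'' j'' = X (i div n * n + i'') (j div n * n + j'')" for i'' j''
  have "pairing_form n Z Q = 0" if "Q \<in> T" for Q
    using Y0[OF that d(1,3)] by (simp add: Y_def Z_def[abs_def])
  then have "Z (i mod n) (j mod n) = 0" using T(1) d unfolding separating_def by blast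
  then show "X i j = 0" by (simp add: Z_def)
qed

lemma good_system_carrier: "good_system n S \<Longrightarrow> S \<subseteq> carrier_mat n n"
  using trace_one_projection_carrier by (auto simp: good_system_def)

lemma good_system_tensor:
  assumes S: "good_system m S" and T: "good_system n T"
  shows "good_system (m * n) {tensor_mat P Q | P Q. P \<in> S \<and> Q \<in> T}"
proof -
  have img: "{tensor_mat P Q | P Q. P \<in> S \<and> Q \<in> T} = (\<lambda>(P, Q). tensor_mat P Q) ` (S \<times> T)" by auto
  have fin: "finite S" "finite T" using S T by (auto simp: good_system_def)
  have "card ((\<lambda>(P, Q). tensor_mat P Q) ` (S \<times> T)) \<le> card (S \<times> T)"
    using fin by (intro card_image_le) auto
  also have "\<dots> \<le> m\<^sup>2 * n\<^sup>2" using S T by (simp add: good_system_def card_cartesian_product mult_le_mono)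
  finally have "card {tensor_mat P Q | P Q. P \<in> S \<and> Q \<in> T} \<le> (m * n)\<^sup>2"
    by (simp add: img power_mult_distrib)
  moreover have "finite {tensor_mat P Q | P Q. P \<in> S \<and> Q \<in> T}" using fin by (simp add: img)
  moreover have "separating (m * n) {tensor_mat P Q | P Q. P \<in> S \<and> Q \<in> T}"
    using S T good_system_carrier by (intro separating_tensor) (auto simp: good_system_def)
  ultimately show ?thesis
    using S T trace_one_projection_tensor by (auto simp: good_system_def)
qed

lemma good_system_unit: "good_system 1 {1\<^sub>m 1}"
proof -
  have "orth_projection 1 (1\<^sub>m 1)"
    unfolding orth_projection_def by (auto intro!: eq_matI)
  then show ?thesis
    by (auto simp: good_system_def trace_one_projection_def mat_trace_one separating_def pairing_form_def)
qed

lemma tensor_system_Nil: "tensor_system Fam [] = {1\<^sub>m 1}"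
  by (auto simp: tensor_system_def tensor_list_def)

lemma tensor_system_Cons:
  "tensor_system Fam (n # ds) = {tensor_mat P Q | P Q. P \<in> Fam n \<and> Q \<in> tensor_system Fam ds}"
proof (intro equalityI subsetI)
  fix R assume "R \<in> tensor_system Fam (n # ds)"
  then obtain Ps where "R = tensor_list Ps" "list_all2 (\<lambda>P n. P \<in> Fam n) Ps (n # ds)"
    by (auto simp: tensor_system_def)
  then obtain P Ps' where "R = tensor_mat P (tensor_list Ps')" "P \<in> Fam n" "list_all2 (\<lambda>P n. P \<in> Fam n) Ps' ds"
    by (auto simp: list_all2_Cons2 tensor_list_def)
  then show "R \<in> {tensor_mat P Q | P Q. P \<in> Fam n \<and> Q \<in> tensor_system Fam ds}"
    unfolding tensor_system_def by blast
next
  fix R assume "R \<in> {tensor_mat P Q | P Q. P \<in> Fam n \<and> Q \<in> tensor_system Fam ds}"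
  then obtain P Ps where "P \<in> Fam n" "R = tensor_mat P (tensor_list Ps)" "list_all2 (\<lambda>P n. P \<in> Fam n) Ps ds"
    by (auto simp: tensor_system_def)
  then show "R \<in> tensor_system Fam (n # ds)"
    unfolding tensor_system_def by (intro CollectI exI[of _ "P # Ps"]) (simp add: tensor_list_def)
qed

lemma good_system_tensor_system:
  assumes "\<forall>n\<in>set ds. good_system n (Fam n)"
  shows "good_system (prod_list ds) (tensor_system Fam ds)"
  using assms
proof (induction ds)
  case Nil
  then show ?case using good_system_unit by (simp add: tensor_system_Nil)
next
  case (Cons n ds)
  then show ?case using good_system_tensor[of n "Fam n"] by (simp add: tensor_system_Cons)
qed

section \<open>Overlaps of tensor products\<close>

lemma overlaps_tensor:
  assumes S: "S \<subseteq> carrier_mat m m" and T: "T \<subseteq> carrier_mat n n"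
  shows "overlaps {tensor_mat P Q | P Q. P \<in> S \<and> Q \<in> T} = {x * y | x y. x \<in> overlaps S \<and> y \<in> overlaps T}"
proof -
  have *: "mat_trace (tensor_mat P Q * tensor_mat P' Q') = mat_trace (P * P') * mat_trace (Q * Q')"
    if "P \<in> S" "P' \<in> S" "Q \<in> T" "Q' \<in> T" for P P' Q Q'
  proof -
    have c: "P \<in> carrier_mat m m" "P' \<in> carrier_mat m m" "Q \<in> carrier_mat n n" "Q' \<in> carrier_mat n n"
      using that S T by auto
    then show ?thesis using tensor_mat_mult[OF c] mat_trace_tensor[of "P * P'" m "Q * Q'" n] by simp
  qed
  show ?thesis
  proof (intro equalityI subsetI)
    fix x assume "x \<in> overlaps {tensor_mat P Q | P Q. P \<in> S \<and> Q \<in> T}"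
    then obtain P Q P' Q' where "P \<in> S" "P' \<in> S" "Q \<in> T" "Q' \<in> T"
      "x = mat_trace (tensor_mat P Q * tensor_mat P' Q')"
      by (auto simp: overlaps_def)
    then show "x \<in> {x * y | x y. x \<in> overlaps S \<and> y \<in> overlaps T}"
      using * unfolding overlaps_def by blast
  next
    fix x assume "x \<in> {x * y | x y. x \<in> overlaps S \<and> y \<in> overlaps T}"
    then obtain P Q P' Q' where "P \<in> S" "P' \<in> S" "Q \<in> T" "Q' \<in> T"
      "x = mat_trace (P * P') * mat_trace (Q * Q')"
      by (auto simp: overlaps_def)
    then show "x \<in> overlaps {tensor_mat P Q | P Q. P \<in> S \<and> Q \<in> T}"
      using *[of P P' Q Q'] unfolding overlaps_def by (simp only: mem_Collect_eq) metis
  qed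
qed

definition divisor_overlaps :: "nat \<Rightarrow> complex set" where
  "divisor_overlaps n = {0} \<union> {1 / of_nat d' | d'. d' > 0 \<and> d' dvd n}"

lemma divisor_overlaps_mult:
  "{x * y | x y. x \<in> divisor_overlaps m \<and> y \<in> divisor_overlaps n} = divisor_overlaps (m * n)"
proof (intro equalityI subsetI)
  fix z assume "z \<in> {x * y | x y. x \<in> divisor_overlaps m \<and> y \<in> divisor_overlaps n}"
  then obtain x y where z: "z = x * y" "x \<in> divisor_overlaps m" "y \<in> divisor_overlaps n" by blast
  show "z \<in> divisor_overlaps (m * n)"
  proof (cases "x = 0 \<or> y = 0")
    case False
    then obtain d e where "x = 1 / of_nat d" "y = 1 / of_nat e" "d > 0" "e > 0" "d dvd m" "e dvd n"
      using z by (auto simp: divisor_overlaps_def)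
    then have "z = 1 / of_nat (d * e)" "d * e > 0" "d * e dvd m * n"
      using z by (auto intro: mult_dvd_mono)
    then show ?thesis unfolding divisor_overlaps_def by blast
  qed (use z in \<open>auto simp: divisor_overlaps_def\<close>)
next
  fix z assume "z \<in> divisor_overlaps (m * n)"
  then consider "z = 0" | d where "z = 1 / of_nat d" "d > 0" "d dvd m * n"
    by (auto simp: divisor_overlaps_def)
  then show "z \<in> {x * y | x y. x \<in> divisor_overlaps m \<and> y \<in> divisor_overlaps n}"
  proof cases
    case 1
    then show ?thesis by (intro CollectI exI[of _ 0]) (auto simp: divisor_overlaps_def)
  next
    case (2 d)
    obtain b c where bc: "d = b * c" "b dvd m" "c dvd n" using division_decomp[OF 2(3)] by blast
    then have "1 / of_nat b \<in> divisor_overlaps m" "1 / of_nat c \<in> divisor_overlaps n"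
      using 2(2) by (auto simp: divisor_overlaps_def)
    moreover have "z = 1 / of_nat b * (1 / of_nat c)" using bc 2 by simp
    ultimately show ?thesis by blast
  qed
qed

text \<open>The empty list has the single overlap 1, without 0, so a one-element list is the base
  case.\<close>

lemma overlaps_tensor_system:
  assumes "\<forall>n\<in>set ds. good_system n (Fam n) \<and> overlaps (Fam n) = divisor_overlaps n" and "ds \<noteq> []"
  shows "overlaps (tensor_system Fam ds) = divisor_overlaps (prod_list ds)"
  using assms
proof (induction ds)
  case (Cons n ds)
  have c: "Fam n \<subseteq> carrier_mat n n" "tensor_system Fam ds \<subseteq> carrier_mat (prod_list ds) (prod_list ds)"
    using Cons.prems(1) good_system_tensor_system[of ds Fam] good_system_carrier by auto
  show ?case
  proof (cases "ds = []")
    case True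
    have "overlaps (tensor_system Fam ds) = {1}"
      by (simp add: True tensor_system_Nil overlaps_def mat_trace_one)
    then show ?thesis
      using Cons.prems(1) True by (simp add: tensor_system_Cons overlaps_tensor[OF c, unfolded True] )
  next
    case False
    then have "overlaps (tensor_system Fam ds) = divisor_overlaps (prod_list ds)" using Cons by simp
    then show ?thesis
      using Cons.prems(1) by (simp add: tensor_system_Cons overlaps_tensor[OF c] divisor_overlaps_mult)
  qed
qed simp

section \<open>Prime factorizations of the dimension\<close>

lemma prod_mset_sum: "finite A \<Longrightarrow> prod_mset (\<Sum>j\<in>A. f j) = (\<Prod>j\<in>A. prod_mset (f j))"
  by (induction A rule: finite_induct) auto

lemma prime_pair_good_system:
  assumes Fam: "projection_families Fam" and p: "prime p" "prime q" "p < q"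
  shows "good_system (p * q) (Fam (p * q))"
proof (cases "p = 2")
  case True
  have "odd q" using primes_dvd_imp_eq[OF two_is_prime_nat p(2)] p(3) True by auto
  then interpret even_dimension q "2 * q" using p by unfold_locales auto
  show ?thesis using family_good Fam a True unfolding projection_families_def by auto
next
  case False
  have "odd p" using primes_dvd_imp_eq[OF two_is_prime_nat p(1)] False by auto
  then interpret odd_dimension p q "p * q" using p by unfold_locales auto
  show ?thesis using family_good Fam assms(2-4) \<open>odd p\<close> unfolding projection_families_def by auto
qed

theorem theorem3p7p3:
  fixes d k :: nat and p s :: "nat \<Rightarrow> nat" and K :: "nat set"
    and Fam :: "nat \<Rightarrow> complex mat set"
  assumes "k \<ge> 1"
    and "\<And>j. j \<in> {1..k} \<Longrightarrow> prime (p j)"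
    and "strict_mono_on {1..k} p"
    and "\<And>j. j \<in> {1..k} \<Longrightarrow> s j \<ge> 1"
    and "d = (\<Prod>j\<in>{1..k}. p j ^ s j)"
    and "K = {j \<in> {1..k}. odd (s j)}"
    and "projection_families Fam"
  shows
    "(\<forall>ds. mset ds = square_factors k p s + image_mset p (mset_set K) \<longrightarrow>
        prod_list ds = d \<and>
        info_complete_system d (tensor_system Fam ds) \<and>
        overlaps (tensor_system Fam ds) = {0} \<union> {1 / of_nat d' | d'. d' > 0 \<and> d' dvd d}) \<and>
     (K \<noteq> {} \<and> even (card K) \<longrightarrow>
        (\<forall>M ds. pairing K M \<and> mset ds = square_factors k p s + pair_factors p M \<longrightarrow>
           prod_list ds = d \<and> info_complete_system d (tensor_system Fam ds))) \<and>
     (odd (card K) \<longrightarrow>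
        (\<forall>j\<^sub>0\<in>K. \<forall>M ds. pairing (K - {j\<^sub>0}) M \<and>
           mset ds = square_factors k p s + {#p j\<^sub>0#} + pair_factors p M \<longrightarrow>
           prod_list ds = d \<and> info_complete_system d (tensor_system Fam ds)))"
proof -
  have fin: "finite K" and K: "K \<subseteq> {1..k}" using assms(6) by auto
  define sq where "sq = square_factors k p s"
  have prod_sq: "prod_mset sq * (\<Prod>j\<in>K. p j) = d"
  proof -
    \<comment> \<open>The product over \<open>K\<close> is spread over all indices, with factor 1
      for even \<open>s j\<close>, so that both products can be compared index by index.\<close>
    have "(\<Prod>j\<in>K. p j) = (\<Prod>j\<in>{1..k}. if odd (s j) then p j else 1)"
      unfolding assms(6) by (rule prod.inter_filter) simp
    then have "prod_mset sq * (\<Prod>j\<in>K. p j) = (\<Prod>j\<in>{1..k}. ((p j)\<^sup>2) ^ (s j div 2) * (if odd (s j) then p j else 1))"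
      by (simp add: sq_def square_factors_def prod_mset_sum prod.distrib)
    also have "\<dots> = d"
      unfolding assms(5)
    proof (intro prod.cong refl)
      fix j
      have "p j ^ s j = p j ^ (2 * (s j div 2) + s j mod 2)" by simp
      then show "((p j)\<^sup>2) ^ (s j div 2) * (if odd (s j) then p j else 1) = p j ^ s j"
        by (simp only: power_add power_mult) (auto simp: odd_iff_mod_2_eq_one even_iff_mod_2_eq_zero)
    qed
    finally show ?thesis .
  qed
  have good_p: "good_system (p j) (Fam (p j)) \<and> overlaps (Fam (p j)) = divisor_overlaps (p j)"
    if "j \<in> {1..k}" for j
    using prime_family_properties[OF assms(2)[OF that], of "Fam (p j)"] assms(7) assms(2)[OF that]
    by (auto simp: projection_families_def divisor_overlaps_def)
  have good_sq: "good_system n (Fam n) \<and> overlaps (Fam n) = divisor_overlaps n" if n: "n \<in># sq" for n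
  proof -
    obtain j where j: "j \<in> {1..k}" "n = (p j)\<^sup>2"
      using n by (auto simp: sq_def square_factors_def in_replicate_mset set_mset_sum)
    interpret prime_square "p j" n using assms(2)[OF j(1)] j(2) by unfold_locales
    show ?thesis using family_properties[of "Fam n"] assms(7) p j(2)
      by (auto simp: projection_families_def divisor_overlaps_def)
  qed
  have good_pair: "good_system n (Fam n)" if M: "pairing K' M" "K' \<subseteq> {1..k}" and n: "n \<in># pair_factors p M" for K' M n
  proof -
    have "finite M" using M finite_elements[OF finite_subset[OF M(2)]] by (auto simp: pairing_def)
    then obtain e where e: "e \<in> M" "n = (\<Prod>j\<in>e. p j)" using n by (auto simp: pair_factors_def)
    then obtain i j where ij: "e = {i, j}" "i \<noteq> j" using M(1) by (auto simp: pairing_def card_2_iff)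
    have "e \<subseteq> {1..k}" using M e(1) unfolding pairing_def partition_on_def by blast
    then have ijk: "i \<in> {1..k}" "j \<in> {1..k}" using ij by auto
    have n2: "n = p i * p j" using e ij by simp
    show ?thesis
    \<comment> \<open>Strict monotonicity of \<open>p\<close> tells which prime is the smaller one,
      as the families for pairs require.\<close>
    proof (cases "i < j")
      case True
      then have "p i < p j" using strict_mono_onD[OF assms(3)] ijk by blast
      from prime_pair_good_system[OF assms(7) assms(2)[OF ijk(1)] assms(2)[OF ijk(2)] this]
      show ?thesis unfolding n2 .
    next
      case False
      then have "p j < p i" using strict_mono_onD[OF assms(3)] ijk ij(2) by (meson linorder_neqE_nat)
      from prime_pair_good_system[OF assms(7) assms(2)[OF ijk(2)] assms(2)[OF ijk(1)] this]
      show ?thesis unfolding n2 mult.commute[of "p i"] .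
    qed
  qed
  have prod_pair: "prod_mset (pair_factors p M) = (\<Prod>j\<in>K'. p j)" if M: "pairing K' M" and K': "K' \<subseteq> {1..k}" for K' M
  proof -
    have U: "\<Union>M = K'" "disjoint M" using M by (auto simp: pairing_def partition_on_def)
    have "(\<Prod>j\<in>\<Union>M. p j) = (\<Prod>e\<in>M. \<Prod>j\<in>e. p j)"
    proof -
      have "\<forall>e\<in>M. card e = 2" using M by (simp add: pairing_def)
      then have "\<forall>e\<in>M. finite e" by (simp add: card_ge_0_finite)
      then show ?thesis using U(2) prod.Union_disjoint[of M p] by (simp add: disjoint_def comp_def)
    qed
    then show ?thesis unfolding U pair_factors_def using prod_unfold_prod_mset[of "\<lambda>e. \<Prod>j\<in>e. p j" M] by simp
  qed
  have system: "prod_list ds = d \<and> info_complete_system d (tensor_system Fam ds)"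
    if ds: "prod_mset (mset ds) = d" "\<And>n. n \<in># mset ds \<Longrightarrow> good_system n (Fam n)" for ds
    using ds good_system_imp_info_complete[OF good_system_tensor_system[of ds Fam]]
    by (simp add: prod_mset_prod_list)
  have a: "prod_list ds = d \<and> info_complete_system d (tensor_system Fam ds) \<and>
      overlaps (tensor_system Fam ds) = {0} \<union> {1 / of_nat d' | d'. d' > 0 \<and> d' dvd d}"
    if ds: "mset ds = square_factors k p s + image_mset p (mset_set K)" for ds
  proof -
    have ds': "mset ds = sq + image_mset p (mset_set K)" using ds by (simp add: sq_def)
    have "prod_mset (mset ds) = d" unfolding ds' using prod_sq by (simp add: prod_unfold_prod_mset)
    moreover have g: "good_system n (Fam n) \<and> overlaps (Fam n) = divisor_overlaps n" if "n \<in># mset ds" for n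
      using that good_sq good_p K fin unfolding ds' by auto
    ultimately have 1: "prod_list ds = d \<and> info_complete_system d (tensor_system Fam ds)"
      by (intro system) auto
    \<comment> \<open>The prime \<open>p 1\<close> divides \<open>d\<close>, so \<open>d\<close> is
      not the empty product.\<close>
    have "ds \<noteq> []"
    proof
      assume "ds = []"
      then have "d = 1" using 1 by simp
      moreover have "p 1 ^ s 1 dvd d" unfolding assms(5) using assms(1) by (intro dvd_prodI) auto
      moreover have "p 1 dvd p 1 ^ s 1" using assms(4)[of 1] assms(1) by (intro dvd_power) auto
      ultimately show False using assms(1) assms(2)[of 1] by (auto dest: dvd_trans)
    qed
    then have "overlaps (tensor_system Fam ds) = divisor_overlaps (prod_list ds)"
      using g by (intro overlaps_tensor_system) auto
    then show ?thesis using 1 by (simp add: divisor_overlaps_def)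
  qed
  have b: "prod_list ds = d \<and> info_complete_system d (tensor_system Fam ds)"
    if M: "pairing K M" and ds: "mset ds = square_factors k p s + pair_factors p M" for M ds
  proof (rule system)
    have ds': "mset ds = sq + pair_factors p M" using ds by (simp add: sq_def)
    show "prod_mset (mset ds) = d" unfolding ds' using prod_sq prod_pair[OF M K] by simp
    show "good_system n (Fam n)" if "n \<in># mset ds" for n
      using that good_sq good_pair[OF M K] unfolding ds' by auto
  qed
  have c: "prod_list ds = d \<and> info_complete_system d (tensor_system Fam ds)"
    if j: "j\<^sub>0 \<in> K" and M: "pairing (K - {j\<^sub>0}) M"
      and ds: "mset ds = square_factors k p s + {#p j\<^sub>0#} + pair_factors p M" for j\<^sub>0 M ds
  proof (rule system)
    have ds': "mset ds = sq + {#p j\<^sub>0#} + pair_factors p M" using ds by (simp add: sq_def)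
    have K': "K - {j\<^sub>0} \<subseteq> {1..k}" using K by blast
    have "(\<Prod>j\<in>K. p j) = p j\<^sub>0 * (\<Prod>j\<in>K - {j\<^sub>0}. p j)" using prod.remove[OF fin j] .
    then show "prod_mset (mset ds) = d" unfolding ds' prod_sq[symmetric] using prod_pair[OF M K'] by simp
    show "good_system n (Fam n)" if "n \<in># mset ds" for n
      using that good_sq good_pair[OF M K'] good_p[of "j\<^sub>0"] j K unfolding ds' by auto
  qed
  show ?thesis using a b c by blast
qed

end
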